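(* Let $V_L$ be the Perron-Frobenius operator of the left shift on the two-sided full $2$-shift $\Sigma=\{0,1\}^{\mathbb{Z}}$ with the uniform Bernoulli measure, and let $V_L(\varepsilon)=Q_0+\varepsilon Q_1$, $X_-$, $X_+'$ be as defined in the context. For any $0\le\varepsilon\le1$: (1) The resolvent $(\lambda-V_L(\varepsilon))^{-1}$ has an analytic continuation to the inside of the unit circle as an operator from $X_-$ into $X_+'$. The generalized eigenvalues with respect to the Gelfand triplet $X_-\subset L^2(\Sigma)\subset X_+'$ are $2^{-k}$, $k=0,1,2,\dots$. (2) The generalized eigenspace of the generalized eigenvalue $2^{-k}$ is a $(k+1)$-dimensional space. When $\varepsilon\ne0$, its algebraic multiplicity is $k+1$ and its geometric multiplicity is $1$. (3) The statements (1) and (2) hold for the Perron-Frobenius operator $V_L$ of the two-sided shift (that is, with $V_L$ in place of $V_L(\varepsilon)$, with algebraic multiplicity $k+1$ and geometric multiplicity $1$).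
   Context: Setting: $\Sigma=\{0,1\}^{\mathbb{Z}}$, $\omega=(\cdots,\omega_{-1},\omega_0.\,\omega_1,\cdots)$, with $\mu$ the product of the measures $\mu_0(\{0\})=\mu_0(\{1\})=1/2$. $\Sigma_+$ is the space of halves $\omega_+=(\omega_1,\omega_2,\dots)$ and $\Sigma_-$ that of halves $\omega_-=(\omega_0,\omega_{-1},\dots)$, each $\cong\{0,1\}^{\mathbb{N}}$ with product measure $\mu_\pm$. $L^2(\Sigma)\cong L^2(\Sigma_+)\otimes L^2(\Sigma_-)$ (Hilbert tensor product) via $f\otimes g\mapsto f(\omega_+)g(\omega_-)$. Inner products are linear in the first variable. Operators: $V_L$ is the adjoint of the Koopman operator $U_L$ of $(S_L\omega)_j=\omega_{j+1}$; it is unitary and $(V_Lf)(\omega)=f(\cdots,\omega_{-2},\omega_{-1}.\,\omega_0,\cdots)$. On $L^2(\Sigma_+)$: $(U_{L+}f)(\omega_1,\omega_2,\dots)=f(\omega_2,\omega_3,\dots)$, $V_{L+}=U_{L+}^*$. On $L^2(\Sigma_-)$: $(U_{R-}f)(\cdots,\omega_{-1},\omega_0)=f(\cdots,\omega_{-2},\omega_{-1})$, $V_{R-}=U_{R-}^*$. Let $(-1)^{\omega_1}$, $(-1)^{\omega_0}$ also denote the corresponding multiplication operators on $L^2(\Sigma_+)$, $L^2(\Sigma_-)$. Set $$Q_0=V_{L+}\otimes U_{R-},\quad Q_1=V_{L+}(-1)^{\omega_1}\otimes(-1)^{\omega_0}U_{R-},\quad V_L(\varepsilon)=Q_0+\varepsilon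 Q_1 ;$$ one has $V_L(1)=V_L$. Spaces: $h(\omega_+)=\sum_{i\ge1}\omega_i2^{-i}$ on $\Sigma_+$; $P_M(\Sigma_+)=\bigoplus_{i=0}^M\mathbb{C}h^i$, $P(\Sigma_+)=\varinjlim P_M(\Sigma_+)$ with the inductive limit topology; $P_M(\Sigma_-)=i^*P_M(\Sigma_+)$ and $P(\Sigma_-)=i^*P(\Sigma_+)$, where $i:\Sigma_-\to\Sigma_+$, $(\cdots,\omega_{-1},\omega_0)\mapsto(\omega_0,\omega_{-1},\cdots)$. $X_+=L^2(\Sigma_+)\otimes P(\Sigma_-)=\varinjlim L^2(\Sigma_+)\otimes P_M(\Sigma_-)$ and $X_-=P(\Sigma_+)\otimes L^2(\Sigma_-)=\varinjlim P_M(\Sigma_+)\otimes L^2(\Sigma_-)$ with strict inductive limit topologies; both are dense in $L^2(\Sigma)$ with stronger topologies. $X_\pm'$ is the space of continuous anti-linear functionals on $X_\pm$ with the weak* topology, and $L^2(\Sigma)\subset X_\pm'$ via $g\mapsto(g,\cdot)$; $X_-\subset L^2(\Sigma)\subset X_+'$ is called a Gelfand triplet. The adjoint $V_L(\varepsilon)^*$ is continuous on $X_+$, and its dual $V_L(\varepsilon)^\times:X_+'\to X_+'$ is given by $\langle V_L(\varepsilon)^\times\mu|g\rangle=\langle\mu|V_L(\varepsilon)^*g\rangle$. Generalized spectrum of an operator $T$ ($=V_L(\varepsilon)$): for $f\in X_-$ the map $\lambda\mapsto(\lambda-T)^{-1}f\in L^2(\Sigma)\subset X_+'$ is holomorphic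 for $|\lambda|$ large. The resolvent has an analytic continuation as an operator from $X_-$ into $X_+'$ if, for every $f\in X_-$, this $X_+'$-valued function continues analytically (weak* sense, i.e. after pairing with each $g\in X_+$) to the inside of the unit circle, outside a set of singularities; the continuation $R_\lambda:X_-\to X_+'$ is the generalized resolvent and the set of its singularities is the generalized spectrum. For an isolated singularity $\lambda_0$, the Riesz projection is $\Pi_{\lambda_0}f=\frac1{2\pi i}\oint_CR_zf\,dz$ ($C$ a positively oriented closed curve encircling $\lambda_0$ and no other singularity). Such a $\lambda_0$ is a generalized eigenvalue if it has associated eigenvectors in $X_+'$; its generalized eigenspace is the image of $\Pi_{\lambda_0}$ in $X_+'$. The algebraic multiplicity is the dimension of the generalized eigenspace; the geometric multiplicity is the dimension of the space of $\mu$ in the generalized eigenspace with $T^\times\mu=\lambda_0\mu$. *)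

theory Defs
  imports
    "HOL-Probability.Probability"
    "HOL-Complex_Analysis.Complex_Analysis"
    "HOL-Library.Function_Algebras"
begin

section \<open>Bernoulli measure and the spaces L2\<close>

text \<open>
  The symbols 0 and 1 are the Booleans False and True. A point of the two-sided shift space is
  a function \<open>\<omega> :: int \<Rightarrow> bool\<close>. Both one-sided spaces are modelled by \<open>nat \<Rightarrow> bool\<close>:
  the half \<open>(\<omega>\<^sub>1, \<omega>\<^sub>2, \<dots>)\<close> is the function sending \<open>n\<close> to \<open>\<omega> (1 + n)\<close>, and the half
  \<open>(\<omega>\<^sub>0, \<omega>\<^sub>-\<^sub>1, \<dots>)\<close> is the function sending \<open>n\<close> to \<open>\<omega> (- n)\<close>. In these coordinates the map \<open>i\<close>
  from the left halves to the right halves is the identity.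
\<close>

definition bernoulli :: "('i \<Rightarrow> bool) measure" where
  "bernoulli = PiM UNIV (\<lambda>_. measure_pmf (bernoulli_pmf (1/2)))"

definition right_half :: "(int \<Rightarrow> bool) \<Rightarrow> nat \<Rightarrow> bool" where
  "right_half \<omega> n = \<omega> (1 + int n)"

definition left_half :: "(int \<Rightarrow> bool) \<Rightarrow> nat \<Rightarrow> bool" where
  "left_half \<omega> n = \<omega> (- int n)"

definition square_integrable :: "(('i \<Rightarrow> bool) \<Rightarrow> complex) \<Rightarrow> bool" where
  "square_integrable f \<longleftrightarrow>
     f \<in> borel_measurable bernoulli \<and> integrable bernoulli (\<lambda>\<omega>. (cmod (f \<omega>))\<^sup>2)"

definition L2_rel :: "(('i \<Rightarrow> bool) \<Rightarrow> complex) \<Rightarrow> (('i \<Rightarrow> bool) \<Rightarrow> complex) \<Rightarrow> bool" where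
  "L2_rel f g \<longleftrightarrow>
     square_integrable f \<and> square_integrable g \<and> (AE \<omega> in bernoulli. f \<omega> = g \<omega>)"

lemma prob_space_bernoulli: "prob_space (bernoulli :: ('i \<Rightarrow> bool) measure)"
  unfolding bernoulli_def by (intro prob_space_PiM measure_pmf.prob_space_axioms)

lemma space_bernoulli [simp]: "space bernoulli = UNIV"
  by (simp add: bernoulli_def space_PiM)

lemma square_integrable_zero [simp]: "square_integrable (\<lambda>_. 0)"
  by (simp add: square_integrable_def)

quotient_type 'i L2 = "('i \<Rightarrow> bool) \<Rightarrow> complex" / partial: L2_rel
proof (rule part_equivpI)
  show "\<exists>x :: ('i \<Rightarrow> bool) \<Rightarrow> complex. L2_rel x x"
    by (rule exI[of _ "\<lambda>_. 0"]) (simp add: L2_rel_def)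
  show "symp (L2_rel :: (('i \<Rightarrow> bool) \<Rightarrow> complex) \<Rightarrow> _)"
    by (auto simp: symp_def L2_rel_def)
  show "transp (L2_rel :: (('i \<Rightarrow> bool) \<Rightarrow> complex) \<Rightarrow> _)"
    unfolding transp_def L2_rel_def by (auto elim: AE_mp)
qed

lemma measurable_cnj [measurable (raw)]:
  "f \<in> borel_measurable M \<Longrightarrow> (\<lambda>x. cnj (f x)) \<in> borel_measurable M"
  by (rule borel_measurable_continuous_on[OF continuous_on_cnj[OF continuous_on_id]])

lemma square_integrable_mult:
  assumes "square_integrable f" "square_integrable g"
  shows "integrable bernoulli (\<lambda>\<omega>. f \<omega> * cnj (g \<omega>))"
proof (rule Bochner_Integration.integrable_bound)
  show "integrable bernoulli (\<lambda>\<omega>. (cmod (f \<omega>))\<^sup>2 + (cmod (g \<omega>))\<^sup>2)"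
    using assms by (auto simp: square_integrable_def)
  show "(\<lambda>\<omega>. f \<omega> * cnj (g \<omega>)) \<in> borel_measurable bernoulli"
    using assms by (auto simp: square_integrable_def intro!: borel_measurable_times measurable_cnj)
  have "a * b \<le> a\<^sup>2 + b\<^sup>2" for a b :: real
  proof -
    have "a * b \<le> \<bar>a * b\<bar>" by simp
    also have "\<dots> \<le> 2 * \<bar>a\<bar> * \<bar>b\<bar>" by (simp add: abs_mult)
    also have "\<dots> \<le> a\<^sup>2 + b\<^sup>2" using sum_squares_bound[of "\<bar>a\<bar>" "\<bar>b\<bar>"] by simp
    finally show ?thesis .
  qed
  then show "AE \<omega> in bernoulli. norm (f \<omega> * cnj (g \<omega>)) \<le> norm ((cmod (f \<omega>))\<^sup>2 + (cmod (g \<omega>))\<^sup>2)"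
    by (simp add: norm_mult)
qed

lemma square_integrable_add:
  assumes "square_integrable f" "square_integrable g"
  shows "square_integrable (\<lambda>\<omega>. f \<omega> + g \<omega>)"
  unfolding square_integrable_def
proof
  show m: "(\<lambda>\<omega>. f \<omega> + g \<omega>) \<in> borel_measurable bernoulli"
    using assms by (auto simp: square_integrable_def)
  show "integrable bernoulli (\<lambda>\<omega>. (cmod (f \<omega> + g \<omega>))\<^sup>2)"
  proof (rule Bochner_Integration.integrable_bound)
    show "integrable bernoulli (\<lambda>\<omega>. 2 * (cmod (f \<omega>))\<^sup>2 + 2 * (cmod (g \<omega>))\<^sup>2)"
      using assms by (auto simp: square_integrable_def)
    show "(\<lambda>\<omega>. (cmod (f \<omega> + g \<omega>))\<^sup>2) \<in> borel_measurable bernoulli"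
      using m by measurable
    have "(cmod (a + b))\<^sup>2 \<le> 2 * (cmod a)\<^sup>2 + 2 * (cmod b)\<^sup>2" for a b
    proof -
      have "(cmod (a + b))\<^sup>2 \<le> (cmod a + cmod b)\<^sup>2"
        by (intro power_mono norm_triangle_ineq norm_ge_zero)
      also have "\<dots> \<le> 2 * (cmod a)\<^sup>2 + 2 * (cmod b)\<^sup>2"
        using sum_squares_bound[of "cmod a" "cmod b"] by (simp add: power2_sum)
      finally show ?thesis .
    qed
    then show "AE \<omega> in bernoulli. norm ((cmod (f \<omega> + g \<omega>))\<^sup>2)
        \<le> norm (2 * (cmod (f \<omega>))\<^sup>2 + 2 * (cmod (g \<omega>))\<^sup>2)"
      by simp
  qed
qed

lemma square_integrable_cmult:
  assumes "square_integrable f"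
  shows "square_integrable (\<lambda>\<omega>. c * f \<omega>)"
  using assms by (auto simp: square_integrable_def norm_mult power_mult_distrib)

lemma square_integrable_bounded:
  assumes "f \<in> borel_measurable bernoulli" "\<And>\<omega>. cmod (f \<omega>) \<le> B"
  shows "square_integrable f"
proof -
  interpret prob_space "bernoulli :: ('a \<Rightarrow> bool) measure" by (rule prob_space_bernoulli)
  have "(cmod (f \<omega>))\<^sup>2 \<le> B\<^sup>2" for \<omega>
    using assms(2)[of \<omega>] by (intro power_mono) auto
  then show ?thesis
    using assms(1) unfolding square_integrable_def
    by (auto intro!: integrable_const_bound[where B = "B\<^sup>2"])
qed

lemma measurable_component_pmf:
  "i \<in> I \<Longrightarrow> (\<lambda>\<omega>. \<omega> i) \<in> measurable (PiM I (\<lambda>_. measure_pmf p)) (count_space UNIV)"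
  by (subst measurable_cong_sets[OF refl sets_measure_pmf_count_space[symmetric, of p]])
    (auto intro: measurable_component_singleton)

lemma measurable_coordinate [measurable]:
  "(\<lambda>\<omega>. \<omega> i) \<in> measurable bernoulli (count_space UNIV)"
  unfolding bernoulli_def by (simp add: measurable_component_pmf)

lemma distr_bernoulli_reindex:
  assumes "inj \<sigma>"
  shows "distr bernoulli bernoulli (\<lambda>\<omega>. \<omega> \<circ> \<sigma>) = bernoulli"
  using distr_PiM_reindex[of UNIV "\<lambda>_. measure_pmf (bernoulli_pmf (1/2))" \<sigma> UNIV] assms
  by (simp add: bernoulli_def measure_pmf.prob_space_axioms comp_def restrict_UNIV)

lemma measurable_reindex [measurable]:
  "(\<lambda>\<omega>. \<omega> \<circ> \<sigma>) \<in> measurable bernoulli bernoulli"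
proof -
  have "(\<lambda>\<omega> i. \<omega> (\<sigma> i)) \<in> measurable bernoulli (PiM UNIV (\<lambda>_. measure_pmf (bernoulli_pmf (1/2))))"
    by (rule measurable_PiM_single')
      (auto simp: measurable_cong_sets[OF refl sets_measure_pmf_count_space])
  then show ?thesis by (simp add: bernoulli_def comp_def)
qed

lemma square_integrable_reindex:
  assumes "inj \<sigma>" "square_integrable f"
  shows "square_integrable (\<lambda>\<omega>. f (\<omega> \<circ> \<sigma>))"
proof -
  have f: "f \<in> borel_measurable bernoulli" "integrable bernoulli (\<lambda>\<omega>. (cmod (f \<omega>))\<^sup>2)"
    using assms by (auto simp: square_integrable_def)
  have "integrable (distr bernoulli bernoulli (\<lambda>\<omega>. \<omega> \<circ> \<sigma>)) (\<lambda>\<omega>. (cmod (f \<omega>))\<^sup>2)"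
    using f by (simp add: distr_bernoulli_reindex[OF assms(1)])
  then have "integrable bernoulli (\<lambda>\<omega>. (cmod (f (\<omega> \<circ> \<sigma>)))\<^sup>2)"
    by (rule integrable_distr[OF measurable_reindex])
  moreover have "(\<lambda>\<omega>. f (\<omega> \<circ> \<sigma>)) \<in> borel_measurable bernoulli"
    using measurable_comp[OF measurable_reindex f(1)] by (simp add: comp_def)
  ultimately show ?thesis by (simp add: square_integrable_def)
qed

lemma AE_reindex:
  assumes "inj \<sigma>" "AE \<omega> in bernoulli. P \<omega>"
  shows "AE \<omega> in bernoulli. P (\<omega> \<circ> \<sigma>)"
proof -
  have "AE \<omega> in distr bernoulli bernoulli (\<lambda>\<omega>. \<omega> \<circ> \<sigma>). P \<omega>"
    by (subst distr_bernoulli_reindex) (use assms in auto)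
  then show ?thesis by (rule AE_distrD[OF measurable_reindex])
qed

lemma L2_rel_reindex:
  assumes "inj \<sigma>" "L2_rel f g"
  shows "L2_rel (\<lambda>\<omega>. f (\<omega> \<circ> \<sigma>)) (\<lambda>\<omega>. g (\<omega> \<circ> \<sigma>))"
  using assms by (auto simp: L2_rel_def intro: square_integrable_reindex AE_reindex)

lemma half_conv_reindex:
  "right_half \<omega> = \<omega> \<circ> (\<lambda>n. 1 + int n)" "left_half \<omega> = \<omega> \<circ> (\<lambda>n. - int n)"
  by (auto simp: right_half_def left_half_def)

lemma inj_half: "inj (\<lambda>n. 1 + int n)" "inj (\<lambda>n. - int n)"
  by (auto simp: inj_def)

lemma square_integrable_tensor:
  assumes "square_integrable f" "square_integrable g"
  shows "square_integrable (\<lambda>\<omega>. f (right_half \<omega>) * g (left_half \<omega>))"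
proof -
  let ?C = "measure_pmf (bernoulli_pmf (1/2))"
  let ?B = "bernoulli :: (int \<Rightarrow> bool) measure"
  let ?S = "{1..} :: int set" and ?T = "{..0} :: int set"
  interpret prob_space ?B by (rule prob_space_bernoulli)
  define f' where "f' = (\<lambda>x :: int \<Rightarrow> bool. (cmod (f (\<lambda>n. x (1 + int n))))\<^sup>2)"
  define g' where "g' = (\<lambda>x :: int \<Rightarrow> bool. (cmod (g (\<lambda>n. x (- int n))))\<^sup>2)"
  have f: "f \<in> borel_measurable bernoulli" and g: "g \<in> borel_measurable bernoulli"
    using assms by (auto simp: square_integrable_def)
  have C: "prob_space ?C" by (rule measure_pmf.prob_space_axioms)
  have "distr ?B (PiM UNIV (\<lambda>_. ?C)) (\<lambda>\<omega>. \<lambda>i\<in>UNIV. \<omega> i) = ?B"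
    by (simp add: restrict_UNIV bernoulli_def distr_id2)
  moreover have "distr ?B ?C (\<lambda>\<omega>. \<omega> i) = ?C" for i
    unfolding bernoulli_def by (rule distr_PiM_component) (simp_all add: C)
  ultimately have "indep_vars (\<lambda>_. ?C) (\<lambda>i \<omega>. \<omega> i) UNIV"
    by (subst indep_vars_iff_distr_eq_PiM')
      (simp_all add: measurable_cong_sets[OF refl sets_measure_pmf_count_space]
        bernoulli_def measurable_component_pmf)
  then have "indep_var (PiM ?S (\<lambda>_. ?C)) (\<lambda>\<omega>. restrict \<omega> ?S) (PiM ?T (\<lambda>_. ?C)) (\<lambda>\<omega>. restrict \<omega> ?T)"
    by (rule indep_var_restrict) auto
  moreover have "f' \<in> borel_measurable (PiM ?S (\<lambda>_. ?C))"
  proof -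
    have "(\<lambda>x n. x (1 + int n)) \<in> measurable (PiM ?S (\<lambda>_. ?C)) bernoulli"
      unfolding bernoulli_def
      by (rule measurable_PiM_single')
        (auto simp: measurable_cong_sets[OF refl sets_measure_pmf_count_space] measurable_component_pmf)
    from measurable_compose[OF this f] show ?thesis unfolding f'_def by measurable
  qed
  moreover have "g' \<in> borel_measurable (PiM ?T (\<lambda>_. ?C))"
  proof -
    have "(\<lambda>x n. x (- int n)) \<in> measurable (PiM ?T (\<lambda>_. ?C)) bernoulli"
      unfolding bernoulli_def
      by (rule measurable_PiM_single')
        (auto simp: measurable_cong_sets[OF refl sets_measure_pmf_count_space] measurable_component_pmf)
    from measurable_compose[OF this g] show ?thesis unfolding g'_def by measurable
  qed
  ultimately have "indep_var borel (f' \<circ> (\<lambda>\<omega>. restrict \<omega> ?S)) borel (g' \<circ> (\<lambda>\<omega>. restrict \<omega> ?T))"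
    by (rule indep_var_compose)
  moreover have "f' \<circ> (\<lambda>\<omega>. restrict \<omega> ?S) = (\<lambda>\<omega>. (cmod (f (right_half \<omega>)))\<^sup>2)"
    "g' \<circ> (\<lambda>\<omega>. restrict \<omega> ?T) = (\<lambda>\<omega>. (cmod (g (left_half \<omega>)))\<^sup>2)"
    by (auto simp: f'_def g'_def right_half_def[abs_def] left_half_def[abs_def])
  ultimately have ind: "indep_var borel (\<lambda>\<omega>. (cmod (f (right_half \<omega>)))\<^sup>2)
      borel (\<lambda>\<omega>. (cmod (g (left_half \<omega>)))\<^sup>2)"
    by simp
  have *: "square_integrable (\<lambda>\<omega>. f (right_half \<omega>))" "square_integrable (\<lambda>\<omega>. g (left_half \<omega>))"
    unfolding half_conv_reindex
    by (intro square_integrable_reindex inj_half assms)+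
  then have "integrable ?B (\<lambda>\<omega>. (cmod (f (right_half \<omega>)))\<^sup>2 * (cmod (g (left_half \<omega>)))\<^sup>2)"
    using indep_var_integrable[OF ind] by (auto simp: square_integrable_def)
  then show ?thesis
    using * by (auto simp: square_integrable_def norm_mult power_mult_distrib)
qed

subsection \<open>Hilbert space structure\<close>

lift_definition cinner :: "'i L2 \<Rightarrow> 'i L2 \<Rightarrow> complex" is
  "\<lambda>f g. \<integral>\<omega>. f \<omega> * cnj (g \<omega>) \<partial>bernoulli"
  by (auto simp: L2_rel_def square_integrable_def intro!: integral_cong_AE)

lift_definition scaleC :: "complex \<Rightarrow> 'i L2 \<Rightarrow> 'i L2" is "\<lambda>c f \<omega>. c * f \<omega>"
  by (auto simp: L2_rel_def intro: square_integrable_cmult)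

instantiation L2 :: (type) ab_group_add
begin

lift_definition zero_L2 :: "'a L2" is "\<lambda>_. 0"
  by (simp add: L2_rel_def)

lift_definition plus_L2 :: "'a L2 \<Rightarrow> 'a L2 \<Rightarrow> 'a L2" is "\<lambda>f g \<omega>. f \<omega> + g \<omega>"
  by (auto simp: L2_rel_def intro: square_integrable_add)

definition uminus_L2 :: "'a L2 \<Rightarrow> 'a L2" where "uminus_L2 f = scaleC (- 1) f"

definition minus_L2 :: "'a L2 \<Rightarrow> 'a L2 \<Rightarrow> 'a L2" where "minus_L2 f g = f + - g"

instance
proof
  fix f g h :: "'a L2"
  show "f + g + h = f + (g + h)"
    by transfer (auto simp: L2_rel_def algebra_simps intro!: square_integrable_add)
  show "f + g = g + f"
    by transfer (auto simp: L2_rel_def algebra_simps intro!: square_integrable_add)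
  show "0 + f = f"
    by transfer (auto simp: L2_rel_def)
  show "- f + f = 0"
    unfolding uminus_L2_def
    by transfer (auto simp: L2_rel_def)
  show "f - g = f + - g"
    by (simp add: minus_L2_def)
qed

end

interpretation L2: vector_space "scaleC :: complex \<Rightarrow> 'i L2 \<Rightarrow> 'i L2"
proof
  fix a b :: complex and f g :: "'i L2"
  show "scaleC a (f + g) = scaleC a f + scaleC a g"
    by transfer (auto simp: L2_rel_def algebra_simps
        intro!: square_integrable_add square_integrable_cmult)
  show "scaleC (a + b) f = scaleC a f + scaleC b f"
    by transfer (auto simp: L2_rel_def algebra_simps
        intro!: square_integrable_add square_integrable_cmult)
  show "scaleC a (scaleC b f) = scaleC (a * b) f"
    by transfer (auto simp: L2_rel_def algebra_simps
        intro!: square_integrable_cmult)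
  show "scaleC 1 f = f"
    by transfer (auto simp: L2_rel_def)
qed

instantiation L2 :: (type) real_vector
begin

definition scaleR_L2 :: "real \<Rightarrow> 'a L2 \<Rightarrow> 'a L2" where
  "scaleR_L2 r = scaleC (complex_of_real r)"

instance
  by standard (simp_all add: scaleR_L2_def L2.scale_right_distrib L2.scale_left_distrib)

end

instantiation L2 :: (type) real_inner
begin

definition inner_L2 :: "'a L2 \<Rightarrow> 'a L2 \<Rightarrow> real" where "inner_L2 f g = Re (cinner f g)"

definition norm_L2 :: "'a L2 \<Rightarrow> real" where "norm_L2 f = sqrt (inner f f)"

definition sgn_L2 :: "'a L2 \<Rightarrow> 'a L2" where "sgn_L2 f = f /\<^sub>R norm f"

definition dist_L2 :: "'a L2 \<Rightarrow> 'a L2 \<Rightarrow> real" where "dist_L2 f g = norm (f - g)"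

definition uniformity_L2 :: "('a L2 \<times> 'a L2) filter" where
  "uniformity_L2 = (INF e\<in>{0<..}. principal {(x, y). dist x y < e})"

definition open_L2 :: "'a L2 set \<Rightarrow> bool" where
  "open_L2 U \<longleftrightarrow> (\<forall>x\<in>U. eventually (\<lambda>(x', y). x' = x \<longrightarrow> y \<in> U) uniformity)"

instance
proof
  fix f g h :: "'a L2" and r :: real
  show "sgn f = f /\<^sub>R norm f" "dist f g = norm (f - g)" "norm f = sqrt (inner f f)"
    by (simp_all add: sgn_L2_def dist_L2_def norm_L2_def)
  show "uniformity = (INF e\<in>{0<..}. principal {(x :: 'a L2, y). dist x y < e})"
    by (rule uniformity_L2_def)
  show "open U \<longleftrightarrow> (\<forall>x\<in>U. \<forall>\<^sub>F (x', y) in uniformity. x' = x \<longrightarrow> y \<in> U)" for U :: "'a L2 set"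
    by (rule open_L2_def)
  show "inner f g = inner g f"
    unfolding inner_L2_def
  proof transfer
    fix f g :: "('a \<Rightarrow> bool) \<Rightarrow> complex"
    have "(\<integral>\<omega>. g \<omega> * cnj (f \<omega>) \<partial>bernoulli) = (\<integral>\<omega>. cnj (f \<omega> * cnj (g \<omega>)) \<partial>bernoulli)"
      by (simp add: mult.commute)
    then show "Re (\<integral>\<omega>. f \<omega> * cnj (g \<omega>) \<partial>bernoulli) = Re (\<integral>\<omega>. g \<omega> * cnj (f \<omega>) \<partial>bernoulli)"
      by (simp only: Bochner_Integration.integral_cnj cnj.simps)
  qed
  show "inner (f + g) h = inner f h + inner g h"
    unfolding inner_L2_def
    by transfer (simp add: L2_rel_def distrib_right square_integrable_mult)
  show "inner (r *\<^sub>R f) g = r * inner f g"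
    unfolding inner_L2_def scaleR_L2_def
    by transfer (simp add: mult.assoc)
  show "0 \<le> inner f f"
    unfolding inner_L2_def
    by transfer (simp add: L2_rel_def square_integrable_mult flip: integral_Re)
  show "inner f f = 0 \<longleftrightarrow> f = 0"
    unfolding inner_L2_def
  proof transfer
    fix f :: "('a \<Rightarrow> bool) \<Rightarrow> complex"
    assume "L2_rel f f"
    then have f: "square_integrable f" by (simp add: L2_rel_def)
    have "Re (\<integral>\<omega>. f \<omega> * cnj (f \<omega>) \<partial>bernoulli) = (\<integral>\<omega>. (cmod (f \<omega>))\<^sup>2 \<partial>bernoulli)"
      using square_integrable_mult[OF f f]
      by (simp add: complex_norm_square[symmetric] flip: integral_Re)
    also have "\<dots> = 0 \<longleftrightarrow> (AE \<omega> in bernoulli. (cmod (f \<omega>))\<^sup>2 = 0)"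
      using f by (intro integral_nonneg_eq_0_iff_AE) (auto simp: square_integrable_def)
    finally show "Re (\<integral>\<omega>. f \<omega> * cnj (f \<omega>) \<partial>bernoulli) = 0 \<longleftrightarrow> L2_rel f (\<lambda>_. 0)"
      using f by (simp add: L2_rel_def)
  qed
qed

end

definition hilbert_adjoint :: "('i L2 \<Rightarrow> 'i L2) \<Rightarrow> 'i L2 \<Rightarrow> 'i L2" where
  "hilbert_adjoint T = (THE T'. \<forall>f g. cinner (T f) g = cinner f (T' g))"

subsection \<open>Tensor products\<close>

lift_definition tensor :: "nat L2 \<Rightarrow> nat L2 \<Rightarrow> int L2"  (infixr \<open>\<otimes>\<^sub>L\<close> 70) is
  "\<lambda>f g \<omega>. f (right_half \<omega>) * g (left_half \<omega>)"
proof -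
  fix f f' g g' :: "(nat \<Rightarrow> bool) \<Rightarrow> complex"
  assume fg: "L2_rel f f'" "L2_rel g g'"
  have "AE \<omega> in bernoulli. f (right_half \<omega>) = f' (right_half \<omega>)"
    "AE \<omega> in bernoulli. g (left_half \<omega>) = g' (left_half \<omega>)"
    unfolding half_conv_reindex using fg
    by (auto simp: L2_rel_def intro!: AE_reindex inj_half)
  then have "AE \<omega> in bernoulli. f (right_half \<omega>) * g (left_half \<omega>) = f' (right_half \<omega>) * g' (left_half \<omega>)"
    by eventually_elim simp
  then show "L2_rel (\<lambda>\<omega>. f (right_half \<omega>) * g (left_half \<omega>)) (\<lambda>\<omega>. f' (right_half \<omega>) * g' (left_half \<omega>))"
    using fg by (auto simp: L2_rel_def intro: square_integrable_tensor)
qed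

definition tensor_op :: "(nat L2 \<Rightarrow> nat L2) \<Rightarrow> (nat L2 \<Rightarrow> nat L2) \<Rightarrow> int L2 \<Rightarrow> int L2" where
  "tensor_op A B = (THE T. bounded_linear T \<and> (\<forall>c x. T (scaleC c x) = scaleC c (T x)) \<and>
     (\<forall>f g. T (f \<otimes>\<^sub>L g) = A f \<otimes>\<^sub>L B g))"

section \<open>The operators\<close>

lift_definition U_L :: "int L2 \<Rightarrow> int L2" is "\<lambda>f \<omega>. f (\<lambda>j. \<omega> (j + 1))"
  using L2_rel_reindex[of "\<lambda>j :: int. j + 1"] by (simp add: comp_def inj_def)

definition V_L :: "int L2 \<Rightarrow> int L2" where
  "V_L = hilbert_adjoint U_L"

lift_definition U_Lplus :: "nat L2 \<Rightarrow> nat L2" is "\<lambda>f \<omega>. f (\<lambda>n. \<omega> (Suc n))"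
  using L2_rel_reindex[of Suc] by (simp add: comp_def)

definition V_Lplus :: "nat L2 \<Rightarrow> nat L2" where
  "V_Lplus = hilbert_adjoint U_Lplus"

text \<open>On left halves, dropping \<open>\<omega>\<^sub>0\<close> is again the unit shift in the coordinates of \<^const>\<open>left_half\<close>.\<close>

lift_definition U_Rminus :: "nat L2 \<Rightarrow> nat L2" is "\<lambda>f \<omega>. f (\<lambda>n. \<omega> (Suc n))"
  using L2_rel_reindex[of Suc] by (simp add: comp_def)

text \<open>
  Multiplication by \<open>(-1)\<close> to the power of the zeroth coordinate. This coordinate is \<open>\<omega>\<^sub>1\<close> on right
  halves and \<open>\<omega>\<^sub>0\<close> on left halves.
\<close>

lift_definition sign_op :: "nat L2 \<Rightarrow> nat L2" is
  "\<lambda>f \<omega>. (- 1) ^ of_bool (\<omega> 0) * f \<omega>"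
proof -
  fix f g :: "(nat \<Rightarrow> bool) \<Rightarrow> complex"
  assume fg: "L2_rel f g"
  have "square_integrable (\<lambda>\<omega>. (- 1) ^ of_bool (\<omega> 0) * h \<omega>)"
    if "square_integrable h" for h :: "(nat \<Rightarrow> bool) \<Rightarrow> complex"
  proof -
    have [measurable]: "h \<in> borel_measurable bernoulli"
      using that by (simp add: square_integrable_def)
    have "(\<lambda>\<omega>. (- 1) ^ of_bool (\<omega> 0) * h \<omega>) = (\<lambda>\<omega>. if \<omega> 0 then - h \<omega> else h \<omega>)"
      by auto
    moreover have "\<dots> \<in> borel_measurable bernoulli"
      by measurable
    ultimately have "(\<lambda>\<omega>. (- 1) ^ of_bool (\<omega> 0) * h \<omega>) \<in> borel_measurable bernoulli"
      by simp
    moreover have "cmod ((- 1) ^ of_bool (\<omega> 0) * h \<omega>) = cmod (h \<omega>)" for \<omega>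
      by (simp add: norm_mult norm_power)
    ultimately show ?thesis
      using that unfolding square_integrable_def by presburger
  qed
  then show "L2_rel (\<lambda>\<omega>. (- 1) ^ of_bool (\<omega> 0) * f \<omega>) (\<lambda>\<omega>. (- 1) ^ of_bool (\<omega> 0) * g \<omega>)"
    using fg by (auto simp: L2_rel_def)
qed

definition Q0 :: "int L2 \<Rightarrow> int L2" where
  "Q0 = tensor_op V_Lplus U_Rminus"

definition Q1 :: "int L2 \<Rightarrow> int L2" where
  "Q1 = tensor_op (V_Lplus \<circ> sign_op) (sign_op \<circ> U_Rminus)"

definition V_eps :: "real \<Rightarrow> int L2 \<Rightarrow> int L2" where
  "V_eps \<epsilon> f = Q0 f + scaleC (complex_of_real \<epsilon>) (Q1 f)"

section \<open>The Gelfand triplet\<close>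

definition binary_value :: "(nat \<Rightarrow> bool) \<Rightarrow> real" where
  "binary_value \<omega> = (\<Sum>n. of_bool (\<omega> n) * (1/2) ^ Suc n)"

lemma measurable_binary_value: "binary_value \<in> borel_measurable bernoulli"
proof -
  have "(\<lambda>\<omega> :: nat \<Rightarrow> bool. \<Sum>n. of_bool (\<omega> n) * (1/2::real) ^ Suc n) \<in> borel_measurable bernoulli"
    by measurable
  then show ?thesis by (simp add: binary_value_def[abs_def])
qed

lemma abs_binary_value_le: "\<bar>binary_value \<omega>\<bar> \<le> 1"
proof -
  have s: "summable (\<lambda>n. (1/2::real) ^ Suc n)"
    using power_half_series by (rule sums_summable)
  have le: "norm (of_bool (\<omega> n) * (1/2::real) ^ Suc n) \<le> (1/2) ^ Suc n" for n
    by simp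
  have "norm (binary_value \<omega>) \<le> (\<Sum>n. (1/2::real) ^ Suc n)"
    unfolding binary_value_def by (rule norm_suminf_le[OF le s])
  then show ?thesis using power_half_series by (simp add: sums_iff)
qed

lift_definition h_power :: "nat \<Rightarrow> nat L2" is "\<lambda>i \<omega>. complex_of_real (binary_value \<omega>) ^ i"
proof -
  fix i
  have "square_integrable (\<lambda>\<omega>. complex_of_real (binary_value \<omega>) ^ i)"
  proof (rule square_integrable_bounded)
    show "(\<lambda>\<omega>. complex_of_real (binary_value \<omega>) ^ i) \<in> borel_measurable bernoulli"
      using measurable_binary_value by measurable
    show "cmod (complex_of_real (binary_value \<omega>) ^ i) \<le> 1" for \<omega>
      using abs_binary_value_le[of \<omega>] by (simp add: norm_power power_le_one)
  qed
  then show "L2_rel (\<lambda>\<omega>. complex_of_real (binary_value \<omega>) ^ i) (\<lambda>\<omega>. complex_of_real (binary_value \<omega>) ^ i)"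
    by (simp add: L2_rel_def)
qed

text \<open>
  Since the map \<open>i\<close> is the identity in our coordinates, \<open>poly_space M\<close> is the space of polynomials of degree
  at most \<open>M\<close> on the right halves as well as on the left halves.
\<close>

definition poly_space :: "nat \<Rightarrow> nat L2 set" where
  "poly_space M = L2.span (h_power ` {..M})"

text \<open>
  As \<open>poly_space M\<close> is finite-dimensional, the tensor products of \<open>poly_space M\<close> with L2 need no completion: they
  are closed subspaces of L2 of the two-sided space and carry its norm.
\<close>

definition X_plus_step :: "nat \<Rightarrow> int L2 set" where
  "X_plus_step M = L2.span {f \<otimes>\<^sub>L p | f p. p \<in> poly_space M}"

definition X_minus_step :: "nat \<Rightarrow> int L2 set" where
  "X_minus_step M = L2.span {p \<otimes>\<^sub>L f | p f. p \<in> poly_space M}"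

definition X_plus :: "int L2 set" where "X_plus = (\<Union>M. X_plus_step M)"

definition X_minus :: "int L2 set" where "X_minus = (\<Union>M. X_minus_step M)"

text \<open>
  The finest locally convex topology on the union of an increasing sequence of subspaces that
  makes all inclusions continuous. A base of neighbourhoods of zero consists of the absolutely
  convex sets meeting each step in a neighbourhood of zero.
\<close>

definition inductive_limit_nbhd :: "(nat \<Rightarrow> 'i L2 set) \<Rightarrow> 'i L2 set \<Rightarrow> bool" where
  "inductive_limit_nbhd E W \<longleftrightarrow> W \<subseteq> (\<Union>M. E M) \<and> convex W \<and>
     (\<forall>c. cmod c \<le> 1 \<longrightarrow> scaleC c ` W \<subseteq> W) \<and>
     (\<forall>M. \<exists>e>0. ball 0 e \<inter> E M \<subseteq> W)"

definition inductive_limit_topology :: "(nat \<Rightarrow> 'i L2 set) \<Rightarrow> 'i L2 topology" where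
  "inductive_limit_topology E = topology (\<lambda>U. U \<subseteq> (\<Union>M. E M) \<and>
     (\<forall>x\<in>U. \<exists>W. inductive_limit_nbhd E W \<and> (+) x ` W \<subseteq> U))"

lemma inductive_limit_nbhd_Int:
  assumes "inductive_limit_nbhd E V" "inductive_limit_nbhd E W"
  shows "inductive_limit_nbhd E (V \<inter> W)"
proof -
  have "\<exists>e>0. ball 0 e \<inter> E M \<subseteq> V \<inter> W" for M
  proof -
    obtain d e where "d > 0" "ball 0 d \<inter> E M \<subseteq> V" "e > 0" "ball 0 e \<inter> E M \<subseteq> W"
      using assms unfolding inductive_limit_nbhd_def by metis
    then show ?thesis by (intro exI[of _ "min d e"]) auto
  qed
  moreover have "scaleC c ` (V \<inter> W) \<subseteq> V \<inter> W" if "cmod c \<le> 1" for c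
    using assms that unfolding inductive_limit_nbhd_def by (meson image_mono inf_le1 inf_le2 le_inf_iff order_trans)
  ultimately show ?thesis
    using assms unfolding inductive_limit_nbhd_def by (simp add: convex_Int le_infI1)
qed

lemma openin_inductive_limit_topology:
  "openin (inductive_limit_topology E) U \<longleftrightarrow> U \<subseteq> (\<Union>M. E M) \<and>
     (\<forall>x\<in>U. \<exists>W. inductive_limit_nbhd E W \<and> (+) x ` W \<subseteq> U)"
proof -
  have "istopology (\<lambda>U. U \<subseteq> (\<Union>M. E M) \<and>
     (\<forall>x\<in>U. \<exists>W. inductive_limit_nbhd E W \<and> (+) x ` W \<subseteq> U))"
    unfolding istopology_def
  proof (intro conjI allI impI)
    fix S T
    assume S: "S \<subseteq> (\<Union>M. E M) \<and> (\<forall>x\<in>S. \<exists>W. inductive_limit_nbhd E W \<and> (+) x ` W \<subseteq> S)"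
      and T: "T \<subseteq> (\<Union>M. E M) \<and> (\<forall>x\<in>T. \<exists>W. inductive_limit_nbhd E W \<and> (+) x ` W \<subseteq> T)"
    show "S \<inter> T \<subseteq> (\<Union>M. E M)" using S by blast
    show "\<forall>x\<in>S \<inter> T. \<exists>W. inductive_limit_nbhd E W \<and> (+) x ` W \<subseteq> S \<inter> T"
    proof
      fix x assume "x \<in> S \<inter> T"
      then obtain V W where "inductive_limit_nbhd E V" "(+) x ` V \<subseteq> S"
        "inductive_limit_nbhd E W" "(+) x ` W \<subseteq> T" using S T by blast
      then show "\<exists>W. inductive_limit_nbhd E W \<and> (+) x ` W \<subseteq> S \<inter> T"
        by (intro exI[of _ "V \<inter> W"] conjI inductive_limit_nbhd_Int) auto
    qed
  next
    fix \<K>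
    assume K: "\<forall>K\<in>\<K>. K \<subseteq> (\<Union>M. E M) \<and> (\<forall>x\<in>K. \<exists>W. inductive_limit_nbhd E W \<and> (+) x ` W \<subseteq> K)"
    show "\<Union>\<K> \<subseteq> (\<Union>M. E M)" using K by blast
    show "\<forall>x\<in>\<Union>\<K>. \<exists>W. inductive_limit_nbhd E W \<and> (+) x ` W \<subseteq> \<Union>\<K>"
    proof
      fix x assume "x \<in> \<Union>\<K>"
      then obtain K where "K \<in> \<K>" "x \<in> K" by blast
      then obtain W where "inductive_limit_nbhd E W" "(+) x ` W \<subseteq> K" using K by blast
      with \<open>K \<in> \<K>\<close> show "\<exists>W. inductive_limit_nbhd E W \<and> (+) x ` W \<subseteq> \<Union>\<K>" by blast
    qed
  qed
  then show ?thesis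
    by (simp add: inductive_limit_topology_def)
qed

text \<open>Functionals on \<^const>\<open>X_plus\<close> are extended by zero to the whole of L2.\<close>

definition X_plus_dual :: "(int L2 \<Rightarrow> complex) set" where
  "X_plus_dual = {\<mu>.
     (\<forall>x\<in>X_plus. \<forall>y\<in>X_plus. \<mu> (x + y) = \<mu> x + \<mu> y) \<and>
     (\<forall>c. \<forall>x\<in>X_plus. \<mu> (scaleC c x) = cnj c * \<mu> x) \<and>
     continuous_map (inductive_limit_topology X_plus_step) euclidean \<mu> \<and>
     (\<forall>x. x \<notin> X_plus \<longrightarrow> \<mu> x = 0)}"

interpretation functionals: vector_space "\<lambda>c (\<mu> :: int L2 \<Rightarrow> complex) x. c * \<mu> x"
  by standard (auto simp: algebra_simps)

definition L2_embed :: "int L2 \<Rightarrow> int L2 \<Rightarrow> complex" where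
  "L2_embed f = (\<lambda>g. if g \<in> X_plus then cinner f g else 0)"

definition dual_op :: "(int L2 \<Rightarrow> int L2) \<Rightarrow> (int L2 \<Rightarrow> complex) \<Rightarrow> int L2 \<Rightarrow> complex" where
  "dual_op T \<mu> = (\<lambda>g. if g \<in> X_plus then \<mu> (hilbert_adjoint T g) else 0)"

section \<open>Generalized spectrum\<close>

definition shifted :: "(int L2 \<Rightarrow> int L2) \<Rightarrow> complex \<Rightarrow> int L2 \<Rightarrow> int L2" where
  "shifted T z f = scaleC z f - T f"

definition weakly_analytic_on ::
  "(complex \<Rightarrow> int L2 \<Rightarrow> int L2 \<Rightarrow> complex) \<Rightarrow> complex set \<Rightarrow> bool" where
  "weakly_analytic_on R D \<longleftrightarrow> (\<forall>f\<in>X_minus.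
     (\<forall>z\<in>D. R z f \<in> X_plus_dual) \<and> (\<forall>g\<in>X_plus. (\<lambda>z. R z f g) holomorphic_on D))"

text \<open>
  \<open>R\<close> is the generalized resolvent of \<open>T\<close> and \<open>S\<close> is the set of its singularities: \<open>R\<close> is weakly
  analytic on the connected open complement of \<open>S\<close>, agrees with the Hilbert space resolvent near
  infinity, and extends analytically to no neighbourhood of any point of \<open>S\<close>. The last condition
  forces \<open>S\<close> to have empty interior (otherwise the zero function is an extension to a ball inside
  \<open>S\<close>), so that \<open>R\<close> really is defined on a dense open part of the unit disc. An accumulation
  point of singularities is a singularity, though not an isolated one.
\<close>

definition generalized_resolvent ::
  "(int L2 \<Rightarrow> int L2) \<Rightarrow> complex set \<Rightarrow> (complex \<Rightarrow> int L2 \<Rightarrow> int L2 \<Rightarrow> complex) \<Rightarrow> bool" where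
  "generalized_resolvent T S R \<longleftrightarrow>
     closed S \<and> S \<subseteq> cball 0 1 \<and> connected (- S) \<and>
     weakly_analytic_on R (- S) \<and>
     (\<exists>r\<ge>1. \<forall>z. cmod z > r \<longrightarrow> bij (shifted T z) \<and>
        (\<forall>f\<in>X_minus. R z f = L2_embed (inv (shifted T z) f))) \<and>
     (\<forall>z\<^sub>0\<in>S. \<not> (\<exists>\<delta>>0. \<exists>R'. weakly_analytic_on R' (ball z\<^sub>0 \<delta>) \<and>
        (\<forall>f\<in>X_minus. \<forall>z\<in>ball z\<^sub>0 \<delta> - S. R' z f = R z f)))"

definition generalized_eigenvalues :: "(int L2 \<Rightarrow> int L2) \<Rightarrow> complex set \<Rightarrow> complex set" where
  "generalized_eigenvalues T S = {z\<^sub>0. z\<^sub>0 isolated_in S \<and>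
     (\<exists>\<mu>\<in>X_plus_dual. \<mu> \<noteq> 0 \<and> dual_op T \<mu> = (\<lambda>g. z\<^sub>0 * \<mu> g))}"

definition encircles :: "(real \<Rightarrow> complex) \<Rightarrow> complex \<Rightarrow> complex set \<Rightarrow> bool" where
  "encircles C z\<^sub>0 S \<longleftrightarrow> valid_path C \<and> simple_path C \<and> pathfinish C = pathstart C \<and>
     path_image C \<inter> S = {} \<and> winding_number C z\<^sub>0 = 1 \<and>
     (\<forall>s\<in>S - {z\<^sub>0}. winding_number C s = 0)"

text \<open>
  The contour integral is a weak integral. Its value does not depend on the choice of the curve.
\<close>

definition riesz_projection ::
  "complex set \<Rightarrow> (complex \<Rightarrow> int L2 \<Rightarrow> int L2 \<Rightarrow> complex) \<Rightarrow> complex \<Rightarrow> int L2 \<Rightarrow> int L2 \<Rightarrow> complex"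
  where
  "riesz_projection S R z\<^sub>0 f = (\<lambda>g. if g \<in> X_plus
     then contour_integral (SOME C. encircles C z\<^sub>0 S) (\<lambda>z. R z f g) / (2 * pi * \<i>) else 0)"

definition generalized_eigenspace ::
  "complex set \<Rightarrow> (complex \<Rightarrow> int L2 \<Rightarrow> int L2 \<Rightarrow> complex) \<Rightarrow> complex \<Rightarrow> (int L2 \<Rightarrow> complex) set"
  where
  "generalized_eigenspace S R z\<^sub>0 = riesz_projection S R z\<^sub>0 ` X_minus"

definition algebraic_multiplicity ::
  "complex set \<Rightarrow> (complex \<Rightarrow> int L2 \<Rightarrow> int L2 \<Rightarrow> complex) \<Rightarrow> complex \<Rightarrow> nat" where
  "algebraic_multiplicity S R z\<^sub>0 = functionals.dim (generalized_eigenspace S R z\<^sub>0)"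

definition geometric_multiplicity ::
  "(int L2 \<Rightarrow> int L2) \<Rightarrow> complex set \<Rightarrow> (complex \<Rightarrow> int L2 \<Rightarrow> int L2 \<Rightarrow> complex) \<Rightarrow> complex \<Rightarrow> nat"
  where
  "geometric_multiplicity T S R z\<^sub>0 = functionals.dim
     {\<mu> \<in> generalized_eigenspace S R z\<^sub>0. dual_op T \<mu> = (\<lambda>g. z\<^sub>0 * \<mu> g)}"

end

theory Submission
  imports Defs
begin

text \<open>
  Write \<open>T = V\<^sub>L(\<epsilon>)\<close>. The adjoint \<open>T\<^sup>*\<close> preserves every step of the test space \<open>X\<^sub>+\<close>. Expand the polynomial
  factor of a test vector in orthonormal polynomials \<open>e\<^sub>j\<close>, and the polynomial factor of a vector of
  \<open>X\<^sub>-\<close> in eigenpolynomials \<open>b\<^sub>i\<close> of the one-sided transfer operator, for the eigenvalues \<open>2\<^sup>-\<^sup>i\<close>. Every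
  vector of \<open>X\<^sub>-\<close> then acts on \<open>X\<^sub>+\<close> as a formal series \<open>\<Sum> a\<^sub>i\<^sub>j b\<^sub>i \<otimes> e\<^sub>j\<close> with bounded \<open>i\<close>. In these coordinates the
  dual of \<open>T\<close> is lower triangular in \<open>j\<close> with diagonal entries \<open>2\<^sup>-\<^sup>(\<^sup>i\<^sup>+\<^sup>j\<^sup>)\<close>, so the resolvent equation is
  solved by recursion on \<open>j\<close>, and each coordinate of the solution is a rational function of \<open>\<lambda>\<close> with poles
  at powers of \<open>1/2\<close>. For large \<open>\<lambda>\<close> the solution is the Hilbert space resolvent, because a bounded
  functional expanded by the contraction \<open>T\<^sup>*\<close> by a factor \<open>\<bar>\<lambda>\<bar> > 1\<close> vanishes.

  At \<open>\<lambda> = 2\<^sup>-\<^sup>k\<close> each coordinate of a residue is annihilated by a power of the dual of \<open>T\<close> minus \<open>2\<^sup>-\<^sup>k\<close>. By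
  triangularity such a series is determined by the values on the \<open>k + 1\<close> test vectors \<open>e\<^sub>i \<otimes> e\<^sub>k\<^sub>-\<^sub>i\<close>, and the residues of
  \<open>b\<^sub>i \<otimes> e\<^sub>k\<^sub>-\<^sub>i\<close> realize a triangular matrix of such values. If \<open>\<epsilon> \<noteq> 0\<close>, the dual of \<open>T\<close> couples each of the \<open>k + 1\<close>
  diagonal positions to the next one, which leaves a single Jordan block.
\<close>

section \<open>Hilbert space preliminaries\<close>

text \<open>The two factors carry different bases because they are read differently. A functional
  pairs b_i with an arbitrary square integrable function, so there only the action of the transfer
  operator on b_i counts, and eigenvectors make it diagonal. The other factor of a vector of X_- is
  itself arbitrary, and its coordinates must be inner products with polynomials; eigenpolynomials
  would demand a biorthogonal system of distributions, whereas orthonormal polynomials are their own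
  duals and still give a triangular action. The coupling has a single source. Besides the average
  over a prefixed symbol, T contains half the difference over it, weighted by \<epsilon>. This
  finite difference lowers the degree by exactly one in each factor, so its leading part leads from
  position (i + 1, j) to (i, j + 1), on the same diagonal, with a product of two nonzero
  coefficients. The claims concern every generalized resolvent, with its own set of singularities.
  The identity theorem, started outside the disc, reduces them to the constructed one; since 0 and
  the powers of 1/2 form a countable set, the complement of both singular sets together remains
  connected.\<close>

lemma cinner_add_left: "cinner (f + g) h = cinner f h + cinner g h"
  by transfer (simp add: L2_rel_def distrib_right square_integrable_mult)

lemma cinner_scaleC_left: "cinner (scaleC c f) g = c * cinner f g"
  by transfer (simp add: mult.assoc)

lemma cinner_commute: "cinner f g = cnj (cinner g f)"
  by transfer (simp add: mult.commute flip: Bochner_Integration.integral_cnj)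

lemma cinner_add_right: "cinner h (f + g) = cinner h f + cinner h g"
  by (metis cinner_add_left cinner_commute complex_cnj_add)

lemma cinner_scaleC_right: "cinner f (scaleC c g) = cnj c * cinner f g"
  by (metis cinner_scaleC_left cinner_commute complex_cnj_mult)

lemma cinner_zero_left [simp]: "cinner 0 g = 0"
  using cinner_scaleC_left[of 0 0 g] by simp

lemma cinner_zero_right [simp]: "cinner f 0 = 0"
  using cinner_scaleC_right[of f 0 0] by simp

lemma cinner_diff_left: "cinner (f - g) h = cinner f h - cinner g h"
  using cinner_add_left[of "f - g" g h] by simp

lemma cinner_sum_left: "cinner (sum f A) h = (\<Sum>a\<in>A. cinner (f a) h)"
  by (induction A rule: infinite_finite_induct) (simp_all add: cinner_add_left)

lemma cinner_sum_right: "cinner h (sum f A) = (\<Sum>a\<in>A. cinner h (f a))"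
  by (induction A rule: infinite_finite_induct) (simp_all add: cinner_add_right)

lemma cinner_self: "cinner f f = complex_of_real ((norm f)\<^sup>2)"
proof -
  have "Im (cinner f f) = 0"
    using cinner_commute[of f f] by (metis complex_cnj_cancel_iff Reals_cnj_iff complex_is_Real_iff)
  moreover have "Re (cinner f f) = (norm f)\<^sup>2"
    by (simp add: power2_norm_eq_inner inner_L2_def)
  ultimately show ?thesis by (simp add: complex_eq_iff)
qed

lemma cinner_self_eq_0 [simp]: "cinner f f = 0 \<longleftrightarrow> f = 0"
  by (simp add: cinner_self)

lemma cinner_ext_left:
  assumes "\<And>g. cinner f g = cinner f' g"
  shows "f = f'"
proof -
  have "cinner (f - f') (f - f') = 0" using assms[of "f - f'"] by (simp add: cinner_diff_left)
  then show ?thesis by simp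
qed

lemma cinner_ext_right:
  assumes "\<And>f. cinner f g = cinner f g'"
  shows "g = g'"
  by (rule cinner_ext_left) (metis assms cinner_commute)

lemma norm_scaleC: "norm (scaleC c f) = cmod c * norm (f :: 'i L2)"
proof -
  have "complex_of_real ((norm (scaleC c f))\<^sup>2) = (c * cnj c) * complex_of_real ((norm f)\<^sup>2)"
    unfolding cinner_self[symmetric] by (simp add: cinner_scaleC_left cinner_scaleC_right)
  also have "\<dots> = complex_of_real ((cmod c * norm f)\<^sup>2)"
    by (simp add: power_mult_distrib flip: complex_norm_square)
  finally show ?thesis
    unfolding of_real_eq_iff by (simp add: power2_eq_iff_nonneg)
qed

text \<open>The real inner product gives Cauchy-Schwarz for the real part only; rotating f by a
  phase makes the complex inner product real and nonnegative.\<close>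

lemma cmod_cinner_le: "cmod (cinner f g) \<le> norm f * norm g"
proof (cases "cinner f g = 0")
  case False
  define u where "u = cnj (cinner f g) / cmod (cinner f g)"
  have u: "cmod u = 1" using False by (simp add: u_def norm_divide)
  have "u * cinner f g = complex_of_real (cmod (cinner f g))"
    using False complex_norm_square[of "cinner f g"]
    by (simp add: u_def field_simps power2_eq_square)
  then have "cmod (cinner f g) = inner (scaleC u f) g"
    by (simp add: inner_L2_def cinner_scaleC_left)
  also have "\<dots> \<le> norm (scaleC u f) * norm g" by (rule norm_cauchy_schwarz)
  finally show ?thesis by (simp add: norm_scaleC u)
qed simp

lemma hilbert_adjoint_eqI:
  assumes "\<And>f g. cinner (T f) g = cinner f (T' g)"
  shows "hilbert_adjoint T = T'"
  unfolding hilbert_adjoint_def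
proof (rule the_equality)
  show "\<forall>f g. cinner (T f) g = cinner f (T' g)" using assms by blast
  fix S assume "\<forall>f g. cinner (T f) g = cinner f (S g)"
  then show "S = T'" using assms by (intro ext cinner_ext_right) metis
qed

section \<open>Measure-preserving maps of Bernoulli spaces\<close>

text \<open>The two-sided operators and the one-sided shift are assembled from compositions with
  such maps, which act as isometries; an inverse map supplies the adjoint.\<close>

definition preserves_bernoulli :: "(('i \<Rightarrow> bool) \<Rightarrow> ('j \<Rightarrow> bool)) \<Rightarrow> bool" where
  "preserves_bernoulli \<phi> \<longleftrightarrow>
     \<phi> \<in> measurable bernoulli bernoulli \<and> distr bernoulli bernoulli \<phi> = bernoulli"

lemma preserves_reindex: "inj \<sigma> \<Longrightarrow> preserves_bernoulli (\<lambda>\<omega> j. \<omega> (\<sigma> j))"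
  using distr_bernoulli_reindex[of \<sigma>] measurable_reindex[of \<sigma>]
  by (simp add: preserves_bernoulli_def comp_def)

lemma preserves_comp:
  assumes "preserves_bernoulli \<phi>" "preserves_bernoulli \<psi>"
  shows "preserves_bernoulli (\<lambda>\<omega>. \<phi> (\<psi> \<omega>))"
proof -
  have "distr (distr bernoulli bernoulli \<psi>) bernoulli \<phi> = distr bernoulli bernoulli (\<phi> \<circ> \<psi>)"
    by (rule distr_distr) (use assms in \<open>auto simp: preserves_bernoulli_def\<close>)
  then show ?thesis
    using assms measurable_compose[of \<psi> bernoulli bernoulli \<phi> bernoulli]
    unfolding preserves_bernoulli_def comp_def by simp
qed

lemma distr_coordinate:
  "distr bernoulli (measure_pmf (bernoulli_pmf (1/2))) (\<lambda>\<omega>. \<omega> i) = measure_pmf (bernoulli_pmf (1/2))"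
  unfolding bernoulli_def by (rule distr_PiM_component) (simp_all add: measure_pmf.prob_space_axioms)

lemma indep_vars_coordinates:
  "prob_space.indep_vars (bernoulli :: ('i \<Rightarrow> bool) measure)
     (\<lambda>_. measure_pmf (bernoulli_pmf (1/2))) (\<lambda>i \<omega>. \<omega> i) UNIV"
proof -
  let ?C = "measure_pmf (bernoulli_pmf (1/2))"
  let ?B = "bernoulli :: ('i \<Rightarrow> bool) measure"
  interpret prob_space ?B by (rule prob_space_bernoulli)
  have "distr ?B (PiM UNIV (\<lambda>_. ?C)) (\<lambda>\<omega>. \<lambda>i\<in>UNIV. \<omega> i) = ?B"
    by (simp add: restrict_UNIV bernoulli_def distr_id2)
  then show ?thesis
    by (subst indep_vars_iff_distr_eq_PiM')
      (simp_all add: measurable_cong_sets[OF refl sets_measure_pmf_count_space]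
        distr_coordinate[unfolded bernoulli_def] bernoulli_def measurable_component_pmf)
qed

text \<open>Independence survives a coordinatewise map, and a flipped fair bit is fair; so the joint
  law is again the product measure.\<close>

lemma preserves_flip: "preserves_bernoulli (\<lambda>\<omega> j. \<omega> j \<noteq> b j)"
proof -
  let ?C = "measure_pmf (bernoulli_pmf (1/2))"
  let ?B = "bernoulli :: ('a \<Rightarrow> bool) measure"
  interpret prob_space ?B by (rule prob_space_bernoulli)
  have ind: "indep_vars (\<lambda>_. ?C) (\<lambda>i \<omega>. \<omega> i \<noteq> b i) UNIV"
    using indep_vars_coordinates by (rule indep_vars_compose2) simp
  have m: "(\<lambda>\<omega>. \<omega> i \<noteq> b i) \<in> measurable ?B ?C" for i
    using ind by (auto simp: indep_vars_def)
  have "map_pmf (\<lambda>x. x \<noteq> c) (bernoulli_pmf (1/2)) = bernoulli_pmf (1/2)" for c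
  proof (rule pmf_eqI)
    fix x
    have "pmf (map_pmf (\<lambda>x. x \<noteq> c) (bernoulli_pmf (1/2))) ((x \<noteq> c) \<noteq> c) = pmf (bernoulli_pmf (1/2)) (x \<noteq> c)"
      by (rule pmf_map_inj') (auto simp: inj_def)
    then show "pmf (map_pmf (\<lambda>x. x \<noteq> c) (bernoulli_pmf (1/2))) x = pmf (bernoulli_pmf (1/2)) x"
      by (cases x; cases c) auto
  qed
  then have flipC: "distr ?C ?C (\<lambda>x. x \<noteq> c) = ?C" for c
    using map_pmf_rep_eq[of "\<lambda>x. x \<noteq> c" "bernoulli_pmf (1/2)"]
    unfolding \<open>\<And>c. map_pmf _ _ = _\<close>
    by (metis distr_cong sets_measure_pmf_count_space)
  have "distr ?B ?C (\<lambda>\<omega>. \<omega> i \<noteq> b i) = distr (distr ?B ?C (\<lambda>\<omega>. \<omega> i)) ?C (\<lambda>x. x \<noteq> b i)" for i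
    by (subst distr_distr) (simp_all add: comp_def measurable_cong_sets[OF refl sets_measure_pmf_count_space])
  then have "distr ?B ?C (\<lambda>\<omega>. \<omega> i \<noteq> b i) = ?C" for i
    unfolding distr_coordinate flipC .
  then have "distr ?B (PiM UNIV (\<lambda>_. ?C)) (\<lambda>\<omega>. \<lambda>i\<in>UNIV. \<omega> i \<noteq> b i) = PiM UNIV (\<lambda>_. ?C)"
    using ind m by (subst (asm) indep_vars_iff_distr_eq_PiM') simp_all
  moreover have "(\<lambda>\<omega> i. \<omega> i \<noteq> b i) \<in> measurable ?B ?B"
    unfolding bernoulli_def
    by (rule measurable_PiM_single') (use m in \<open>auto simp: bernoulli_def\<close>)
  ultimately show ?thesis
    by (simp add: preserves_bernoulli_def restrict_UNIV flip: bernoulli_def)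
qed

lemma preserves_flip_reindex:
  "inj \<sigma> \<Longrightarrow> preserves_bernoulli (\<lambda>\<omega> j. \<omega> (\<sigma> j) \<noteq> b j)"
  using preserves_comp[OF preserves_flip[of b] preserves_reindex[of \<sigma>]] by simp

lemma preserves_halves: "preserves_bernoulli right_half" "preserves_bernoulli left_half"
  using preserves_reindex[OF inj_half(1)] preserves_reindex[OF inj_half(2)]
  by (simp_all add: right_half_def[abs_def] left_half_def[abs_def])

lemma preserves_AE:
  assumes "preserves_bernoulli \<phi>" "AE \<omega> in bernoulli. P \<omega>"
  shows "AE \<omega> in bernoulli. P (\<phi> \<omega>)"
proof (rule AE_distrD[where f = \<phi> and M' = bernoulli and P = P])
  show "\<phi> \<in> measurable bernoulli bernoulli" using assms(1) by (simp add: preserves_bernoulli_def)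
  have d: "distr bernoulli bernoulli \<phi> = bernoulli" using assms(1) by (simp add: preserves_bernoulli_def)
  show "AE \<omega> in distr bernoulli bernoulli \<phi>. P \<omega>" unfolding d by (rule assms(2))
qed

lemma preserves_measurable:
  "preserves_bernoulli \<phi> \<Longrightarrow> f \<in> borel_measurable bernoulli \<Longrightarrow> (\<lambda>\<omega>. f (\<phi> \<omega>)) \<in> borel_measurable bernoulli"
  unfolding preserves_bernoulli_def by (rule measurable_compose[where N = bernoulli and g = f]) auto

lemma preserves_integrable_iff:
  fixes f :: "_ \<Rightarrow> 'b :: {banach, second_countable_topology}"
  assumes "preserves_bernoulli \<phi>" "f \<in> borel_measurable bernoulli"
  shows "integrable bernoulli (\<lambda>\<omega>. f (\<phi> \<omega>)) \<longleftrightarrow> integrable bernoulli f"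
  using assms integrable_distr_eq[of \<phi> bernoulli bernoulli f] by (simp add: preserves_bernoulli_def)

lemma preserves_integral:
  fixes f :: "_ \<Rightarrow> 'b :: {banach, second_countable_topology}"
  assumes "preserves_bernoulli \<phi>" "f \<in> borel_measurable bernoulli"
  shows "integral\<^sup>L bernoulli (\<lambda>\<omega>. f (\<phi> \<omega>)) = integral\<^sup>L bernoulli f"
  using assms integral_distr[of \<phi> bernoulli bernoulli f] by (simp add: preserves_bernoulli_def)

lemma preserves_square_integrable:
  assumes "preserves_bernoulli \<phi>" "square_integrable f"
  shows "square_integrable (\<lambda>\<omega>. f (\<phi> \<omega>))"
proof -
  have [measurable]: "f \<in> borel_measurable bernoulli" using assms(2) by (simp add: square_integrable_def)
  have "(\<lambda>\<omega>. (cmod (f \<omega>))\<^sup>2) \<in> borel_measurable bernoulli" by measurable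
  from preserves_integrable_iff[OF assms(1) this] preserves_measurable[OF assms(1), of f] assms(2)
  show ?thesis by (simp add: square_integrable_def)
qed

text \<open>The value 0 for a map that does not preserve the measure lets the lift respect almost
  everywhere equality for every map, so the map can stay a plain argument.\<close>

lift_definition koopman :: "(('i \<Rightarrow> bool) \<Rightarrow> ('j \<Rightarrow> bool)) \<Rightarrow> 'j L2 \<Rightarrow> 'i L2" is
  "\<lambda>\<phi> f \<omega>. if preserves_bernoulli \<phi> then f (\<phi> \<omega>) else 0"
  subgoal for \<phi> f g
    using preserves_square_integrable[of \<phi> f] preserves_square_integrable[of \<phi> g]
      preserves_AE[of \<phi> "\<lambda>\<omega>. f \<omega> = g \<omega>"]
    by (cases "preserves_bernoulli \<phi>") (simp_all add: L2_rel_def)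
  done

lemma koopman_add: "koopman \<phi> (f + g) = koopman \<phi> f + koopman \<phi> g"
  apply transfer
  subgoal for \<phi> f g
    using preserves_square_integrable[of \<phi> f] preserves_square_integrable[of \<phi> g]
    by (cases "preserves_bernoulli \<phi>") (simp_all add: L2_rel_def square_integrable_add)
  done

lemma koopman_abs:
  "preserves_bernoulli \<phi> \<Longrightarrow> square_integrable f \<Longrightarrow> koopman \<phi> (abs_L2 f) = abs_L2 (\<lambda>\<omega>. f (\<phi> \<omega>))"
  by (subst koopman.abs_eq) (simp_all add: L2_rel_def)

lemma koopman_scaleC: "koopman \<phi> (scaleC c f) = scaleC c (koopman \<phi> f)"
  apply transfer
  subgoal for \<phi> c f
    using preserves_square_integrable[of \<phi> f]
    by (cases "preserves_bernoulli \<phi>") (simp_all add: L2_rel_def square_integrable_cmult)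
  done

lemma cinner_koopman:
  assumes "preserves_bernoulli \<phi>"
  shows "cinner (koopman \<phi> f) (koopman \<phi> g) = cinner f g"
  using assms
proof (transfer, clarsimp simp: L2_rel_def)
  fix \<phi> :: "('a \<Rightarrow> bool) \<Rightarrow> ('b \<Rightarrow> bool)" and f g :: "('b \<Rightarrow> bool) \<Rightarrow> complex"
  assume *: "preserves_bernoulli \<phi>" "square_integrable f" "square_integrable g"
  show "(\<integral>\<omega>. f (\<phi> \<omega>) * cnj (g (\<phi> \<omega>)) \<partial>bernoulli) = (\<integral>\<omega>. f \<omega> * cnj (g \<omega>) \<partial>bernoulli)"
    by (rule preserves_integral[OF *(1), of "\<lambda>\<omega>. f \<omega> * cnj (g \<omega>)"])
      (use * in \<open>auto simp: square_integrable_def intro!: borel_measurable_times measurable_cnj\<close>)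
qed

lemma norm_koopman: "preserves_bernoulli \<phi> \<Longrightarrow> norm (koopman \<phi> f) = norm f"
  by (simp add: norm_L2_def inner_L2_def cinner_koopman)

lemma koopman_inverse:
  assumes "preserves_bernoulli \<phi>" "preserves_bernoulli \<psi>" "(\<lambda>\<omega>. \<phi> (\<psi> \<omega>)) = (\<lambda>\<omega>. \<omega>)"
  shows "koopman \<psi> (koopman \<phi> f) = f"
proof (induction f rule: L2.abs_induct)
  case (1 y)
  then have y: "square_integrable y" by (simp add: L2_rel_def)
  have "koopman \<psi> (koopman \<phi> (abs_L2 y)) = abs_L2 (\<lambda>\<omega>. y (\<phi> (\<psi> \<omega>)))"
    using assms(1,2) y preserves_square_integrable[OF assms(1) y] by (simp add: koopman_abs)
  moreover have "(\<lambda>\<omega>. y (\<phi> (\<psi> \<omega>))) = y"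
  proof
    fix \<omega> show "y (\<phi> (\<psi> \<omega>)) = y \<omega>" using fun_cong[OF assms(3), of \<omega>] by simp
  qed
  ultimately show ?case by simp
qed

text \<open>Apply the isometry \<open>koopman \<psi>\<close> to both arguments and cancel it against
  \<open>koopman \<phi>\<close>.\<close>

lemma cinner_koopman_inverse:
  assumes "preserves_bernoulli \<phi>" "preserves_bernoulli \<psi>" "(\<lambda>\<omega>. \<phi> (\<psi> \<omega>)) = (\<lambda>\<omega>. \<omega>)"
  shows "cinner (koopman \<phi> f) g = cinner f (koopman \<psi> g)"
proof -
  have "koopman \<psi> (koopman \<phi> f) = f" by (rule koopman_inverse[of \<phi> \<psi>]) (fact assms)+
  moreover have "cinner (koopman \<psi> (koopman \<phi> f)) (koopman \<psi> g) = cinner (koopman \<phi> f) g"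
    by (rule cinner_koopman) (fact assms)
  ultimately show ?thesis by simp
qed

section \<open>Representatives of classes and completeness\<close>

lemma square_integrable_diff:
  "square_integrable f \<Longrightarrow> square_integrable g \<Longrightarrow> square_integrable (\<lambda>\<omega>. f \<omega> - g \<omega>)"
  using square_integrable_add[OF _ square_integrable_cmult[of g "-1"], of f] by simp

lemma abs_L2_add:
  "square_integrable f \<Longrightarrow> square_integrable g \<Longrightarrow> abs_L2 f + abs_L2 g = abs_L2 (\<lambda>\<omega>. f \<omega> + g \<omega>)"
  by (simp add: plus_L2.abs_eq L2_rel_def)

lemma abs_L2_scaleC:
  "square_integrable f \<Longrightarrow> scaleC c (abs_L2 f) = abs_L2 (\<lambda>\<omega>. c * f \<omega>)"
  by (simp add: scaleC.abs_eq L2_rel_def)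

lemma abs_L2_diff:
  assumes "square_integrable f" "square_integrable g"
  shows "abs_L2 f - abs_L2 g = abs_L2 (\<lambda>\<omega>. f \<omega> - g \<omega>)"
proof -
  have "abs_L2 f - abs_L2 g + abs_L2 g = abs_L2 (\<lambda>\<omega>. f \<omega> - g \<omega>) + abs_L2 g"
    using assms by (simp add: abs_L2_add square_integrable_diff)
  then show ?thesis by (rule add_right_imp_eq)
qed

lemma abs_L2_cases:
  obtains u where "f = abs_L2 u" "square_integrable u"
  by (induction f rule: L2.abs_induct) (auto simp: L2_rel_def)

lemma norm_abs_L2:
  assumes "square_integrable f"
  shows "(norm (abs_L2 f))\<^sup>2 = (\<integral>\<omega>. (cmod (f \<omega>))\<^sup>2 \<partial>bernoulli)"
proof -
  have "complex_of_real ((norm (abs_L2 f))\<^sup>2) = (\<integral>\<omega>. f \<omega> * cnj (f \<omega>) \<partial>bernoulli)"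
    unfolding cinner_self[symmetric] using assms by (simp add: cinner.abs_eq L2_rel_def)
  also have "\<dots> = complex_of_real (\<integral>\<omega>. (cmod (f \<omega>))\<^sup>2 \<partial>bernoulli)"
    by (simp only: complex_norm_square[symmetric] integral_complex_of_real)
  finally show ?thesis by (simp only: of_real_eq_iff)
qed

lemma ennreal_norm_abs_L2:
  assumes "square_integrable f"
  shows "(\<integral>\<^sup>+\<omega>. ennreal ((cmod (f \<omega>))\<^sup>2) \<partial>bernoulli) = ennreal ((norm (abs_L2 f))\<^sup>2)"
  unfolding norm_abs_L2[OF assms]
  by (rule nn_integral_eq_integral) (use assms in \<open>auto simp: square_integrable_def\<close>)

lemma square_integrableI_nn:
  assumes f: "f \<in> borel_measurable bernoulli"
    and b: "(\<integral>\<^sup>+\<omega>. ennreal ((cmod (f \<omega>))\<^sup>2) \<partial>bernoulli) < \<infinity>"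
  shows "square_integrable f"
  unfolding square_integrable_def
proof
  have "(\<lambda>\<omega>. (cmod (f \<omega>))\<^sup>2) \<in> borel_measurable bernoulli" using f by measurable
  then show "integrable bernoulli (\<lambda>\<omega>. (cmod (f \<omega>))\<^sup>2)"
    by (rule integrableI_bounded) (use b in simp)
qed (rule f)

text \<open>The squared increments are weighted by 2^n: the n-th weighted integral is at most 2^n
  (2^-n)^2 = 2^-n, so the weighted squares are summable almost everywhere, and the inequality of
  arithmetic and geometric means turns this into absolute convergence of the increments.\<close>

lemma AE_convergent_if_summable_norms:
  fixes v :: "nat \<Rightarrow> ('i \<Rightarrow> bool) \<Rightarrow> complex"
  assumes v: "\<And>n. square_integrable (v n)"
    and d: "\<And>n. norm (abs_L2 (v (Suc n)) - abs_L2 (v n)) \<le> (1/2) ^ n"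
  shows "AE \<omega> in bernoulli. convergent (\<lambda>n. v n \<omega>)"
proof -
  let ?B = "bernoulli :: ('i \<Rightarrow> bool) measure"
  define g where "g n \<omega> = (2::real) ^ n * (cmod (v (Suc n) \<omega> - v n \<omega>))\<^sup>2" for n \<omega>
  have [measurable]: "v n \<in> borel_measurable bernoulli" for n
    using v by (simp add: square_integrable_def)
  have [measurable]: "g n \<in> borel_measurable bernoulli" for n unfolding g_def by measurable
  have "(\<integral>\<^sup>+\<omega>. ennreal (g n \<omega>) \<partial>?B) \<le> ennreal ((1/2) ^ n)" for n
  proof -
    have "(\<integral>\<^sup>+\<omega>. ennreal (g n \<omega>) \<partial>?B)
        = ennreal (2 ^ n) * (\<integral>\<^sup>+\<omega>. ennreal ((cmod (v (Suc n) \<omega> - v n \<omega>))\<^sup>2) \<partial>?B)"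
      unfolding g_def by (subst nn_integral_cmult[symmetric]) (auto simp: ennreal_mult)
    also have "\<dots> = ennreal (2 ^ n * (norm (abs_L2 (v (Suc n)) - abs_L2 (v n)))\<^sup>2)"
      by (subst ennreal_norm_abs_L2) (simp_all add: v square_integrable_diff abs_L2_diff ennreal_mult)
    also have "\<dots> \<le> ennreal ((1/2) ^ n)"
    proof (rule ennreal_leI)
      have "(norm (abs_L2 (v (Suc n)) - abs_L2 (v n)))\<^sup>2 \<le> ((1/2) ^ n)\<^sup>2"
        by (rule power_mono[OF d]) simp
      then have "2 ^ n * (norm (abs_L2 (v (Suc n)) - abs_L2 (v n)))\<^sup>2 \<le> 2 ^ n * ((1/2) ^ n)\<^sup>2"
        by simp
      also have "\<dots> = (1/2) ^ n" by (simp add: power2_eq_square field_simps)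
      finally show "2 ^ n * (norm (abs_L2 (v (Suc n)) - abs_L2 (v n)))\<^sup>2 \<le> (1/2) ^ n" .
    qed
    finally show ?thesis .
  qed
  then have "(\<Sum>n. \<integral>\<^sup>+\<omega>. ennreal (g n \<omega>) \<partial>?B) \<le> (\<Sum>n. ennreal ((1/2) ^ n))"
    by (intro suminf_le) auto
  also have "\<dots> = ennreal 2"
    using geometric_sums[of "1/2::real"] by (intro suminf_ennreal_eq) (auto simp: sums_iff)
  finally have "(\<integral>\<^sup>+\<omega>. (\<Sum>n. ennreal (g n \<omega>)) \<partial>?B) \<le> ennreal 2"
    by (subst nn_integral_suminf) auto
  then have "(\<integral>\<^sup>+\<omega>. (\<Sum>n. ennreal (g n \<omega>)) \<partial>?B) \<noteq> \<infinity>"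
    by (metis ennreal_less_top infinity_ennreal_def leD)
  then have "AE \<omega> in ?B. (\<Sum>n. ennreal (g n \<omega>)) \<noteq> \<infinity>"
    by (intro nn_integral_noteq_infinite) auto
  then show ?thesis
  proof eventually_elim
    case (elim \<omega>)
    have s: "summable (\<lambda>n. g n \<omega>)"
      by (rule summable_suminf_not_top) (use elim in \<open>auto simp: g_def\<close>)
    have "summable (\<lambda>n. v (Suc n) \<omega> - v n \<omega>)"
    proof (rule summable_comparison_test')
      show "summable (\<lambda>n. (g n \<omega> + (1/2) ^ n) / 2)"
        by (intro summable_divide summable_add s summable_geometric) simp
      fix n
      define t where "t = cmod (v (Suc n) \<omega> - v n \<omega>)"
      have "0 \<le> (2 ^ n * t - 1)\<^sup>2" by simp
      then have "2 * (2 ^ n * t) \<le> (2 ^ n * t)\<^sup>2 + 1" by (simp add: power2_diff)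
      then have "2 * t \<le> 2 ^ n * t\<^sup>2 + (1/2) ^ n"
        by (simp add: power2_eq_square field_simps)
      then show "norm (v (Suc n) \<omega> - v n \<omega>) \<le> (g n \<omega> + (1/2) ^ n) / 2"
        by (simp add: g_def t_def)
    qed
    then have "convergent (\<lambda>n. v n \<omega> - v 0 \<omega>)"
      unfolding summable_iff_convergent sum_lessThan_telescope[of "\<lambda>n. v n \<omega>"] .
    then show "convergent (\<lambda>n. v n \<omega>)"
      using convergent_add[OF _ convergent_const[of "v 0 \<omega>"]] by fastforce
  qed
qed

text \<open>Riesz-Fischer. The fixed point argument for the Hilbert space resolvent rests on this
  completeness.\<close>

instance L2 :: (type) complete_space
proof
  fix X :: "nat \<Rightarrow> 'a L2"
  let ?B = "bernoulli :: ('a \<Rightarrow> bool) measure"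
  assume "Cauchy X"
  then have "\<exists>N. \<forall>m\<ge>N. \<forall>n\<ge>N. dist (X m) (X n) < (1/2) ^ k" for k
    by (auto simp: Cauchy_def)
  then obtain N where N: "\<And>k m n. m \<ge> N k \<Longrightarrow> n \<ge> N k \<Longrightarrow> dist (X m) (X n) < (1/2) ^ k"
    by metis
  \<comment> \<open>The sum dominates \<open>N 0\<close>, ..., \<open>N n\<close> at once, so
    \<open>r n\<close> is a valid threshold for all accuracies up to the n-th.\<close>
  define r where "r n = (\<Sum>k\<le>n. N k)" for n
  have r: "N k \<le> r n" if "k \<le> n" for k n
    unfolding r_def by (rule member_le_sum) (use that in auto)
  have "\<exists>v. X (r n) = abs_L2 v \<and> square_integrable v" for n by (metis abs_L2_cases)
  then obtain v where v: "\<And>n. X (r n) = abs_L2 (v n)" "\<And>n. square_integrable (v n)" by metis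
  have [measurable]: "v n \<in> borel_measurable bernoulli" for n
    using v(2) by (simp add: square_integrable_def)
  have close: "norm (abs_L2 (v m) - abs_L2 (v n)) \<le> (1/2) ^ n" if "m \<ge> n" for m n
    using N[where k = n and m = "r m" and n = "r n"] r[OF that] r[of n n] by (simp add: v(1) dist_norm)
  have conv: "AE \<omega> in ?B. convergent (\<lambda>n. v n \<omega>)"
    by (rule AE_convergent_if_summable_norms[OF v(2) close]) simp
  \<comment> \<open>Off the set of convergence the value of \<open>lim\<close> is arbitrary; that
    set has full measure.\<close>
  define w where "w \<omega> = lim (\<lambda>n. v n \<omega>)" for \<omega>
  have [measurable]: "w \<in> borel_measurable bernoulli" unfolding w_def by measurable
  \<comment> \<open>Fatou turns the pointwise limit into a norm bound, which also yields the square
    integrability of the limit.\<close>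
  have fatou: "(\<integral>\<^sup>+\<omega>. ennreal ((cmod (w \<omega> - v n \<omega>))\<^sup>2) \<partial>?B) \<le> ennreal (((1/2) ^ n)\<^sup>2)" for n
  proof -
    have "AE \<omega> in ?B. ennreal ((cmod (w \<omega> - v n \<omega>))\<^sup>2)
        = liminf (\<lambda>m. ennreal ((cmod (v m \<omega> - v n \<omega>))\<^sup>2))"
      using conv
    proof eventually_elim
      case (elim \<omega>)
      then have "(\<lambda>m. v m \<omega>) \<longlonglongrightarrow> w \<omega>" by (simp add: w_def convergent_LIMSEQ_iff)
      then have "(\<lambda>m. ennreal ((cmod (v m \<omega> - v n \<omega>))\<^sup>2)) \<longlonglongrightarrow> ennreal ((cmod (w \<omega> - v n \<omega>))\<^sup>2)"
        by (intro tendsto_intros)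
      then show ?case by (rule lim_imp_Liminf[OF sequentially_bot, symmetric])
    qed
    then have "(\<integral>\<^sup>+\<omega>. ennreal ((cmod (w \<omega> - v n \<omega>))\<^sup>2) \<partial>?B)
        = (\<integral>\<^sup>+\<omega>. liminf (\<lambda>m. ennreal ((cmod (v m \<omega> - v n \<omega>))\<^sup>2)) \<partial>?B)"
      by (rule nn_integral_cong_AE)
    also have "\<dots> \<le> liminf (\<lambda>m. \<integral>\<^sup>+\<omega>. ennreal ((cmod (v m \<omega> - v n \<omega>))\<^sup>2) \<partial>?B)"
      by (rule nn_integral_liminf) measurable
    also have "\<dots> \<le> ennreal (((1/2) ^ n)\<^sup>2)"
    proof (rule Liminf_le)
      show "\<forall>\<^sub>F m in sequentially. (\<integral>\<^sup>+\<omega>. ennreal ((cmod (v m \<omega> - v n \<omega>))\<^sup>2) \<partial>?B) \<le> ennreal (((1/2) ^ n)\<^sup>2)"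
        using eventually_ge_at_top[of n]
      proof eventually_elim
        case (elim m)
        have "(\<integral>\<^sup>+\<omega>. ennreal ((cmod (v m \<omega> - v n \<omega>))\<^sup>2) \<partial>?B) = ennreal ((norm (abs_L2 (v m) - abs_L2 (v n)))\<^sup>2)"
          by (subst ennreal_norm_abs_L2) (simp_all add: v square_integrable_diff abs_L2_diff)
        also have "\<dots> \<le> ennreal (((1/2) ^ n)\<^sup>2)"
          by (intro ennreal_leI power_mono close elim) simp
        finally show ?case .
      qed
    qed simp
    finally show ?thesis .
  qed
  have wv: "square_integrable (\<lambda>\<omega>. w \<omega> - v n \<omega>)" for n
  proof (rule square_integrableI_nn)
    show "(\<integral>\<^sup>+\<omega>. ennreal ((cmod (w \<omega> - v n \<omega>))\<^sup>2) \<partial>?B) < \<infinity>"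
      using fatou[of n] by (rule le_less_trans) simp
  qed measurable
  have w: "square_integrable w" using square_integrable_add[OF wv[of 0] v(2)[of 0]] by simp
  have lim: "dist (abs_L2 w) (X (r n)) \<le> (1/2) ^ n" for n
  proof -
    have "ennreal ((norm (abs_L2 w - X (r n)))\<^sup>2) \<le> ennreal (((1/2) ^ n)\<^sup>2)"
      unfolding v(1) abs_L2_diff[OF w v(2)] ennreal_norm_abs_L2[OF wv, symmetric] by (rule fatou)
    then have "(norm (abs_L2 w - X (r n)))\<^sup>2 \<le> ((1/2) ^ n)\<^sup>2" by (subst (asm) ennreal_le_iff) simp_all
    then show ?thesis unfolding dist_norm by (rule power2_le_imp_le) simp
  qed
  have "X \<longlonglongrightarrow> abs_L2 w"
  proof (rule metric_LIMSEQ_I)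
    fix e :: real assume "e > 0"
    then obtain k where k: "(1/2) ^ k < e / 2" using real_arch_pow_inv[of "e/2" "1/2"] by auto
    have "dist (X n) (abs_L2 w) < e" if "n \<ge> N k" for n
    proof -
      have "dist (X n) (abs_L2 w) \<le> dist (X n) (X (r k)) + dist (X (r k)) (abs_L2 w)"
        by (rule dist_triangle)
      also have "\<dots> < e"
        using N[OF that r[of k k]] lim[of k] k by (simp add: dist_commute)
      finally show ?thesis .
    qed
    then show "\<exists>no. \<forall>n\<ge>no. dist (X n) (abs_L2 w) < e" by blast
  qed
  then show "convergent X" by (rule convergentI)
qed

section \<open>Density of simple functions\<close>

lemma abs_L2_tendsto_dominated:
  fixes f :: "('i \<Rightarrow> bool) \<Rightarrow> complex"
  assumes s: "\<And>n. square_integrable (s n)" and f: "square_integrable f" and w: "integrable bernoulli w"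
    and lim: "\<And>\<omega>. (\<lambda>n. s n \<omega>) \<longlonglongrightarrow> f \<omega>" and b: "\<And>n \<omega>. (cmod (s n \<omega> - f \<omega>))\<^sup>2 \<le> w \<omega>"
  shows "(\<lambda>n. abs_L2 (s n)) \<longlonglongrightarrow> abs_L2 f"
proof -
  have [measurable]: "s n \<in> borel_measurable bernoulli" "f \<in> borel_measurable bernoulli" for n
    using s f by (simp_all add: square_integrable_def)
  have "(\<lambda>n. \<integral>\<omega>. (cmod (s n \<omega> - f \<omega>))\<^sup>2 \<partial>bernoulli) \<longlonglongrightarrow> (\<integral>\<omega>. 0 \<partial>(bernoulli :: ('i \<Rightarrow> bool) measure))"
  proof (rule integral_dominated_convergence[where w = w])
    show "AE \<omega> in bernoulli. (\<lambda>n. (cmod (s n \<omega> - f \<omega>))\<^sup>2) \<longlonglongrightarrow> 0"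
    proof (rule AE_I2)
      fix \<omega>
      have "(\<lambda>n. (cmod (s n \<omega> - f \<omega>))\<^sup>2) \<longlonglongrightarrow> (cmod (f \<omega> - f \<omega>))\<^sup>2"
        by (intro tendsto_intros lim)
      then show "(\<lambda>n. (cmod (s n \<omega> - f \<omega>))\<^sup>2) \<longlonglongrightarrow> 0" by simp
    qed
  qed (use w b in auto)
  then have "(\<lambda>n. (norm (abs_L2 (s n) - abs_L2 f))\<^sup>2) \<longlonglongrightarrow> 0"
    by (simp add: abs_L2_diff s f norm_abs_L2 square_integrable_diff)
  then have "(\<lambda>n. sqrt ((norm (abs_L2 (s n) - abs_L2 f))\<^sup>2)) \<longlonglongrightarrow> sqrt 0"
    by (rule tendsto_real_sqrt)
  then have "(\<lambda>n. norm (abs_L2 (s n) - abs_L2 f)) \<longlonglongrightarrow> 0" by simp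
  then show ?thesis by (simp add: LIM_zero_iff tendsto_norm_zero_iff)
qed

lemma square_integrable_indicator:
  "A \<in> sets bernoulli \<Longrightarrow> square_integrable (\<lambda>\<omega>. of_bool (\<omega> \<in> A))"
  by (rule square_integrable_bounded[where B = 1]) (auto simp: of_bool_def)

text \<open>Simple functions lie in G as finite combinations of indicators of their fibres, and
  dominated convergence carries this over to every class.\<close>

lemma closed_subspace_eq_UNIV:
  assumes add: "\<And>f g. f \<in> G \<Longrightarrow> g \<in> G \<Longrightarrow> f + g \<in> G"
    and scale: "\<And>c f. f \<in> G \<Longrightarrow> scaleC c f \<in> G"
    and cl: "closed G"
    and ind: "\<And>A. A \<in> sets bernoulli \<Longrightarrow> abs_L2 (\<lambda>\<omega>. of_bool (\<omega> \<in> A)) \<in> G"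
  shows "G = UNIV"
proof -
  have zero: "0 \<in> G" using scale[OF ind[of "{}"], of 0] by simp
  have "f \<in> G" for f
  proof (cases f rule: abs_L2_cases)
    case (1 u)
    then have [measurable]: "u \<in> borel_measurable bernoulli" by (simp add: square_integrable_def)
    then obtain s where s: "\<And>n. simple_function bernoulli (s n)" "\<And>\<omega>. (\<lambda>n. s n \<omega>) \<longlonglongrightarrow> u \<omega>"
        "\<And>n \<omega>. dist (s n \<omega>) 0 \<le> 2 * dist (u \<omega>) 0"
      using borel_measurable_implies_sequence_metric[of u bernoulli 0] by auto
    have sm [measurable]: "s n \<in> borel_measurable bernoulli" for n
      using s(1) by (rule borel_measurable_simple_function)
    have sq: "square_integrable (s n)" for n
      unfolding square_integrable_def
    proof
      show "integrable bernoulli (\<lambda>\<omega>. (cmod (s n \<omega>))\<^sup>2)"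
      proof (rule Bochner_Integration.integrable_bound)
        show "integrable bernoulli (\<lambda>\<omega>. 4 * (cmod (u \<omega>))\<^sup>2)"
          using 1 by (simp add: square_integrable_def)
        show "AE \<omega> in bernoulli. norm ((cmod (s n \<omega>))\<^sup>2) \<le> norm (4 * (cmod (u \<omega>))\<^sup>2)"
          using power_mono[OF s(3), of _ _ 2] by (auto simp: power_mult_distrib)
      qed measurable
    qed (rule sm)
    have mem: "abs_L2 (s n) \<in> G" for n
    proof -
      let ?t = "\<lambda>y \<omega>. y * of_bool (\<omega> \<in> s n -` {y})"
      have fin: "finite (range (s n))" and ms: "\<And>y. s n -` {y} \<in> sets bernoulli"
        using s(1)[of n] measurable_sets[OF sm, of "{_}" n] by (auto simp: simple_function_def)
      have *: "square_integrable (\<lambda>\<omega>. \<Sum>y\<in>F. ?t y \<omega>) \<and> abs_L2 (\<lambda>\<omega>. \<Sum>y\<in>F. ?t y \<omega>) \<in> G"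
        if "finite F" for F using that
      proof induction
        case empty
        then show ?case using zero by (simp add: zero_L2_def)
      next
        case (insert y F)
        have t: "square_integrable (?t y)"
          by (intro square_integrable_cmult square_integrable_indicator ms)
        have "abs_L2 (?t y) = scaleC y (abs_L2 (\<lambda>\<omega>. of_bool (\<omega> \<in> s n -` {y})))"
          by (rule abs_L2_scaleC[symmetric]) (rule square_integrable_indicator[OF ms])
        then have "abs_L2 (?t y) \<in> G" using ind[OF ms] scale by simp
        then have "abs_L2 (?t y) + abs_L2 (\<lambda>\<omega>. \<Sum>y\<in>F. ?t y \<omega>) \<in> G"
          using insert.IH add by blast
        moreover have "(\<lambda>\<omega>. \<Sum>z\<in>insert y F. ?t z \<omega>) = (\<lambda>\<omega>. ?t y \<omega> + (\<Sum>z\<in>F. ?t z \<omega>))"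
          using insert.hyps by (simp only: sum.insert not_False_eq_True)
        ultimately show ?case
          using insert.IH t by (simp only: abs_L2_add square_integrable_add)
      qed
      have "s n = (\<lambda>\<omega>. \<Sum>y\<in>range (s n). ?t y \<omega>)"
      proof
        fix \<omega>
        have "(\<Sum>y\<in>range (s n). ?t y \<omega>) = (\<Sum>y\<in>{s n \<omega>}. ?t y \<omega>)"
          by (rule sum.mono_neutral_right) (auto simp: fin)
        then show "s n \<omega> = (\<Sum>y\<in>range (s n). ?t y \<omega>)" by simp
      qed
      then show ?thesis using *[OF fin] by simp
    qed
    have "(\<lambda>n. abs_L2 (s n)) \<longlonglongrightarrow> abs_L2 u"
    proof (rule abs_L2_tendsto_dominated)
      show "integrable bernoulli (\<lambda>\<omega>. 9 * (cmod (u \<omega>))\<^sup>2)"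
        using 1 by (simp add: square_integrable_def)
      fix n \<omega>
      \<comment> \<open>The approximations satisfy |s| \<le> 2 |u|; hence the factor 3, and 9 after
        squaring.\<close>
      have "cmod (s n \<omega> - u \<omega>) \<le> 3 * cmod (u \<omega>)"
        using norm_triangle_ineq4[of "s n \<omega>" "u \<omega>"] s(3)[of n \<omega>] by simp
      from power_mono[OF this, of 2] show "(cmod (s n \<omega> - u \<omega>))\<^sup>2 \<le> 9 * (cmod (u \<omega>))\<^sup>2"
        by (simp add: power_mult_distrib)
    qed (use sq 1 s in auto)
    then show "f \<in> G" using closed_sequentially[OF cl mem] 1 by simp
  qed
  then show ?thesis by blast
qed

section \<open>The operators in coordinates\<close>

lemma preserves_shift: "preserves_bernoulli (\<lambda>\<omega> n. \<omega> (Suc n))"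
  using preserves_reindex[of Suc] by simp

lemma measurable_case_nat: "case_nat b \<in> measurable bernoulli bernoulli"
proof -
  have "(\<lambda>\<omega> i. case_nat b \<omega> i) \<in> measurable bernoulli (PiM UNIV (\<lambda>_. measure_pmf (bernoulli_pmf (1/2))))"
  proof (rule measurable_PiM_single')
    fix i
    show "(\<lambda>\<omega>. case_nat b \<omega> i) \<in> measurable bernoulli (measure_pmf (bernoulli_pmf (1/2)))"
      unfolding measurable_cong_sets[OF refl sets_measure_pmf_count_space]
      by (cases i) simp_all
  qed simp
  then show ?thesis by (simp add: bernoulli_def)
qed

abbreviation flip0 :: "(nat \<Rightarrow> bool) \<Rightarrow> nat \<Rightarrow> bool" where
  "flip0 \<omega> \<equiv> \<lambda>n. \<omega> n \<noteq> (n = 0)"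

text \<open>Prefixing a symbol does not preserve the measure, since its range has measure 1/2.
  Composed with the shift it becomes the identity or a flip of the first symbol, both measure
  preserving; the next lemmas transfer their claims through the shift in this way.\<close>

lemma case_nat_shift: "case_nat b (\<lambda>n. \<omega> (Suc n)) = (if \<omega> 0 = b then \<omega> else flip0 \<omega>)"
  by (auto simp: fun_eq_iff split: nat.split)

lemma AE_case_nat:
  assumes "AE \<omega> in bernoulli. P \<omega>"
  shows "AE \<omega> in bernoulli. P (case_nat b \<omega>)"
proof -
  \<comment> \<open>The exceptional set is enlarged to a measurable null set, because transport
    along a distribution asks for a measurable predicate.\<close>
  from AE_E[OF assms] obtain N where N: "{\<omega>. \<not> P \<omega>} \<subseteq> N" "N \<in> sets bernoulli" "emeasure bernoulli N = 0"
    by auto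
  have N0: "AE \<omega> in bernoulli. \<omega> \<notin> N"
    by (rule AE_I'[of N]) (use N in \<open>auto simp: null_sets_def\<close>)
  have "AE \<omega> in bernoulli. case_nat b (\<lambda>n. \<omega> (Suc n)) \<notin> N"
    using N0 preserves_AE[OF preserves_flip[of "\<lambda>n. n = 0"] N0]
    by eventually_elim (simp add: case_nat_shift)
  moreover have "{\<omega> \<in> space bernoulli. case_nat b \<omega> \<notin> N} \<in> sets bernoulli"
    using measurable_sets[OF measurable_case_nat sets.compl_sets[OF N(2)], of b]
    by (simp add: vimage_def)
  ultimately have "AE \<omega> in distr bernoulli bernoulli (\<lambda>\<omega> n. \<omega> (Suc n)). case_nat b \<omega> \<notin> N"
    using preserves_shift by (subst AE_distr_iff) (auto simp: preserves_bernoulli_def)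
  moreover have d: "distr bernoulli bernoulli (\<lambda>\<omega> n. \<omega> (Suc n)) = (bernoulli :: (nat \<Rightarrow> bool) measure)"
    using preserves_shift by (simp add: preserves_bernoulli_def)
  ultimately have "AE \<omega> in bernoulli. case_nat b \<omega> \<notin> N" by (simp only: d)
  then show ?thesis by eventually_elim (use N in auto)
qed

lemma integrable_case_nat:
  fixes G :: "(nat \<Rightarrow> bool) \<Rightarrow> 'b :: {banach, second_countable_topology}"
  assumes "integrable bernoulli G"
  shows "integrable bernoulli (\<lambda>\<omega>. G (case_nat b \<omega>))"
proof -
  have G [measurable]: "G \<in> borel_measurable bernoulli" using assms by simp
  have m: "(\<lambda>\<omega>. G (case_nat b \<omega>)) \<in> borel_measurable bernoulli"
    using measurable_compose[OF measurable_case_nat G] .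
  have i2: "integrable bernoulli (\<lambda>\<omega>. G (flip0 \<omega>))"
    using preserves_integrable_iff[OF preserves_flip[of "\<lambda>n. n = 0"] G] assms by simp
  have "integrable bernoulli (\<lambda>\<omega>. G (case_nat b (\<lambda>n. \<omega> (Suc n))))"
  proof (rule Bochner_Integration.integrable_bound)
    show "integrable bernoulli (\<lambda>\<omega>. norm (G \<omega>) + norm (G (flip0 \<omega>)))"
      using assms i2 by simp
    show "(\<lambda>\<omega>. G (case_nat b (\<lambda>n. \<omega> (Suc n)))) \<in> borel_measurable bernoulli"
      using preserves_measurable[OF preserves_shift m] .
    show "AE \<omega> in bernoulli. norm (G (case_nat b (\<lambda>n. \<omega> (Suc n)))) \<le> norm (norm (G \<omega>) + norm (G (flip0 \<omega>)))"
      by (intro AE_I2) (simp add: case_nat_shift)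
  qed
  then show ?thesis using preserves_integrable_iff[OF preserves_shift m] by simp
qed

text \<open>After composition with the shift, one of the two terms is G and the other is G after a
  flip of the first symbol, which has the same integral.\<close>

lemma integral_case_nat:
  fixes G :: "(nat \<Rightarrow> bool) \<Rightarrow> complex"
  assumes G: "integrable bernoulli G"
  shows "integral\<^sup>L bernoulli G
    = (\<integral>\<omega>. (G (case_nat False \<omega>) + G (case_nat True \<omega>)) / 2 \<partial>bernoulli)"
proof -
  have Gm: "G \<in> borel_measurable bernoulli" using G by simp
  have m: "(\<lambda>\<omega>. (G (case_nat False \<omega>) + G (case_nat True \<omega>)) / 2) \<in> borel_measurable bernoulli"
    using integrable_case_nat[OF G, of False] integrable_case_nat[OF G, of True] by simp
  have i2: "integrable bernoulli (\<lambda>\<omega>. G (flip0 \<omega>))"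
    using preserves_integrable_iff[OF preserves_flip[of "\<lambda>n. n = 0"] Gm] G by simp
  have "(\<integral>\<omega>. (G (case_nat False \<omega>) + G (case_nat True \<omega>)) / 2 \<partial>bernoulli)
      = (\<integral>\<omega>. (G (case_nat False (\<lambda>n. \<omega> (Suc n))) + G (case_nat True (\<lambda>n. \<omega> (Suc n)))) / 2 \<partial>bernoulli)"
    using preserves_integral[OF preserves_shift m] by simp
  also have "\<dots> = (\<integral>\<omega>. (G \<omega> + G (flip0 \<omega>)) / 2 \<partial>bernoulli)"
    by (rule Bochner_Integration.integral_cong) (auto simp: case_nat_shift)
  also have "\<dots> = (integral\<^sup>L bernoulli G + (\<integral>\<omega>. G (flip0 \<omega>) \<partial>bernoulli)) / 2"
    using G i2 by simp
  also have "(\<integral>\<omega>. G (flip0 \<omega>) \<partial>bernoulli) = integral\<^sup>L bernoulli G"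
    by (rule preserves_integral[OF preserves_flip Gm])
  finally show ?thesis by simp
qed

lemma square_integrable_case_nat:
  assumes "square_integrable g"
  shows "square_integrable (\<lambda>\<omega>. g (case_nat b \<omega>))"
  using assms integrable_case_nat[of "\<lambda>\<omega>. (cmod (g \<omega>))\<^sup>2" b]
    measurable_compose[OF measurable_case_nat, of g borel b]
  by (simp add: square_integrable_def)

lemma square_integrable_avg:
  assumes "square_integrable g"
  shows "square_integrable (\<lambda>\<omega>. (g (case_nat False \<omega>) + g (case_nat True \<omega>)) / 2)"
  using square_integrable_cmult[OF square_integrable_add[OF square_integrable_case_nat[OF assms, of False]
      square_integrable_case_nat[OF assms, of True]], of "1/2"]
  by simp

text \<open>The transfer operator of the one-sided shift. Given by a formula on functions, it can be
  evaluated on polynomials, whereas \<open>V_Lplus\<close> is known only as an adjoint until the two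
  are identified.\<close>

lift_definition avg_op :: "nat L2 \<Rightarrow> nat L2" is
  "\<lambda>g \<omega>. (g (case_nat False \<omega>) + g (case_nat True \<omega>)) / 2"
proof -
  fix f g :: "(nat \<Rightarrow> bool) \<Rightarrow> complex"
  assume "L2_rel f g"
  then have fg: "square_integrable f" "square_integrable g" "AE \<omega> in bernoulli. f \<omega> = g \<omega>"
    by (simp_all add: L2_rel_def)
  have "AE \<omega> in bernoulli. (f (case_nat False \<omega>) + f (case_nat True \<omega>)) / 2
      = (g (case_nat False \<omega>) + g (case_nat True \<omega>)) / 2"
    using AE_case_nat[OF fg(3), of False] AE_case_nat[OF fg(3), of True]
    by eventually_elim simp
  then show "L2_rel (\<lambda>\<omega>. (f (case_nat False \<omega>) + f (case_nat True \<omega>)) / 2)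
      (\<lambda>\<omega>. (g (case_nat False \<omega>) + g (case_nat True \<omega>)) / 2)"
    using fg square_integrable_avg by (simp add: L2_rel_def)
qed

lemma avg_op_abs:
  "square_integrable g \<Longrightarrow>
     avg_op (abs_L2 g) = abs_L2 (\<lambda>\<omega>. (g (case_nat False \<omega>) + g (case_nat True \<omega>)) / 2)"
  by (rule avg_op.abs_eq) (simp add: L2_rel_def)

section \<open>One-sided operators and their adjoints\<close>

lemma U_Lplus_eq_koopman: "U_Lplus = koopman (\<lambda>\<omega> n. \<omega> (Suc n))"
proof
  fix f :: "nat L2"
  show "U_Lplus f = koopman (\<lambda>\<omega> n. \<omega> (Suc n)) f"
    by (cases f rule: abs_L2_cases)
      (simp add: U_Lplus.abs_eq koopman_abs preserves_shift L2_rel_def)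
qed

lemma U_Rminus_eq_U_Lplus: "U_Rminus = U_Lplus"
  unfolding U_Rminus_def U_Lplus_def ..

lemma U_Lplus_abs: "square_integrable f \<Longrightarrow> U_Lplus (abs_L2 f) = abs_L2 (\<lambda>\<omega>. f (\<lambda>n. \<omega> (Suc n)))"
  by (simp add: U_Lplus_eq_koopman koopman_abs preserves_shift)

lemma cinner_abs:
  "square_integrable f \<Longrightarrow> square_integrable g \<Longrightarrow>
     cinner (abs_L2 f) (abs_L2 g) = (\<integral>\<omega>. f \<omega> * cnj (g \<omega>) \<partial>bernoulli)"
  by (simp add: cinner.abs_eq L2_rel_def)

lemma cinner_U_Lplus: "cinner (U_Lplus f) g = cinner f (avg_op g)"
proof -
  obtain u v where f: "f = abs_L2 u" "square_integrable u" and g: "g = abs_L2 v" "square_integrable v"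
    by (metis abs_L2_cases)
  have Uu: "square_integrable (\<lambda>\<omega>. u (\<lambda>n. \<omega> (Suc n)))"
    by (rule preserves_square_integrable[OF preserves_shift f(2)])
  have "cinner (U_Lplus f) g = (\<integral>\<omega>. u (\<lambda>n. \<omega> (Suc n)) * cnj (v \<omega>) \<partial>bernoulli)"
    by (simp add: f g U_Lplus_abs cinner_abs Uu)
  also have "\<dots> = (\<integral>\<omega>. (u \<omega> * cnj (v (case_nat False \<omega>)) + u \<omega> * cnj (v (case_nat True \<omega>))) / 2 \<partial>bernoulli)"
    using integral_case_nat[OF square_integrable_mult[OF Uu g(2)]] by simp
  also have "\<dots> = cinner f (avg_op g)"
    unfolding f g avg_op_abs[OF g(2)] cinner_abs[OF f(2) square_integrable_avg[OF g(2)]]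
    by (rule Bochner_Integration.integral_cong) (simp_all add: algebra_simps)
  finally show ?thesis .
qed

lemma V_Lplus_eq: "V_Lplus = avg_op"
  unfolding V_Lplus_def by (rule hilbert_adjoint_eqI) (rule cinner_U_Lplus)

lemma sign_op_abs:
  "square_integrable f \<Longrightarrow> sign_op (abs_L2 f) = abs_L2 (\<lambda>\<omega>. (- 1) ^ of_bool (\<omega> 0) * f \<omega>)"
  by (rule sign_op.abs_eq) (simp add: L2_rel_def)

lemma square_integrable_sign:
  "square_integrable f \<Longrightarrow> square_integrable (\<lambda>\<omega> :: nat \<Rightarrow> bool. (- 1) ^ of_bool (\<omega> 0) * f \<omega>)"
proof -
  assume f: "square_integrable f"
  have [measurable]: "f \<in> borel_measurable bernoulli" using f by (simp add: square_integrable_def)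
  have "(\<lambda>\<omega> :: nat \<Rightarrow> bool. (- 1) ^ of_bool (\<omega> 0) * f \<omega>) = (\<lambda>\<omega>. if \<omega> 0 then - f \<omega> else f \<omega>)" by auto
  moreover have "\<dots> \<in> borel_measurable bernoulli" by measurable
  moreover have "cmod ((- 1) ^ of_bool (\<omega> 0) * f \<omega>) = cmod (f \<omega>)" for \<omega>
    by (simp add: norm_mult norm_power)
  ultimately show ?thesis using f unfolding square_integrable_def by presburger
qed

lemma cinner_sign_op: "cinner (sign_op f) g = cinner f (sign_op g)"
proof -
  obtain u v where f: "f = abs_L2 u" "square_integrable u" and g: "g = abs_L2 v" "square_integrable v"
    by (metis abs_L2_cases)
  show ?thesis
    unfolding f g sign_op_abs[OF f(2)] sign_op_abs[OF g(2)]
      cinner_abs[OF f(2) square_integrable_sign[OF g(2)]] cinner_abs[OF square_integrable_sign[OF f(2)] g(2)]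
    by (simp add: algebra_simps)
qed

subsection \<open>Tensors\<close>

lemma tensor_abs:
  "square_integrable f \<Longrightarrow> square_integrable g \<Longrightarrow>
     abs_L2 f \<otimes>\<^sub>L abs_L2 g = abs_L2 (\<lambda>\<omega>. f (right_half \<omega>) * g (left_half \<omega>))"
  by (rule tensor.abs_eq) (simp_all add: L2_rel_def)

lemma tensor_add_left: "(f + f') \<otimes>\<^sub>L g = f \<otimes>\<^sub>L g + f' \<otimes>\<^sub>L g"
proof -
  obtain u v w where *: "f = abs_L2 u" "f' = abs_L2 v" "g = abs_L2 w"
    and [simp]: "square_integrable u" "square_integrable v" "square_integrable w"
    by (metis abs_L2_cases)
  have [simp]: "square_integrable (\<lambda>\<omega>. u \<omega> + v \<omega>)" by (rule square_integrable_add) simp_all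
  have [simp]: "square_integrable (\<lambda>\<omega>. u (right_half \<omega>) * w (left_half \<omega>))"
    "square_integrable (\<lambda>\<omega>. v (right_half \<omega>) * w (left_half \<omega>))"
    by (rule square_integrable_tensor; simp)+
  show ?thesis by (simp add: * abs_L2_add tensor_abs distrib_right)
qed

lemma tensor_add_right: "f \<otimes>\<^sub>L (g + g') = f \<otimes>\<^sub>L g + f \<otimes>\<^sub>L g'"
proof -
  obtain u v w where *: "g = abs_L2 u" "g' = abs_L2 v" "f = abs_L2 w"
    and [simp]: "square_integrable u" "square_integrable v" "square_integrable w"
    by (metis abs_L2_cases)
  have [simp]: "square_integrable (\<lambda>\<omega>. u \<omega> + v \<omega>)" by (rule square_integrable_add) simp_all
  have [simp]: "square_integrable (\<lambda>\<omega>. w (right_half \<omega>) * u (left_half \<omega>))"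
    "square_integrable (\<lambda>\<omega>. w (right_half \<omega>) * v (left_half \<omega>))"
    by (rule square_integrable_tensor; simp)+
  show ?thesis by (simp add: * abs_L2_add tensor_abs distrib_left)
qed

lemma tensor_scaleC_left: "scaleC c f \<otimes>\<^sub>L g = scaleC c (f \<otimes>\<^sub>L g)"
proof -
  obtain u w where *: "f = abs_L2 u" "g = abs_L2 w"
    and [simp]: "square_integrable u" "square_integrable w"
    by (metis abs_L2_cases)
  have [simp]: "square_integrable (\<lambda>\<omega>. c * u \<omega>)" by (rule square_integrable_cmult) simp
  have [simp]: "square_integrable (\<lambda>\<omega>. u (right_half \<omega>) * w (left_half \<omega>))"
    by (rule square_integrable_tensor; simp)
  show ?thesis by (simp add: * abs_L2_scaleC tensor_abs mult.assoc)
qed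

lemma tensor_scaleC_right: "f \<otimes>\<^sub>L scaleC c g = scaleC c (f \<otimes>\<^sub>L g)"
proof -
  obtain u w where *: "f = abs_L2 u" "g = abs_L2 w"
    and [simp]: "square_integrable u" "square_integrable w"
    by (metis abs_L2_cases)
  have [simp]: "square_integrable (\<lambda>\<omega>. c * w \<omega>)" by (rule square_integrable_cmult) simp
  have [simp]: "square_integrable (\<lambda>\<omega>. u (right_half \<omega>) * w (left_half \<omega>))"
    by (rule square_integrable_tensor; simp)
  show ?thesis by (simp add: * abs_L2_scaleC tensor_abs mult.left_commute)
qed

lemma tensor_zero_left [simp]: "0 \<otimes>\<^sub>L g = 0"
  using tensor_scaleC_left[of 0 0 g] by simp

lemma tensor_zero_right [simp]: "f \<otimes>\<^sub>L 0 = 0"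
  using tensor_scaleC_right[of f 0 0] by simp

lemma tensor_sum_left: "sum f A \<otimes>\<^sub>L g = (\<Sum>a\<in>A. f a \<otimes>\<^sub>L g)"
  by (induction A rule: infinite_finite_induct) (simp_all add: tensor_add_left)

lemma tensor_sum_right: "g \<otimes>\<^sub>L sum f A = (\<Sum>a\<in>A. g \<otimes>\<^sub>L f a)"
  by (induction A rule: infinite_finite_induct) (simp_all add: tensor_add_right)

text \<open>The right half reads the indices from 1 on, the left half those up to 0: disjoint
  families of independent coordinates.\<close>

lemma indep_var_halves:
  fixes F G :: "(nat \<Rightarrow> bool) \<Rightarrow> complex"
  assumes F: "F \<in> borel_measurable bernoulli" and G: "G \<in> borel_measurable bernoulli"
  shows "prob_space.indep_var bernoulli borel (\<lambda>\<omega>. F (right_half \<omega>)) borel (\<lambda>\<omega>. G (left_half \<omega>))"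
proof -
  let ?C = "measure_pmf (bernoulli_pmf (1/2))"
  let ?B = "bernoulli :: (int \<Rightarrow> bool) measure"
  let ?S = "{1..} :: int set" and ?T = "{..0} :: int set"
  interpret prob_space ?B by (rule prob_space_bernoulli)
  from indep_vars_coordinates have ind: "indep_var (PiM ?S (\<lambda>_. ?C)) (\<lambda>\<omega>. restrict \<omega> ?S) (PiM ?T (\<lambda>_. ?C)) (\<lambda>\<omega>. restrict \<omega> ?T)"
    by (rule indep_var_restrict) auto
  have "(\<lambda>x n. x (1 + int n)) \<in> measurable (PiM ?S (\<lambda>_. ?C)) bernoulli"
    unfolding bernoulli_def
    by (rule measurable_PiM_single')
      (auto simp: measurable_cong_sets[OF refl sets_measure_pmf_count_space] measurable_component_pmf)
  from measurable_compose[OF this F]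
  have F': "(\<lambda>x. F (\<lambda>n. x (1 + int n))) \<in> borel_measurable (PiM ?S (\<lambda>_. ?C))" .
  have "(\<lambda>x n. x (- int n)) \<in> measurable (PiM ?T (\<lambda>_. ?C)) bernoulli"
    unfolding bernoulli_def
    by (rule measurable_PiM_single')
      (auto simp: measurable_cong_sets[OF refl sets_measure_pmf_count_space] measurable_component_pmf)
  from measurable_compose[OF this G]
  have G': "(\<lambda>x. G (\<lambda>n. x (- int n))) \<in> borel_measurable (PiM ?T (\<lambda>_. ?C))" .
  from indep_var_compose[OF ind F' G'] show ?thesis
    by (simp add: comp_def right_half_def[abs_def] left_half_def[abs_def])
qed

lemma cinner_tensor: "cinner (f \<otimes>\<^sub>L g) (f' \<otimes>\<^sub>L g') = cinner f f' * cinner g g'"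
proof -
  interpret prob_space "bernoulli :: (int \<Rightarrow> bool) measure" by (rule prob_space_bernoulli)
  obtain u v u' v' where *: "f = abs_L2 u" "g = abs_L2 v" "f' = abs_L2 u'" "g' = abs_L2 v'"
    and sq [simp]: "square_integrable u" "square_integrable v" "square_integrable u'" "square_integrable v'"
    by (metis abs_L2_cases)
  have [simp]: "square_integrable (\<lambda>\<omega>. u (right_half \<omega>) * v (left_half \<omega>))"
    "square_integrable (\<lambda>\<omega>. u' (right_half \<omega>) * v' (left_half \<omega>))"
    by (rule square_integrable_tensor; simp)+
  define F where "F \<omega> = u \<omega> * cnj (u' \<omega>)" for \<omega>
  define G where "G \<omega> = v \<omega> * cnj (v' \<omega>)" for \<omega>
  have int: "integrable bernoulli F" "integrable bernoulli G"
    unfolding F_def G_def by (rule square_integrable_mult; simp)+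
  have Fm: "F \<in> borel_measurable bernoulli" and Gm: "G \<in> borel_measurable bernoulli"
    using int by simp_all
  have "cinner (f \<otimes>\<^sub>L g) (f' \<otimes>\<^sub>L g') = (\<integral>\<omega>. F (right_half \<omega>) * G (left_half \<omega>) \<partial>bernoulli)"
    by (simp add: * tensor_abs cinner_abs F_def G_def mult_ac)
  also have "\<dots> = (\<integral>\<omega>. F (right_half \<omega>) \<partial>bernoulli) * (\<integral>\<omega>. G (left_half \<omega>) \<partial>bernoulli)"
    by (rule indep_var_lebesgue_integral[OF indep_var_halves[OF Fm Gm]])
      (simp_all add: preserves_integrable_iff[OF preserves_halves(1) Fm] preserves_integrable_iff[OF preserves_halves(2) Gm] int)
  also have "\<dots> = integral\<^sup>L bernoulli F * integral\<^sup>L bernoulli G"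
    by (simp add: preserves_integral[OF preserves_halves(1) Fm] preserves_integral[OF preserves_halves(2) Gm])
  also have "\<dots> = cinner f f' * cinner g g'"
    by (simp add: * cinner_abs F_def[abs_def] G_def[abs_def])
  finally show ?thesis .
qed

section \<open>Density of the elementary tensors\<close>

lemma bounded_linear_koopman:
  assumes "preserves_bernoulli \<phi>"
  shows "bounded_linear (koopman \<phi>)"
  by (rule bounded_linear_intro[where K = 1])
    (simp_all add: koopman_add koopman_scaleC scaleR_L2_def norm_koopman[OF assms])

lemma bounded_linear_scaleC: "bounded_linear (scaleC c :: 'i L2 \<Rightarrow> 'i L2)"
  by (rule bounded_linear_intro[where K = "cmod c"])
    (simp_all add: L2.scale_right_distrib scaleR_L2_def norm_scaleC mult.commute)

text \<open>The conditions at positive indices define P, the remaining ones define Q. Cylinders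
  generate the sigma-algebra, so the indicators of a generating family become tensors.\<close>

lemma cylinder_eq_rectangle:
  assumes "finite J"
  shows "\<exists>P\<in>sets bernoulli. \<exists>Q\<in>sets bernoulli.
     {\<omega> :: int \<Rightarrow> bool. \<forall>j\<in>J. \<omega> j \<in> E j} = {\<omega>. right_half \<omega> \<in> P \<and> left_half \<omega> \<in> Q}"
proof -
  define P where "P = {x :: nat \<Rightarrow> bool. \<forall>j\<in>J \<inter> {1..}. x (nat (j - 1)) \<in> E j}"
  define Q where "Q = {x :: nat \<Rightarrow> bool. \<forall>j\<in>J \<inter> {..0}. x (nat (- j)) \<in> E j}"
  have coord: "{x :: nat \<Rightarrow> bool. x n \<in> A} \<in> sets bernoulli" for n A
    using measurable_sets[OF measurable_coordinate[of n], of A] by (simp add: vimage_def)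
  have cyl: "{x :: nat \<Rightarrow> bool. \<forall>j\<in>K. x (t j) \<in> E j} \<in> sets bernoulli"
    if "finite K" for K and t :: "int \<Rightarrow> nat"
  proof -
    have "(\<Inter>j\<in>K. {x :: nat \<Rightarrow> bool. x (t j) \<in> E j}) \<in> sets bernoulli \<or> K = {}"
      using that coord by (cases "K = {}") (auto intro: sets.finite_INT)
    moreover have "{x :: nat \<Rightarrow> bool. \<forall>j\<in>K. x (t j) \<in> E j} = (if K = {} then UNIV else \<Inter>j\<in>K. {x. x (t j) \<in> E j})"
      by auto
    ultimately show ?thesis using sets.top[of bernoulli] by auto
  qed
  have PQ: "P \<in> sets bernoulli" "Q \<in> sets bernoulli"
    unfolding P_def Q_def by (rule cyl; use assms in simp)+
  have "(\<forall>j\<in>J. \<omega> j \<in> E j) \<longleftrightarrow> right_half \<omega> \<in> P \<and> left_half \<omega> \<in> Q" for \<omega> :: "int \<Rightarrow> bool"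
  proof -
    have "right_half \<omega> \<in> P \<longleftrightarrow> (\<forall>j\<in>J \<inter> {1..}. \<omega> j \<in> E j)"
      unfolding P_def mem_Collect_eq by (rule ball_cong) (simp_all add: right_half_def)
    moreover have "left_half \<omega> \<in> Q \<longleftrightarrow> (\<forall>j\<in>J \<inter> {..0}. \<omega> j \<in> E j)"
      unfolding Q_def mem_Collect_eq by (rule ball_cong) (simp_all add: left_half_def)
    moreover have "j \<in> {1..} \<or> j \<in> {..0}" for j :: int by auto
    ultimately show ?thesis by blast
  qed
  then have "{\<omega> :: int \<Rightarrow> bool. \<forall>j\<in>J. \<omega> j \<in> E j} = {\<omega>. right_half \<omega> \<in> P \<and> left_half \<omega> \<in> Q}" by blast
  with PQ show ?thesis by blast
qed

lemma indicator_union_tendsto: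
  fixes A :: "nat \<Rightarrow> ('i \<Rightarrow> bool) set"
  assumes A: "range A \<subseteq> sets bernoulli"
  shows "(\<lambda>n. abs_L2 (\<lambda>\<omega>. of_bool (\<omega> \<in> (\<Union>i<n. A i)))) \<longlonglongrightarrow> abs_L2 (\<lambda>\<omega>. of_bool (\<omega> \<in> (\<Union>i. A i)))"
proof (rule abs_L2_tendsto_dominated)
  interpret prob_space "bernoulli :: ('i \<Rightarrow> bool) measure" by (rule prob_space_bernoulli)
  show "square_integrable (\<lambda>\<omega>. of_bool (\<omega> \<in> (\<Union>i<n. A i)))" for n
    by (rule square_integrable_indicator) (use A in auto)
  show "square_integrable (\<lambda>\<omega>. of_bool (\<omega> \<in> (\<Union>i. A i)))"
    by (rule square_integrable_indicator) (use A in auto)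
  show "integrable (bernoulli :: ('i \<Rightarrow> bool) measure) (\<lambda>_. 1)" by simp
  fix \<omega>
  show "(\<lambda>n. of_bool (\<omega> \<in> (\<Union>i<n. A i))) \<longlonglongrightarrow> (of_bool (\<omega> \<in> (\<Union>i. A i)) :: complex)"
  proof (cases "\<omega> \<in> (\<Union>i. A i)")
    case True
    then obtain i where "\<omega> \<in> A i" by blast
    have "\<forall>\<^sub>F n in sequentially. of_bool (\<omega> \<in> (\<Union>i<n. A i)) = (of_bool (\<omega> \<in> (\<Union>i. A i)) :: complex)"
      by (rule eventually_mono[OF eventually_gt_at_top[of i]]) (use \<open>\<omega> \<in> A i\<close> in auto)
    then show ?thesis by (rule tendsto_eventually)
  qed (simp add: tendsto_eventually)
  show "(cmod (of_bool (\<omega> \<in> (\<Union>i<n. A i)) - of_bool (\<omega> \<in> (\<Union>i. A i))))\<^sup>2 \<le> 1" for n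
    by (auto simp: of_bool_def)
qed

text \<open>A Dynkin class argument: cylinders form an intersection-stable generator, and the sets
  whose indicator lies in G are closed under complements by linearity and under disjoint countable
  unions by closedness.\<close>

lemma closed_subspace_tensors_eq_UNIV:
  assumes add: "\<And>f g. f \<in> G \<Longrightarrow> g \<in> G \<Longrightarrow> f + g \<in> G"
    and scale: "\<And>c f. f \<in> G \<Longrightarrow> scaleC c f \<in> G"
    and cl: "closed G"
    and tensor: "\<And>f g. f \<otimes>\<^sub>L g \<in> G"
  shows "G = UNIV"
proof (rule closed_subspace_eq_UNIV)
  let ?C = "\<lambda>_ :: int. measure_pmf (bernoulli_pmf (1/2))"
  define ind where "ind A = abs_L2 (\<lambda>\<omega> :: int \<Rightarrow> bool. of_bool (\<omega> \<in> A))" for A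
  have rect: "ind {\<omega>. right_half \<omega> \<in> P \<and> left_half \<omega> \<in> Q} \<in> G"
    if "P \<in> sets bernoulli" "Q \<in> sets bernoulli" for P Q
  proof -
    have "ind {\<omega>. right_half \<omega> \<in> P \<and> left_half \<omega> \<in> Q}
        = abs_L2 (\<lambda>\<omega>. of_bool (\<omega> \<in> P)) \<otimes>\<^sub>L abs_L2 (\<lambda>\<omega>. of_bool (\<omega> \<in> Q))"
      unfolding ind_def using that by (simp add: tensor_abs square_integrable_indicator of_bool_conj)
    then show ?thesis using tensor by simp
  qed
  have one: "ind UNIV \<in> G" using rect[of UNIV UNIV] sets.top[of bernoulli] by simp
  have sets_eq: "sets (bernoulli :: (int \<Rightarrow> bool) measure)
      = sigma_sets (\<Pi>\<^sub>E i\<in>UNIV. space (?C i)) (prod_algebra UNIV ?C)"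
    by (simp add: bernoulli_def sets_PiM)
  have "ind A \<in> G" if "A \<in> sets bernoulli" for A
    using that unfolding sets_eq
  proof (induction rule: sigma_sets_induct_disjoint[OF Int_stable_prod_algebra prod_algebra_sets_into_space,
        consumes 1, case_names basic empty compl union])
    case (basic A)
    from prod_algebraE[OF basic]
    obtain J E where J: "A = prod_emb UNIV ?C J (Pi\<^sub>E J E)" "finite J" by metis
    have "A = {\<omega>. \<forall>j\<in>J. \<omega> j \<in> E j}"
      unfolding J(1) prod_emb_def by (auto simp: PiE_def Pi_iff)
    moreover obtain P Q where "P \<in> sets bernoulli" "Q \<in> sets bernoulli"
      "{\<omega>. \<forall>j\<in>J. \<omega> j \<in> E j} = {\<omega>. right_half \<omega> \<in> P \<and> left_half \<omega> \<in> Q}"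
      using cylinder_eq_rectangle[OF J(2), of E] by blast
    ultimately show ?case using rect[of P Q] by (simp only:)
  next
    case empty
    then show ?case using scale[OF one, of 0] by (simp add: ind_def zero_L2_def)
  next
    case (compl A)
    then have A: "A \<in> sets bernoulli" by (simp add: sets_eq)
    have sA: "square_integrable (\<lambda>\<omega>. of_bool (\<omega> \<in> A))"
      and s1: "square_integrable (\<lambda>\<omega> :: int \<Rightarrow> bool. of_bool (\<omega> \<in> UNIV))"
      by (rule square_integrable_indicator; use A sets.top[of bernoulli] in simp)+
    have "(\<lambda>\<omega>. of_bool (\<omega> \<in> (\<Pi>\<^sub>E i\<in>UNIV. space (?C i)) - A))
        = (\<lambda>\<omega>. of_bool (\<omega> \<in> UNIV) + - 1 * (of_bool (\<omega> \<in> A) :: complex))"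
      by (auto simp: fun_eq_iff)
    then have "ind ((\<Pi>\<^sub>E i\<in>UNIV. space (?C i)) - A) = ind UNIV + scaleC (- 1) (ind A)"
      unfolding ind_def abs_L2_scaleC[OF sA] abs_L2_add[OF s1 square_integrable_cmult[OF sA]] by (simp only:)
    then show ?case using add[OF one scale[OF compl(2), of "- 1"]] by (simp only:)
  next
    case (union A)
    then have A: "range A \<subseteq> sets bernoulli" by (auto simp: sets_eq)
    have "ind (\<Union>i<n. A i) \<in> G" for n
    proof (induction n)
      case 0
      then show ?case using scale[OF one, of 0] by (simp add: ind_def zero_L2_def)
    next
      case (Suc n)
      have "A n \<inter> A i = {}" if "i < n" for i
        by (rule disjoint_family_onD[OF union(1)]) (use that in auto)
      then have disj: "\<omega> \<in> A n \<Longrightarrow> \<omega> \<notin> (\<Union>i<n. A i)" for \<omega> by blast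
      have "(\<lambda>\<omega>. of_bool (\<omega> \<in> (\<Union>i<Suc n. A i)))
          = (\<lambda>\<omega>. of_bool (\<omega> \<in> (\<Union>i<n. A i)) + (of_bool (\<omega> \<in> A n) :: complex))"
      proof
        fix \<omega>
        have "\<omega> \<in> (\<Union>i<Suc n. A i) \<longleftrightarrow> \<omega> \<in> (\<Union>i<n. A i) \<or> \<omega> \<in> A n" by (simp add: lessThan_Suc disj_commute)
        then show "of_bool (\<omega> \<in> (\<Union>i<Suc n. A i))
            = of_bool (\<omega> \<in> (\<Union>i<n. A i)) + (of_bool (\<omega> \<in> A n) :: complex)"
          using disj[of \<omega>] by (cases "\<omega> \<in> A n"; cases "\<omega> \<in> (\<Union>i<n. A i)") (simp_all only: of_bool_eq, simp_all)
      qed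
      moreover have "square_integrable (\<lambda>\<omega>. of_bool (\<omega> \<in> (\<Union>i<n. A i)))"
        "square_integrable (\<lambda>\<omega>. of_bool (\<omega> \<in> A n))"
        by (rule square_integrable_indicator; use A in auto)+
      ultimately have "ind (\<Union>i<Suc n. A i) = ind (\<Union>i<n. A i) + ind (A n)"
        unfolding ind_def by (simp only: abs_L2_add)
      then show ?case using add[OF Suc union(3)] by simp
    qed
    from closed_sequentially[OF cl this indicator_union_tendsto[OF A, folded ind_def]]
    show ?case .
  qed
  then show "abs_L2 (\<lambda>\<omega> :: int \<Rightarrow> bool. of_bool (\<omega> \<in> A)) \<in> G" if "A \<in> sets bernoulli" for A
    using that by (simp add: ind_def)
qed (fact add scale cl)+

text \<open>Two candidates agree on a closed subspace containing the tensors; density leaves exactly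
  one object for the definite description.\<close>

lemma tensor_op_eqI:
  assumes T: "bounded_linear T" "\<And>c x. T (scaleC c x) = scaleC c (T x)"
    and tensor: "\<And>f g. T (f \<otimes>\<^sub>L g) = A f \<otimes>\<^sub>L B g"
  shows "tensor_op A B = T"
  unfolding tensor_op_def
proof (rule the_equality)
  show "bounded_linear T \<and> (\<forall>c x. T (scaleC c x) = scaleC c (T x)) \<and> (\<forall>f g. T (f \<otimes>\<^sub>L g) = A f \<otimes>\<^sub>L B g)"
    using assms by blast
  fix S assume S: "bounded_linear S \<and> (\<forall>c x. S (scaleC c x) = scaleC c (S x)) \<and> (\<forall>f g. S (f \<otimes>\<^sub>L g) = A f \<otimes>\<^sub>L B g)"
  have "{x. S x = T x} = UNIV"
  proof (rule closed_subspace_tensors_eq_UNIV)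
    show "closed {x. S x = T x}"
      using S T(1) by (intro closed_Collect_eq linear_continuous_on) auto
  qed (use S T tensor in \<open>auto simp: linear_add[OF bounded_linear.linear]\<close>)
  then show "S = T" by auto
qed

section \<open>The two-sided operators as combinations of Koopman operators\<close>

definition shift_map :: "(int \<Rightarrow> bool) \<Rightarrow> int \<Rightarrow> bool" where
  "shift_map \<omega> j = \<omega> (j - 1)"

text \<open>The flipped symbol is the one crossing from index 0 to index 1. The two shift maps
  together realize both symbols that can be prefixed to the right half.\<close>

definition twisted_shift_map :: "(int \<Rightarrow> bool) \<Rightarrow> int \<Rightarrow> bool" where
  "twisted_shift_map \<omega> j = (\<omega> (j - 1) \<noteq> (j = 1))"

definition unshift_map :: "(int \<Rightarrow> bool) \<Rightarrow> int \<Rightarrow> bool" where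
  "unshift_map \<omega> j = \<omega> (j + 1)"

definition twisted_unshift_map :: "(int \<Rightarrow> bool) \<Rightarrow> int \<Rightarrow> bool" where
  "twisted_unshift_map \<omega> j = (\<omega> (j + 1) \<noteq> (j = 0))"

lemma preserves_maps:
  "preserves_bernoulli shift_map" "preserves_bernoulli twisted_shift_map"
  "preserves_bernoulli unshift_map" "preserves_bernoulli twisted_unshift_map"
  using preserves_reindex[of "\<lambda>j :: int. j - 1"] preserves_flip_reindex[of "\<lambda>j :: int. j - 1" "\<lambda>j. j = 1"]
    preserves_reindex[of "\<lambda>j :: int. j + 1"] preserves_flip_reindex[of "\<lambda>j :: int. j + 1" "\<lambda>j. j = 0"]
  by (simp_all add: shift_map_def[abs_def] twisted_shift_map_def[abs_def] unshift_map_def[abs_def]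
      twisted_unshift_map_def[abs_def] inj_def)

lemma maps_inverse:
  "(\<lambda>\<omega>. shift_map (unshift_map \<omega>)) = (\<lambda>\<omega>. \<omega>)" "(\<lambda>\<omega>. unshift_map (shift_map \<omega>)) = (\<lambda>\<omega>. \<omega>)"
  "(\<lambda>\<omega>. twisted_shift_map (twisted_unshift_map \<omega>)) = (\<lambda>\<omega>. \<omega>)"
  by (auto simp: fun_eq_iff shift_map_def unshift_map_def twisted_shift_map_def twisted_unshift_map_def)

lemma halves_maps:
  "right_half (shift_map \<omega>) = case_nat (\<omega> 0) (right_half \<omega>)"
  "left_half (shift_map \<omega>) = (\<lambda>n. left_half \<omega> (Suc n))"
  "right_half (twisted_shift_map \<omega>) = case_nat (\<not> \<omega> 0) (right_half \<omega>)"
  "left_half (twisted_shift_map \<omega>) = (\<lambda>n. left_half \<omega> (Suc n))"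
  "right_half (unshift_map \<omega>) = (\<lambda>n. right_half \<omega> (Suc n))"
  "left_half (unshift_map \<omega>) = case_nat (\<omega> 1) (left_half \<omega>)"
  "right_half (twisted_unshift_map \<omega>) = (\<lambda>n. right_half \<omega> (Suc n))"
  "left_half (twisted_unshift_map \<omega>) = case_nat (\<not> \<omega> 1) (left_half \<omega>)"
  by (auto simp: fun_eq_iff shift_map_def unshift_map_def twisted_shift_map_def twisted_unshift_map_def
      right_half_def left_half_def algebra_simps minus_diff_commute split: nat.split)

lemma half_zero: "right_half \<omega> 0 = \<omega> 1" "left_half \<omega> 0 = \<omega> 0"
  by (simp_all add: right_half_def left_half_def)

lemma koopman_tensor:
  assumes "preserves_bernoulli \<phi>" "square_integrable u" "square_integrable v"
  shows "koopman \<phi> (abs_L2 u \<otimes>\<^sub>L abs_L2 v) = abs_L2 (\<lambda>\<omega>. u (right_half (\<phi> \<omega>)) * v (left_half (\<phi> \<omega>)))"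
  using assms square_integrable_tensor[OF assms(2,3)] by (simp add: tensor_abs koopman_abs)

text \<open>In an average over the symbol prefixed to the right half, that symbol either equals the
  one dropped from the left half, as for \<open>shift_map\<close>, or differs from it, as for
  \<open>twisted_shift_map\<close>.\<close>

lemma tensor_op_even:
  "tensor_op avg_op U_Lplus = (\<lambda>F. scaleC (1/2) (koopman shift_map F + koopman twisted_shift_map F))"
proof (rule tensor_op_eqI)
  show "bounded_linear (\<lambda>F. scaleC (1/2) (koopman shift_map F + koopman twisted_shift_map F))"
    by (intro bounded_linear_compose[OF bounded_linear_scaleC] bounded_linear_add bounded_linear_koopman preserves_maps)
  fix f g :: "nat L2"
  obtain u v where *: "f = abs_L2 u" "g = abs_L2 v" and u: "square_integrable u" and v: "square_integrable v"
    by (metis abs_L2_cases)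
  have sq: "square_integrable (\<lambda>\<omega>. u (right_half (\<phi> \<omega>)) * v (left_half (\<phi> \<omega>)))"
    if "preserves_bernoulli \<phi>" for \<phi> :: "(int \<Rightarrow> bool) \<Rightarrow> (int \<Rightarrow> bool)"
    by (rule preserves_square_integrable[OF that square_integrable_tensor[OF u v]])
  have "scaleC (1/2) (koopman shift_map (f \<otimes>\<^sub>L g) + koopman twisted_shift_map (f \<otimes>\<^sub>L g))
      = abs_L2 (\<lambda>\<omega>. 1/2 * (u (right_half (shift_map \<omega>)) * v (left_half (shift_map \<omega>))
         + u (right_half (twisted_shift_map \<omega>)) * v (left_half (twisted_shift_map \<omega>))))"
    unfolding * koopman_tensor[OF preserves_maps(1) u v] koopman_tensor[OF preserves_maps(2) u v]
      abs_L2_add[OF sq[OF preserves_maps(1)] sq[OF preserves_maps(2)]]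
    by (rule abs_L2_scaleC[OF square_integrable_add[OF sq[OF preserves_maps(1)] sq[OF preserves_maps(2)]]])
  also have "\<dots> = avg_op f \<otimes>\<^sub>L U_Lplus g"
    unfolding * avg_op_abs[OF u] U_Lplus_abs[OF v]
      tensor_abs[OF square_integrable_avg[OF u] preserves_square_integrable[OF preserves_shift v]]
    by (intro arg_cong[of _ _ abs_L2] ext, case_tac "\<omega> 0") (simp_all add: halves_maps field_simps)
  finally show "scaleC (1/2) (koopman shift_map (f \<otimes>\<^sub>L g) + koopman twisted_shift_map (f \<otimes>\<^sub>L g))
      = avg_op f \<otimes>\<^sub>L U_Lplus g" .
qed (simp add: koopman_scaleC L2.scale_right_distrib L2.scale_right_diff_distrib ac_simps)

text \<open>The two signs multiply to 1 if the prefixed symbol equals the dropped one, and to -1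
  otherwise.\<close>

lemma tensor_op_odd:
  "tensor_op (avg_op \<circ> sign_op) (sign_op \<circ> U_Lplus)
     = (\<lambda>F. scaleC (1/2) (koopman shift_map F + scaleC (-1) (koopman twisted_shift_map F)))"
proof (rule tensor_op_eqI)
  show "bounded_linear (\<lambda>F. scaleC (1/2) (koopman shift_map F + scaleC (-1) (koopman twisted_shift_map F)))"
    by (intro bounded_linear_compose[OF bounded_linear_scaleC] bounded_linear_add bounded_linear_koopman preserves_maps)
  fix f g :: "nat L2"
  obtain u v where *: "f = abs_L2 u" "g = abs_L2 v" and u: "square_integrable u" and v: "square_integrable v"
    by (metis abs_L2_cases)
  have sq: "square_integrable (\<lambda>\<omega>. u (right_half (\<phi> \<omega>)) * v (left_half (\<phi> \<omega>)))"
    if "preserves_bernoulli \<phi>" for \<phi> :: "(int \<Rightarrow> bool) \<Rightarrow> (int \<Rightarrow> bool)"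
    by (rule preserves_square_integrable[OF that square_integrable_tensor[OF u v]])
  have sq1: "square_integrable (\<lambda>\<omega>. -1 * (u (right_half (twisted_shift_map \<omega>)) * v (left_half (twisted_shift_map \<omega>))))"
    by (rule square_integrable_cmult[OF sq[OF preserves_maps(2)]])
  have "scaleC (1/2) (koopman shift_map (f \<otimes>\<^sub>L g) + scaleC (-1) (koopman twisted_shift_map (f \<otimes>\<^sub>L g)))
      = abs_L2 (\<lambda>\<omega>. 1/2 * (u (right_half (shift_map \<omega>)) * v (left_half (shift_map \<omega>))
         + -1 * (u (right_half (twisted_shift_map \<omega>)) * v (left_half (twisted_shift_map \<omega>)))))"
    unfolding * koopman_tensor[OF preserves_maps(1) u v] koopman_tensor[OF preserves_maps(2) u v]
      abs_L2_scaleC[OF sq[OF preserves_maps(2)]] abs_L2_add[OF sq[OF preserves_maps(1)] sq1]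
    by (rule abs_L2_scaleC[OF square_integrable_add[OF sq[OF preserves_maps(1)] sq1]])
  also have "\<dots> = (avg_op \<circ> sign_op) f \<otimes>\<^sub>L (sign_op \<circ> U_Lplus) g"
    unfolding * comp_apply sign_op_abs[OF u] avg_op_abs[OF square_integrable_sign[OF u]] U_Lplus_abs[OF v]
      sign_op_abs[OF preserves_square_integrable[OF preserves_shift v]]
      tensor_abs[OF square_integrable_avg[OF square_integrable_sign[OF u]]
        square_integrable_sign[OF preserves_square_integrable[OF preserves_shift v]]]
    by (intro arg_cong[of _ _ abs_L2] ext, case_tac "\<omega> 0") (simp_all add: halves_maps half_zero field_simps)
  finally show "scaleC (1/2) (koopman shift_map (f \<otimes>\<^sub>L g) + scaleC (-1) (koopman twisted_shift_map (f \<otimes>\<^sub>L g)))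
      = (avg_op \<circ> sign_op) f \<otimes>\<^sub>L (sign_op \<circ> U_Lplus) g" .
qed (simp add: koopman_scaleC L2.scale_right_distrib L2.scale_right_diff_distrib ac_simps)

text \<open>For 0 \<le> \<epsilon> \<le> 1 the weights are nonnegative with sum 1, which is the
  origin of the contraction bound; at \<epsilon> = 1 the twisted term disappears and the two-sided
  shift remains.\<close>

lemma V_eps_eq:
  "V_eps \<epsilon> F = scaleC ((1 + \<epsilon>) / 2) (koopman shift_map F) + scaleC ((1 - \<epsilon>) / 2) (koopman twisted_shift_map F)"
proof -
  have "V_eps \<epsilon> F = scaleC (1/2) (koopman shift_map F) + scaleC (\<epsilon> * (1/2)) (koopman shift_map F)
     + (scaleC (1/2) (koopman twisted_shift_map F) + scaleC (- \<epsilon> * (1/2)) (koopman twisted_shift_map F))"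
    unfolding V_eps_def Q0_def Q1_def V_Lplus_eq U_Rminus_eq_U_Lplus tensor_op_even tensor_op_odd
    by (simp add: L2.scale_right_distrib L2.scale_right_diff_distrib ac_simps)
  also have "\<dots> = scaleC ((1 + \<epsilon>) / 2) (koopman shift_map F) + scaleC ((1 - \<epsilon>) / 2) (koopman twisted_shift_map F)"
    unfolding L2.scale_left_distrib[symmetric] by (simp add: field_simps)
  finally show ?thesis .
qed

lemma U_L_eq: "U_L = koopman unshift_map"
proof
  fix f :: "int L2"
  show "U_L f = koopman unshift_map f"
    by (cases f rule: abs_L2_cases)
      (simp add: U_L.abs_eq koopman_abs[OF preserves_maps(3), unfolded unshift_map_def[abs_def]] L2_rel_def
        unshift_map_def[abs_def])
qed

lemma V_L_eq_V_eps_1: "V_L = V_eps 1"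
proof -
  have "V_L = koopman shift_map"
    unfolding V_L_def U_L_eq
    by (rule hilbert_adjoint_eqI) (rule cinner_koopman_inverse[OF preserves_maps(3,1) maps_inverse(2)])
  then show ?thesis by (simp add: V_eps_eq[abs_def])
qed

definition V_eps_adj :: "real \<Rightarrow> int L2 \<Rightarrow> int L2" where
  "V_eps_adj \<epsilon> F = scaleC ((1 + \<epsilon>) / 2) (koopman unshift_map F)
     + scaleC ((1 - \<epsilon>) / 2) (koopman twisted_unshift_map F)"

lemma cinner_V_eps: "cinner (V_eps \<epsilon> f) g = cinner f (V_eps_adj \<epsilon> g)"
  unfolding V_eps_eq V_eps_adj_def
  by (simp add: cinner_add_left cinner_add_right cinner_scaleC_left cinner_scaleC_right
      cinner_koopman_inverse[OF preserves_maps(1,3) maps_inverse(1)]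
      cinner_koopman_inverse[OF preserves_maps(2,4) maps_inverse(3)])

lemma hilbert_adjoint_V_eps: "hilbert_adjoint (V_eps \<epsilon>) = V_eps_adj \<epsilon>"
  by (rule hilbert_adjoint_eqI) (rule cinner_V_eps)

text \<open>The left factor is only averaged, possibly after a sign. Both operations send
  polynomials to polynomials, which is why the adjoint maps X_+ into itself.\<close>

lemma V_eps_adj_tensor:
  "V_eps_adj \<epsilon> (f \<otimes>\<^sub>L g) = U_Lplus f \<otimes>\<^sub>L avg_op g
     + scaleC \<epsilon> (sign_op (U_Lplus f) \<otimes>\<^sub>L avg_op (sign_op g))"
proof -
  obtain u v where *: "f = abs_L2 u" "g = abs_L2 v" and u: "square_integrable u" and v: "square_integrable v"
    by (metis abs_L2_cases)
  have sq: "square_integrable (\<lambda>\<omega>. u (right_half (\<phi> \<omega>)) * v (left_half (\<phi> \<omega>)))"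
    if "preserves_bernoulli \<phi>" for \<phi> :: "(int \<Rightarrow> bool) \<Rightarrow> (int \<Rightarrow> bool)"
    by (rule preserves_square_integrable[OF that square_integrable_tensor[OF u v]])
  note Uu = preserves_square_integrable[OF preserves_shift u]
  have sq1: "square_integrable (\<lambda>\<omega>. u (\<lambda>n. right_half \<omega> (Suc n)) * ((v (case_nat False (left_half \<omega>)) + v (case_nat True (left_half \<omega>))) / 2))"
    by (rule square_integrable_tensor[OF Uu square_integrable_avg[OF v]])
  note sq2 = square_integrable_tensor[OF square_integrable_sign[OF Uu] square_integrable_avg[OF square_integrable_sign[OF v]]]
  show ?thesis
    unfolding * V_eps_adj_def koopman_tensor[OF preserves_maps(3) u v] koopman_tensor[OF preserves_maps(4) u v]
      abs_L2_scaleC[OF sq[OF preserves_maps(3)]] abs_L2_scaleC[OF sq[OF preserves_maps(4)]]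
      abs_L2_add[OF square_integrable_cmult[OF sq[OF preserves_maps(3)]] square_integrable_cmult[OF sq[OF preserves_maps(4)]]]
      U_Lplus_abs[OF u] avg_op_abs[OF v] sign_op_abs[OF Uu] sign_op_abs[OF v] avg_op_abs[OF square_integrable_sign[OF v]]
      tensor_abs[OF Uu square_integrable_avg[OF v]]
      tensor_abs[OF square_integrable_sign[OF Uu] square_integrable_avg[OF square_integrable_sign[OF v]]]
      abs_L2_scaleC[OF sq2] abs_L2_add[OF sq1 square_integrable_cmult[OF sq2]]
    by (intro arg_cong[of _ _ abs_L2] ext, case_tac "\<omega> 1") (simp_all add: halves_maps half_zero field_simps)
qed

section \<open>Contraction bound and Hilbert space resolvent\<close>

lemma V_eps_add: "V_eps \<epsilon> (f + g) = V_eps \<epsilon> f + V_eps \<epsilon> g"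
  by (simp add: V_eps_eq koopman_add L2.scale_right_distrib ac_simps)

lemma V_eps_adj_add: "V_eps_adj \<epsilon> (f + g) = V_eps_adj \<epsilon> f + V_eps_adj \<epsilon> g"
  by (simp add: V_eps_adj_def koopman_add L2.scale_right_distrib ac_simps)

lemma V_eps_adj_scaleC: "V_eps_adj \<epsilon> (scaleC c f) = scaleC c (V_eps_adj \<epsilon> f)"
  by (simp add: V_eps_adj_def koopman_scaleC L2.scale_right_distrib ac_simps)

lemma norm_koopman_convex:
  assumes "0 \<le> \<epsilon>" "\<epsilon> \<le> 1" "preserves_bernoulli \<phi>" "preserves_bernoulli \<psi>"
  shows "norm (scaleC ((1 + complex_of_real \<epsilon>) / 2) (koopman \<phi> f)
    + scaleC ((1 - complex_of_real \<epsilon>) / 2) (koopman \<psi> f)) \<le> norm f"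
proof -
  have c: "(1 + complex_of_real \<epsilon>) / 2 = complex_of_real ((1 + \<epsilon>) / 2)"
    "(1 - complex_of_real \<epsilon>) / 2 = complex_of_real ((1 - \<epsilon>) / 2)" by simp_all
  have "norm (scaleC ((1 + complex_of_real \<epsilon>) / 2) (koopman \<phi> f)
      + scaleC ((1 - complex_of_real \<epsilon>) / 2) (koopman \<psi> f))
      \<le> cmod (complex_of_real ((1 + \<epsilon>) / 2)) * norm f + cmod (complex_of_real ((1 - \<epsilon>) / 2)) * norm f"
    by (rule order_trans[OF norm_triangle_ineq])
      (simp only: c norm_scaleC norm_koopman assms order_refl)
  also have "\<dots> = (1 + \<epsilon>) / 2 * norm f + (1 - \<epsilon>) / 2 * norm f"
    unfolding norm_of_real using assms(1,2) by simp
  also have "\<dots> = norm f" by (simp add: field_simps)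
  finally show ?thesis .
qed

lemma norm_V_eps:
  assumes "0 \<le> \<epsilon>" "\<epsilon> \<le> 1"
  shows "norm (V_eps \<epsilon> f) \<le> norm f"
  using norm_koopman_convex[OF assms preserves_maps(1,2), of f] by (simp add: V_eps_eq)

lemma norm_V_eps_adj:
  assumes "0 \<le> \<epsilon>" "\<epsilon> \<le> 1"
  shows "norm (V_eps_adj \<epsilon> f) \<le> norm f"
  using norm_koopman_convex[OF assms preserves_maps(3,4), of f] by (simp add: V_eps_adj_def)

text \<open>The equation z x - T x = y is the fixed point equation x = (y + T x) / z, whose right
  side contracts by the factor 1 / |z|.\<close>

lemma bij_shifted_V_eps:
  assumes "0 \<le> \<epsilon>" "\<epsilon> \<le> 1" "cmod z > 1"
  shows "bij (shifted (V_eps \<epsilon>) z)"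
proof -
  have z: "z \<noteq> 0" using assms(3) by auto
  have "\<exists>!x. shifted (V_eps \<epsilon>) z x = y" for y
  proof -
    have "\<exists>!x. scaleC (1 / z) (y + V_eps \<epsilon> x) = x"
    proof (rule banach_fix_type[where c = "1 / cmod z"])
      show "\<forall>x x'. dist (scaleC (1 / z) (y + V_eps \<epsilon> x)) (scaleC (1 / z) (y + V_eps \<epsilon> x')) \<le> 1 / cmod z * dist x x'"
      proof (intro allI)
        fix x x'
        have "V_eps \<epsilon> x - V_eps \<epsilon> x' = V_eps \<epsilon> (x - x')"
          using V_eps_add[of \<epsilon> "x - x'" x'] by simp
        then have "scaleC (1 / z) (y + V_eps \<epsilon> x) - scaleC (1 / z) (y + V_eps \<epsilon> x') = scaleC (1 / z) (V_eps \<epsilon> (x - x'))"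
          by (simp flip: L2.scale_right_diff_distrib)
        then show "dist (scaleC (1 / z) (y + V_eps \<epsilon> x)) (scaleC (1 / z) (y + V_eps \<epsilon> x')) \<le> 1 / cmod z * dist x x'"
          using norm_V_eps[OF assms(1,2), of "x - x'"]
          by (simp add: dist_norm norm_scaleC norm_divide divide_right_mono)
      qed
      show "1 / cmod z < 1" using assms(3) by (subst divide_less_eq_1_pos) auto
    qed simp
    moreover have "scaleC (1 / z) (y + V_eps \<epsilon> x) = x \<longleftrightarrow> shifted (V_eps \<epsilon>) z x = y" for x
    proof -
      have "scaleC (1 / z) (y + V_eps \<epsilon> x) = x \<longleftrightarrow> y + V_eps \<epsilon> x = scaleC z x"
        using z by (metis L2.scale_scale L2.scale_one nonzero_eq_divide_eq mult.commute)
      also have "\<dots> \<longleftrightarrow> shifted (V_eps \<epsilon>) z x = y"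
        by (auto simp: shifted_def algebra_simps)
      finally show ?thesis .
    qed
    ultimately show ?thesis by simp
  qed
  then show ?thesis by (simp add: bij_iff)
qed

section \<open>Polynomials\<close>

text \<open>An operator with an adjoint is linear; arguing this way avoids representatives.\<close>

lemma avg_op_add: "avg_op (f + g) = avg_op f + avg_op g"
  by (rule cinner_ext_right) (simp add: cinner_add_right flip: cinner_U_Lplus)

lemma avg_op_scaleC: "avg_op (scaleC c f) = scaleC c (avg_op f)"
  by (rule cinner_ext_right) (simp add: cinner_scaleC_right flip: cinner_U_Lplus)

lemma sign_op_add: "sign_op (f + g) = sign_op f + sign_op g"
  by (rule cinner_ext_right) (simp add: cinner_add_right flip: cinner_sign_op)

lemma sign_op_scaleC: "sign_op (scaleC c f) = scaleC c (sign_op f)"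
  by (rule cinner_ext_right) (simp add: cinner_scaleC_right flip: cinner_sign_op)

text \<open>Half the difference of the values after prefixing 0 and 1: a finite difference, hence an
  operator that lowers degrees.\<close>

definition odd_op :: "nat L2 \<Rightarrow> nat L2" where
  "odd_op f = avg_op (sign_op f)"

lemma odd_op_add: "odd_op (f + g) = odd_op f + odd_op g"
  by (simp add: odd_op_def avg_op_add sign_op_add)

lemma odd_op_scaleC: "odd_op (scaleC c f) = scaleC c (odd_op f)"
  by (simp add: odd_op_def avg_op_scaleC sign_op_scaleC)

text \<open>Degree strictly below n: for n = 0 the space is trivial, which is where the inductions
  start.\<close>

abbreviation low_degree :: "nat \<Rightarrow> nat L2 set" where
  "low_degree n \<equiv> L2.span (h_power ` {..<n})"

lemma poly_space_eq: "poly_space M = low_degree (Suc M)"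
  by (simp add: poly_space_def lessThan_Suc_atMost)

lemma low_degree_mono: "m \<le> n \<Longrightarrow> low_degree m \<subseteq> low_degree n"
  by (rule L2.span_mono) auto

lemma h_power_in_low_degree: "m < n \<Longrightarrow> h_power m \<in> low_degree n"
  by (rule L2.span_base) simp

lemma low_degree_Suc: "x \<in> low_degree (Suc n) \<longleftrightarrow> (\<exists>k. x - scaleC k (h_power n) \<in> low_degree n)"
  by (simp add: lessThan_Suc L2.span_breakdown_eq)

lemmas low_degree_intros = L2.span_add L2.span_scale L2.span_diff L2.span_neg L2.span_zero

lemma low_degree_scaleD:
  assumes "scaleC c x \<in> low_degree n" "c \<noteq> 0"
  shows "x \<in> low_degree n"
  using L2.span_scale[OF assms(1), of "1 / c"] assms(2) by simp

lemma sum_mult_of_bool_eq: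
  fixes f :: "'a \<Rightarrow> complex"
  shows "finite A \<Longrightarrow> (\<Sum>x\<in>A. f x * of_bool (x = l)) = (if l \<in> A then f l else 0)"
  by (simp add: of_bool_def if_distrib cong: if_cong)

lemma two_power_eq_iff: "(2 :: complex) ^ n = 2 ^ l \<longleftrightarrow> n = l"
proof -
  have "(2 :: complex) ^ n = 2 ^ l \<longleftrightarrow> (of_nat (2 ^ n) :: complex) = of_nat (2 ^ l)" by simp
  also have "\<dots> \<longleftrightarrow> n = l" unfolding of_nat_eq_iff by simp
  finally show ?thesis .
qed

lemma half_power_eq_iff: "1 / (2 :: complex) ^ n = 1 / 2 ^ l \<longleftrightarrow> n = l"
  by (simp add: two_power_eq_iff frac_eq_eq eq_commute)

text \<open>Prefixing a symbol corresponds to the inverse branches x / 2 and (1 + x) / 2 of the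
  doubling map; this is how the operators become explicit on polynomials.\<close>

lemma binary_value_case_nat: "binary_value (case_nat b \<omega>) = (of_bool b + binary_value \<omega>) / 2"
proof -
  let ?f = "\<lambda>\<omega> n. of_bool (\<omega> n) * (1/2::real) ^ Suc n"
  have s: "summable (?f \<omega>)" for \<omega>
  proof (rule summable_comparison_test')
    show "summable (\<lambda>n. (1/2::real) ^ Suc n)" using power_half_series by (rule sums_summable)
  qed simp
  have "binary_value (case_nat b \<omega>) = ?f (case_nat b \<omega>) 0 + (\<Sum>n. ?f (case_nat b \<omega>) (Suc n))"
    unfolding binary_value_def by (subst suminf_split_head[OF s]) simp
  also have "(\<Sum>n. ?f (case_nat b \<omega>) (Suc n)) = (\<Sum>n. 1/2 * ?f \<omega> n)"
    by (rule suminf_cong) simp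
  also have "\<dots> = 1/2 * binary_value \<omega>"
    unfolding binary_value_def by (rule suminf_mult[OF s])
  finally show ?thesis by (simp add: field_simps)
qed

lemma square_integrable_binary_power: "square_integrable (\<lambda>\<omega>. complex_of_real (binary_value \<omega>) ^ i)"
proof (rule square_integrable_bounded)
  show "(\<lambda>\<omega>. complex_of_real (binary_value \<omega>) ^ i) \<in> borel_measurable bernoulli"
    using measurable_binary_value by measurable
  show "cmod (complex_of_real (binary_value \<omega>) ^ i) \<le> 1" for \<omega>
    using abs_binary_value_le[of \<omega>] by (simp add: norm_power power_le_one)
qed

lemma h_power_abs: "h_power i = abs_L2 (\<lambda>\<omega>. complex_of_real (binary_value \<omega>) ^ i)"
  by (simp add: h_power_def)

lemma sum_h_power_abs:
  "square_integrable (\<lambda>\<omega>. \<Sum>i<n. c i * complex_of_real (binary_value \<omega>) ^ i) \<and>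
   (\<Sum>i<n. scaleC (c i) (h_power i)) = abs_L2 (\<lambda>\<omega>. \<Sum>i<n. c i * complex_of_real (binary_value \<omega>) ^ i)"
proof (induction n)
  case 0
  then show ?case by (simp add: zero_L2_def)
next
  case (Suc n)
  have "square_integrable (\<lambda>\<omega>. c n * complex_of_real (binary_value \<omega>) ^ n)"
    by (rule square_integrable_cmult[OF square_integrable_binary_power])
  with Suc show ?case
    by (simp add: abs_L2_add square_integrable_add h_power_def abs_L2_scaleC square_integrable_binary_power)
qed

text \<open>Both branches have top coefficient 2^-n: it survives in the mean and cancels in the
  difference, so the second sum has no term of degree n.\<close>

lemma binomial_average:
  fixes x :: complex
  shows "((x / 2) ^ n + ((1 + x) / 2) ^ n) / 2
      = 1 / 2 ^ n * x ^ n + (\<Sum>l<n. of_nat (n choose l) / 2 ^ Suc n * x ^ l)" (is ?even)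
    and "((x / 2) ^ n - ((1 + x) / 2) ^ n) / 2 = (\<Sum>l<n. - of_nat (n choose l) / 2 ^ Suc n * x ^ l)" (is ?odd)
proof -
  define S where "S = (\<Sum>l<n. of_nat (n choose l) * x ^ l)"
  have "(1 + x) ^ n = (x + 1) ^ n" by (simp add: add.commute)
  also have "\<dots> = x ^ n + S"
    unfolding binomial_ring S_def by (simp flip: lessThan_Suc_atMost)
  finally have b: "(1 + x) ^ n = x ^ n + S" .
  have 1: "(\<Sum>l<n. of_nat (n choose l) / 2 ^ Suc n * x ^ l) = S / 2 ^ Suc n"
    unfolding S_def sum_divide_distrib by (rule sum.cong) simp_all
  have 2: "(\<Sum>l<n. - of_nat (n choose l) / 2 ^ Suc n * x ^ l) = - S / 2 ^ Suc n"
    unfolding S_def sum_negf[symmetric] sum_divide_distrib by (rule sum.cong) simp_all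
  show ?even unfolding 1 power_divide b by (simp add: field_simps)
  show ?odd unfolding 2 power_divide b by (simp add: field_simps)
qed

lemma avg_op_h_power:
  "avg_op (h_power n) = scaleC (1 / 2 ^ n) (h_power n)
     + (\<Sum>l<n. scaleC (of_nat (n choose l) / 2 ^ Suc n) (h_power l))"
proof -
  note sm = sum_h_power_abs[where n = n and c = "\<lambda>l. of_nat (n choose l) / 2 ^ Suc n"]
  have "avg_op (h_power n) = abs_L2 (\<lambda>\<omega>. 1 / 2 ^ n * complex_of_real (binary_value \<omega>) ^ n
      + (\<Sum>l<n. of_nat (n choose l) / 2 ^ Suc n * complex_of_real (binary_value \<omega>) ^ l))"
    unfolding h_power_abs avg_op_abs[OF square_integrable_binary_power]
  proof (rule arg_cong[of _ _ abs_L2], rule ext)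
    fix \<omega>
    have "(complex_of_real (binary_value (case_nat False \<omega>)) ^ n + complex_of_real (binary_value (case_nat True \<omega>)) ^ n) / 2
        = ((complex_of_real (binary_value \<omega>) / 2) ^ n + ((1 + complex_of_real (binary_value \<omega>)) / 2) ^ n) / 2"
      by (simp add: binary_value_case_nat)
    also have "\<dots> = 1 / 2 ^ n * complex_of_real (binary_value \<omega>) ^ n
      + (\<Sum>l<n. of_nat (n choose l) / 2 ^ Suc n * complex_of_real (binary_value \<omega>) ^ l)"
      by (rule binomial_average)
    finally show "(complex_of_real (binary_value (case_nat False \<omega>)) ^ n + complex_of_real (binary_value (case_nat True \<omega>)) ^ n) / 2
      = 1 / 2 ^ n * complex_of_real (binary_value \<omega>) ^ n
      + (\<Sum>l<n. of_nat (n choose l) / 2 ^ Suc n * complex_of_real (binary_value \<omega>) ^ l)" .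
  qed
  also have "\<dots> = scaleC (1 / 2 ^ n) (h_power n)
     + (\<Sum>l<n. scaleC (of_nat (n choose l) / 2 ^ Suc n) (h_power l))"
    using sm square_integrable_cmult[OF square_integrable_binary_power, of "1 / 2 ^ n" n]
    by (simp add: abs_L2_add h_power_def abs_L2_scaleC square_integrable_binary_power)
  finally show ?thesis .
qed

lemma odd_op_h_power:
  "odd_op (h_power n) = (\<Sum>l<n. scaleC (- of_nat (n choose l) / 2 ^ Suc n) (h_power l))"
proof -
  note sm = sum_h_power_abs[where n = n and c = "\<lambda>l. - of_nat (n choose l) / 2 ^ Suc n"]
  have "odd_op (h_power n) = abs_L2 (\<lambda>\<omega>. \<Sum>l<n. - of_nat (n choose l) / 2 ^ Suc n * complex_of_real (binary_value \<omega>) ^ l)"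
    unfolding odd_op_def h_power_abs sign_op_abs[OF square_integrable_binary_power]
      avg_op_abs[OF square_integrable_sign[OF square_integrable_binary_power]]
  proof (rule arg_cong[of _ _ abs_L2], rule ext)
    fix \<omega>
    have "((- 1) ^ of_bool (case_nat False \<omega> 0) * complex_of_real (binary_value (case_nat False \<omega>)) ^ n
        + (- 1) ^ of_bool (case_nat True \<omega> 0) * complex_of_real (binary_value (case_nat True \<omega>)) ^ n) / 2
        = ((complex_of_real (binary_value \<omega>) / 2) ^ n - ((1 + complex_of_real (binary_value \<omega>)) / 2) ^ n) / 2"
      by (simp add: binary_value_case_nat)
    also have "\<dots> = (\<Sum>l<n. - of_nat (n choose l) / 2 ^ Suc n * complex_of_real (binary_value \<omega>) ^ l)"
      by (rule binomial_average)
    finally show "((- 1) ^ of_bool (case_nat False \<omega> 0) * complex_of_real (binary_value (case_nat False \<omega>)) ^ n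
        + (- 1) ^ of_bool (case_nat True \<omega> 0) * complex_of_real (binary_value (case_nat True \<omega>)) ^ n) / 2
      = (\<Sum>l<n. - of_nat (n choose l) / 2 ^ Suc n * complex_of_real (binary_value \<omega>) ^ l)" .
  qed
  then show ?thesis using sm by simp
qed

section \<open>Triangularity with respect to the degree\<close>

lemma avg_op_h_power_low: "avg_op (h_power n) - scaleC (1 / 2 ^ n) (h_power n) \<in> low_degree n"
  unfolding avg_op_h_power by (auto intro!: L2.span_sum L2.span_scale h_power_in_low_degree)

text \<open>The coefficient comes from (n + 1 choose n) = n + 1. That it is nonzero drives both the
  independence of the powers and the coupling along a diagonal.\<close>

lemma odd_op_h_power_low:
  "odd_op (h_power (Suc n)) - scaleC (- of_nat (Suc n) / 2 ^ Suc (Suc n)) (h_power n) \<in> low_degree n"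
  unfolding odd_op_h_power sum.lessThan_Suc binomial_Suc_n add_diff_cancel
  by (intro L2.span_sum L2.span_scale h_power_in_low_degree) simp

lemma avg_op_low_degree:
  assumes "x \<in> low_degree n"
  shows "avg_op x \<in> low_degree n"
  using assms
proof (induction rule: L2.span_induct)
  case base
  show ?case
    unfolding L2.subspace_def mem_Collect_eq
    using avg_op_scaleC[of 0 0] by (auto simp: avg_op_add avg_op_scaleC intro: L2.span_add L2.span_scale L2.span_zero)
next
  case (step x)
  then obtain m where m: "x = h_power m" "m < n" by auto
  have "avg_op x - scaleC (1 / 2 ^ m) (h_power m) + scaleC (1 / 2 ^ m) (h_power m) \<in> low_degree n"
    unfolding m(1) using avg_op_h_power_low[of m] low_degree_mono[of m n] m(2)
    by (intro L2.span_add L2.span_scale h_power_in_low_degree) auto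
  then show ?case by simp
qed

lemma odd_op_low_degree:
  assumes "x \<in> low_degree (Suc n)"
  shows "odd_op x \<in> low_degree n"
  using assms
proof (induction rule: L2.span_induct)
  case base
  show ?case
    unfolding L2.subspace_def mem_Collect_eq
    using odd_op_scaleC[of 0 0] by (auto simp: odd_op_add odd_op_scaleC intro: L2.span_add L2.span_scale L2.span_zero)
next
  case (step x)
  then obtain m where m: "x = h_power m" "m < Suc n" by auto
  show ?case
    unfolding m(1) odd_op_h_power using m(2)
    by (intro L2.span_sum L2.span_scale h_power_in_low_degree) simp
qed

text \<open>\<open>odd_op\<close> lowers the degree by exactly one, so a linear relation in degree n
  + 1 produces one in degree n, down to the nonzero constant function.\<close>

lemma h_power_notin_low_degree: "h_power n \<notin> low_degree n"
proof (induction n)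
  case 0
  interpret prob_space "bernoulli :: (nat \<Rightarrow> bool) measure" by (rule prob_space_bernoulli)
  have "square_integrable (\<lambda>_ :: nat \<Rightarrow> bool. 1)" by (rule square_integrable_bounded[where B = 1]) auto
  then have "cinner (h_power 0) (h_power 0) = 1"
    using prob_space by (simp add: h_power_def cinner_abs)
  then show ?case by auto
next
  case (Suc n)
  show ?case
  proof
    assume "h_power (Suc n) \<in> low_degree (Suc n)"
    then have "odd_op (h_power (Suc n)) \<in> low_degree n" by (rule odd_op_low_degree)
    from L2.span_diff[OF this odd_op_h_power_low]
    have "scaleC (- of_nat (Suc n) / 2 ^ Suc (Suc n)) (h_power n) \<in> low_degree n" by simp
    then have "h_power n \<in> low_degree n"
      by (rule low_degree_scaleD) (simp del: of_nat_Suc)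
    with Suc show False by simp
  qed
qed

text \<open>The constant is left open because orthonormal polynomials carry a normalization factor,
  while the eigenpolynomials are monic.\<close>

definition leading :: "complex \<Rightarrow> nat \<Rightarrow> nat L2 \<Rightarrow> bool" where
  "leading c n x \<longleftrightarrow> c \<noteq> 0 \<and> x - scaleC c (h_power n) \<in> low_degree n"

lemma leading_in: "leading c n x \<Longrightarrow> x \<in> low_degree (Suc n)"
  by (auto simp: leading_def low_degree_Suc)

lemma leading_notin:
  assumes "leading c n x"
  shows "x \<notin> low_degree n"
proof
  assume "x \<in> low_degree n"
  with assms have "x - (x - scaleC c (h_power n)) \<in> low_degree n"
    unfolding leading_def by (blast intro: L2.span_diff)
  then have "scaleC c (h_power n) \<in> low_degree n" by simp
  moreover have "c \<noteq> 0" using assms by (simp add: leading_def)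
  ultimately show False using h_power_notin_low_degree[of n] low_degree_scaleD by blast
qed

lemma leading_reduce:
  assumes "leading c n x" "y \<in> low_degree (Suc n)"
  obtains k where "y - scaleC k x \<in> low_degree n"
proof -
  from assms(2) obtain k where k: "y - scaleC k (h_power n) \<in> low_degree n" by (auto simp: low_degree_Suc)
  have c: "c \<noteq> 0" "x - scaleC c (h_power n) \<in> low_degree n" using assms(1) by (auto simp: leading_def)
  have "(y - scaleC k (h_power n)) - scaleC (k / c) (x - scaleC c (h_power n)) \<in> low_degree n"
    by (intro L2.span_diff L2.span_scale k c)
  also have "(y - scaleC k (h_power n)) - scaleC (k / c) (x - scaleC c (h_power n)) = y - scaleC (k / c) x"
    using c(1) by (simp add: L2.scale_right_diff_distrib)
  finally show ?thesis using that by blast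
qed

lemma leading_expand:
  assumes b: "\<And>l. leading (c l) l (b l)" and x: "x \<in> low_degree n"
  shows "\<exists>a. x = (\<Sum>l<n. scaleC (a l) (b l))"
  using x
proof (induction n arbitrary: x)
  case (Suc n)
  from leading_reduce[OF b Suc.prems] obtain k where k: "x - scaleC k (b n) \<in> low_degree n" .
  from Suc.IH[OF this] obtain a where a: "x - scaleC k (b n) = (\<Sum>l<n. scaleC (a l) (b l))" ..
  have "(\<Sum>l<n. scaleC ((a(n := k)) l) (b l)) = x - scaleC k (b n)"
    unfolding a by (rule sum.cong) auto
  then have "x = (\<Sum>l<Suc n. scaleC ((a(n := k)) l) (b l))" by simp
  then show ?case by blast
qed simp

lemma leading_odd_op:
  assumes "leading c (Suc n) x"
  shows "leading (c * (- of_nat (Suc n) / 2 ^ Suc (Suc n))) n (odd_op x)"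
proof -
  have c: "c \<noteq> 0" "x - scaleC c (h_power (Suc n)) \<in> low_degree (Suc n)" using assms by (auto simp: leading_def)
  have "odd_op (x - scaleC c (h_power (Suc n))) \<in> low_degree n" by (rule odd_op_low_degree) fact
  from L2.span_add[OF this L2.span_scale[OF odd_op_h_power_low[of n], of c]]
  have "odd_op (x - scaleC c (h_power (Suc n))) + scaleC c (odd_op (h_power (Suc n)))
     - scaleC (c * (- of_nat (Suc n) / 2 ^ Suc (Suc n))) (h_power n) \<in> low_degree n"
    by (simp add: L2.scale_right_diff_distrib algebra_simps del: of_nat_Suc)
  moreover have "odd_op (x - scaleC c (h_power (Suc n))) + scaleC c (odd_op (h_power (Suc n))) = odd_op x"
    by (simp flip: odd_op_scaleC odd_op_add)
  ultimately show ?thesis using c(1) by (simp add: leading_def del: of_nat_Suc)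
qed

lemma leading_avg_op:
  assumes "leading c n x"
  shows "avg_op x - scaleC (1 / 2 ^ n) x \<in> low_degree n"
proof -
  have c: "x - scaleC c (h_power n) \<in> low_degree n" using assms by (auto simp: leading_def)
  let ?p = "x - scaleC c (h_power n)"
  have "avg_op ?p - scaleC (1 / 2 ^ n) ?p + scaleC c (avg_op (h_power n) - scaleC (1 / 2 ^ n) (h_power n)) \<in> low_degree n"
    by (intro low_degree_intros avg_op_low_degree c avg_op_h_power_low)
  also have "avg_op ?p - scaleC (1 / 2 ^ n) ?p + scaleC c (avg_op (h_power n) - scaleC (1 / 2 ^ n) (h_power n))
     = (avg_op ?p + avg_op (scaleC c (h_power n))) - scaleC (1 / 2 ^ n) x"
    by (simp add: L2.scale_right_diff_distrib avg_op_scaleC algebra_simps)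
  also have "\<dots> = avg_op x - scaleC (1 / 2 ^ n) x" by (simp flip: avg_op_add)
  finally show ?thesis .
qed

text \<open>By triangularity the eigenvalues of the average in degree below n are 2^-l with l < n;
  the induction solves for the top coefficient and descends.\<close>

lemma avg_op_shift_surj:
  assumes "\<And>l. l < n \<Longrightarrow> c \<noteq> 1 / 2 ^ l" "y \<in> low_degree n"
  shows "\<exists>x\<in>low_degree n. avg_op x - scaleC c x = y"
  using assms
proof (induction n arbitrary: y)
  case 0
  then show ?case using avg_op_scaleC[of 0 0] by auto
next
  case (Suc n)
  from Suc.prems(2) obtain k where k: "y - scaleC k (h_power n) \<in> low_degree n" by (auto simp: low_degree_Suc)
  \<comment> \<open>Matches the coefficient of degree n, which the average multiplies by
    2^-n.\<close>
  define t where "t = k / (1 / 2 ^ n - c)"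
  have c: "1 / 2 ^ n - c \<noteq> 0" using Suc.prems(1)[of n] by auto
  define r where "r = avg_op (h_power n) - scaleC (1 / 2 ^ n) (h_power n)"
  have "y - scaleC k (h_power n) - scaleC t r \<in> low_degree n"
    unfolding r_def by (intro low_degree_intros k avg_op_h_power_low)
  with Suc.IH Suc.prems(1) obtain x where x: "x \<in> low_degree n"
      "avg_op x - scaleC c x = y - scaleC k (h_power n) - scaleC t r" by auto
  have tk: "t * (1 / 2 ^ n) - t * c = k" using c unfolding t_def right_diff_distrib[symmetric] by simp
  have "avg_op (x + scaleC t (h_power n)) - scaleC c (x + scaleC t (h_power n))
      = (avg_op x - scaleC c x) + scaleC t r + scaleC (t * (1 / 2 ^ n) - t * c) (h_power n)"
    by (simp add: r_def avg_op_add avg_op_scaleC L2.scale_right_distrib L2.scale_right_diff_distrib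
        L2.scale_left_diff_distrib algebra_simps)
  also have "\<dots> = y" unfolding tk x(2) by simp
  finally have "avg_op (x + scaleC t (h_power n)) - scaleC c (x + scaleC t (h_power n)) = y" .
  moreover have "x + scaleC t (h_power n) \<in> low_degree (Suc n)"
    using x(1) low_degree_mono[of n "Suc n"] by (intro L2.span_add L2.span_scale h_power_in_low_degree) auto
  ultimately show ?case by blast
qed

text \<open>These are the Bernoulli polynomials in \<open>binary_value\<close>: the eigenvalue
  equation is their multiplication theorem for the factor 2.\<close>

definition eigen_poly :: "nat \<Rightarrow> nat L2" where
  "eigen_poly n = (SOME b. leading 1 n b \<and> avg_op b = scaleC (1 / 2 ^ n) b)"

lemma eigen_poly: "leading 1 n (eigen_poly n) \<and> avg_op (eigen_poly n) = scaleC (1 / 2 ^ n) (eigen_poly n)"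
  unfolding eigen_poly_def
proof (rule someI_ex)
  \<comment> \<open>The defect of \<open>h_power n\<close> has lower degree and can be corrected
    there, because 2^-n is not an eigenvalue in lower degree.\<close>
  have "\<exists>x\<in>low_degree n. avg_op x - scaleC (1 / 2 ^ n) x = - (avg_op (h_power n) - scaleC (1 / 2 ^ n) (h_power n))"
  proof (rule avg_op_shift_surj)
    show "1 / 2 ^ n \<noteq> (1 / 2 ^ l :: complex)" if "l < n" for l
      unfolding half_power_eq_iff using that by simp
  qed (intro L2.span_neg avg_op_h_power_low)
  then obtain x where x: "x \<in> low_degree n"
    "avg_op x - scaleC (1 / 2 ^ n) x = - (avg_op (h_power n) - scaleC (1 / 2 ^ n) (h_power n))" by blast
  have "leading 1 n (h_power n + x)" using x(1) by (simp add: leading_def)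
  moreover have "avg_op (h_power n + x) - scaleC (1 / 2 ^ n) (h_power n + x)
      = (avg_op x - scaleC (1 / 2 ^ n) x) + (avg_op (h_power n) - scaleC (1 / 2 ^ n) (h_power n))"
    unfolding avg_op_add L2.scale_right_distrib by (simp add: algebra_simps)
  then have "avg_op (h_power n + x) - scaleC (1 / 2 ^ n) (h_power n + x) = 0"
    unfolding x(2) by (simp only: ab_left_minus)
  then have "avg_op (h_power n + x) = scaleC (1 / 2 ^ n) (h_power n + x)" by (simp only: right_minus_eq)
  ultimately show "\<exists>b. leading 1 n b \<and> avg_op b = scaleC (1 / 2 ^ n) b" by blast
qed

lemmas leading_eigen_poly = eigen_poly[THEN conjunct1]
lemmas avg_op_eigen_poly = eigen_poly[THEN conjunct2]

section \<open>Orthonormal polynomials by Gram-Schmidt\<close>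

lemma low_degree_projection: "\<exists>p\<in>low_degree n. \<forall>y\<in>low_degree n. cinner (x - p) y = 0"
proof (induction n arbitrary: x)
  case 0
  then show ?case by auto
next
  case (Suc n)
  from Suc[of "h_power n"] obtain s where s: "s \<in> low_degree n" "\<And>y. y \<in> low_degree n \<Longrightarrow> cinner (h_power n - s) y = 0"
    by blast
  define q where "q = h_power n - s"
  have lq: "leading 1 n q" using s(1) by (simp add: leading_def q_def L2.span_neg)
  have q0: "cinner q q \<noteq> 0" using leading_notin[OF lq] by (auto simp: L2.span_zero)
  have qy: "cinner q y = 0" if "y \<in> low_degree n" for y using s(2)[OF that] by (simp add: q_def)
  from Suc[of x] obtain p where p: "p \<in> low_degree n" "\<And>y. y \<in> low_degree n \<Longrightarrow> cinner (x - p) y = 0"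
    by blast
  \<comment> \<open>The component along q, the new direction orthogonal to all lower
    degrees.\<close>
  define k where "k = cinner (x - p) q / cinner q q"
  have "p + scaleC k q \<in> low_degree (Suc n)"
    using p(1) low_degree_mono[of n "Suc n"] leading_in[OF lq] by (intro L2.span_add L2.span_scale) auto
  moreover have "cinner (x - (p + scaleC k q)) y = 0" if y: "y \<in> low_degree (Suc n)" for y
  proof -
    from leading_reduce[OF lq y] obtain m where m: "y - scaleC m q \<in> low_degree n" .
    have 1: "cinner (x - (p + scaleC k q)) u = cinner (x - p) u - k * cinner q u" for u
      by (simp add: cinner_diff_left cinner_add_left cinner_scaleC_left algebra_simps)
    have "cinner (x - (p + scaleC k q)) ((y - scaleC m q) + scaleC m q) = 0"
      unfolding cinner_add_right[of _ "y - scaleC m q"] cinner_scaleC_right 1 p(2)[OF m] qy[OF m]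
      using q0 by (simp add: k_def)
    then show ?thesis by simp
  qed
  ultimately show ?case by blast
qed

text \<open>Up to a phase, the normalized Legendre polynomials of the unit interval, since
  \<open>binary_value\<close> is uniformly distributed there.\<close>

definition ortho_poly :: "nat \<Rightarrow> nat L2" where
  "ortho_poly n = (SOME u. (\<exists>c. leading c n u) \<and> (\<forall>y\<in>low_degree n. cinner u y = 0) \<and> cinner u u = 1)"

lemma ortho_poly:
  "(\<exists>c. leading c n (ortho_poly n)) \<and> (\<forall>y\<in>low_degree n. cinner (ortho_poly n) y = 0) \<and>
   cinner (ortho_poly n) (ortho_poly n) = 1"
  unfolding ortho_poly_def
proof (rule someI_ex)
  from low_degree_projection obtain p where p: "p \<in> low_degree n" "\<And>y. y \<in> low_degree n \<Longrightarrow> cinner (h_power n - p) y = 0"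
    by blast
  define q where "q = h_power n - p"
  have lq: "leading 1 n q" using p(1) by (simp add: leading_def q_def L2.span_neg)
  have q0: "norm q \<noteq> 0" using leading_notin[OF lq] by (auto simp: L2.span_zero)
  define u where "u = scaleC (1 / norm q) q"
  have "leading (1 / norm q) n u"
    using lq q0 L2.span_scale[of "q - h_power n" _ "complex_of_real (1 / norm q)"]
    by (auto simp: leading_def u_def L2.scale_right_diff_distrib)
  moreover have "cinner u y = 0" if "y \<in> low_degree n" for y
    using p(2)[OF that] by (simp add: u_def q_def cinner_scaleC_left)
  moreover have "cinner u u = 1"
    using q0 by (simp add: u_def cinner_self norm_scaleC norm_divide)
  ultimately show "\<exists>u. (\<exists>c. leading c n u) \<and> (\<forall>y\<in>low_degree n. cinner u y = 0) \<and> cinner u u = 1" by blast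
qed

lemma leading_ortho_poly: obtains c where "leading c n (ortho_poly n)"
  using ortho_poly by blast

lemma cinner_ortho_low: "y \<in> low_degree n \<Longrightarrow> cinner (ortho_poly n) y = 0"
  and cinner_low_ortho: "y \<in> low_degree n \<Longrightarrow> cinner y (ortho_poly n) = 0"
  using ortho_poly cinner_commute[of y "ortho_poly n"] by auto

lemma ortho_in_low_degree: "m < n \<Longrightarrow> ortho_poly m \<in> low_degree n"
  using leading_in low_degree_mono[of "Suc m" n] leading_ortho_poly[of m] by (metis Suc_leI subsetD)

lemma cinner_ortho_poly: "cinner (ortho_poly m) (ortho_poly n) = of_bool (m = n)"
  using ortho_poly[of n] cinner_ortho_low[OF ortho_in_low_degree, of n m] cinner_low_ortho[OF ortho_in_low_degree, of m n]
  by (cases m n rule: linorder_cases) auto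

lemma ortho_expand:
  assumes "x \<in> low_degree n"
  shows "x = (\<Sum>l<n. scaleC (cinner x (ortho_poly l)) (ortho_poly l))"
proof -
  obtain c where "\<And>l. leading (c l) l (ortho_poly l)" using ortho_poly by metis
  from leading_expand[OF this assms] obtain a where a: "x = (\<Sum>l<n. scaleC (a l) (ortho_poly l))" ..
  have "cinner x (ortho_poly l) = a l" if "l < n" for l
    using that by (simp add: a cinner_sum_left cinner_scaleC_left cinner_ortho_poly sum_mult_of_bool_eq)
  then show ?thesis by (subst a) simp
qed

text \<open>A zero on the diagonal would leave the eigenpolynomial with a degree below its own.
  Triangularity of this Gram matrix is what lets test vectors detect single coordinates.\<close>

lemma cinner_eigen_ortho:
  "i < j \<Longrightarrow> cinner (eigen_poly i) (ortho_poly j) = 0" "cinner (eigen_poly i) (ortho_poly i) \<noteq> 0"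
proof -
  show "cinner (eigen_poly i) (ortho_poly j) = 0" if "i < j"
    using leading_in[OF leading_eigen_poly[of i]] low_degree_mono[of "Suc i" j] that
    by (intro cinner_low_ortho) auto
  show "cinner (eigen_poly i) (ortho_poly i) \<noteq> 0"
  proof
    assume 0: "cinner (eigen_poly i) (ortho_poly i) = 0"
    have "eigen_poly i = (\<Sum>l<Suc i. scaleC (cinner (eigen_poly i) (ortho_poly l)) (ortho_poly l))"
      by (rule ortho_expand) (rule leading_in[OF leading_eigen_poly])
    also have "\<dots> = (\<Sum>l<i. scaleC (cinner (eigen_poly i) (ortho_poly l)) (ortho_poly l))"
      by (simp add: 0)
    also have "\<dots> \<in> low_degree i"
      by (intro L2.span_sum L2.span_scale ortho_in_low_degree) simp
    finally show False using leading_notin[OF leading_eigen_poly] by blast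
  qed
qed

text \<open>The value 0 for l \<ge> i is fixed so that later sums may run over all indices up to a
  common bound M.\<close>

definition odd_coeff :: "nat \<Rightarrow> nat \<Rightarrow> complex" where
  "odd_coeff i = (SOME a. (\<forall>l. l \<ge> i \<longrightarrow> a l = 0) \<and> odd_op (eigen_poly i) = (\<Sum>l<i. scaleC (a l) (eigen_poly l)))"

lemma odd_coeff:
  "(\<forall>l. l \<ge> i \<longrightarrow> odd_coeff i l = 0) \<and> odd_op (eigen_poly i) = (\<Sum>l<i. scaleC (odd_coeff i l) (eigen_poly l))"
proof -
  have "odd_op (eigen_poly i) \<in> low_degree i"
    by (rule odd_op_low_degree) (rule leading_in[OF leading_eigen_poly])
  from leading_expand[OF leading_eigen_poly this] obtain a
    where "odd_op (eigen_poly i) = (\<Sum>l<i. scaleC (a l) (eigen_poly l))" ..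
  then have "\<exists>a. (\<forall>l. l \<ge> i \<longrightarrow> a l = 0) \<and> odd_op (eigen_poly i) = (\<Sum>l<i. scaleC (a l) (eigen_poly l))"
    by (intro exI[of _ "\<lambda>l. if l < i then a l else 0"]) auto
  then show ?thesis unfolding odd_coeff_def by (rule someI_ex)
qed

lemma odd_coeff_eq_0: "i \<le> l \<Longrightarrow> odd_coeff i l = 0"
  using odd_coeff by blast

lemma eigen_in_low_degree: "m < n \<Longrightarrow> eigen_poly m \<in> low_degree n"
  using leading_in[OF leading_eigen_poly[of m]] low_degree_mono[of "Suc m" n] by auto

text \<open>A zero would push \<open>odd_op\<close> down by two degrees, against its nonzero leading
  coefficient. This is one of the two factors of the coupling; the other is
  \<open>cinner_odd_ortho_nonzero\<close>.\<close>

lemma odd_coeff_nonzero: "odd_coeff (Suc i) i \<noteq> 0"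
proof
  assume "odd_coeff (Suc i) i = 0"
  then have "odd_op (eigen_poly (Suc i)) = (\<Sum>l<i. scaleC (odd_coeff (Suc i) l) (eigen_poly l))"
    using odd_coeff[of "Suc i"] by simp
  also have "\<dots> \<in> low_degree i" by (intro L2.span_sum L2.span_scale eigen_in_low_degree) simp
  finally show False using leading_notin[OF leading_odd_op[OF leading_eigen_poly]] by blast
qed

text \<open>Orthonormal polynomials need not be eigenvectors, so lower terms remain; only the
  diagonal entry is fixed, by orthogonality to lower degrees.\<close>

lemma avg_op_ortho_expand:
  "avg_op (ortho_poly j) = scaleC (1 / 2 ^ j) (ortho_poly j)
     + (\<Sum>l<j. scaleC (cinner (avg_op (ortho_poly j)) (ortho_poly l)) (ortho_poly l))"
proof -
  obtain c where c: "leading c j (ortho_poly j)" by (rule leading_ortho_poly)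
  have "cinner (avg_op (ortho_poly j) - scaleC (1 / 2 ^ j) (ortho_poly j)) (ortho_poly j) = 0"
    by (rule cinner_low_ortho[OF leading_avg_op[OF c]])
  then have d: "cinner (avg_op (ortho_poly j)) (ortho_poly j) = 1 / 2 ^ j"
    by (simp add: cinner_diff_left cinner_scaleC_left cinner_ortho_poly)
  have "avg_op (ortho_poly j) = (\<Sum>l<Suc j. scaleC (cinner (avg_op (ortho_poly j)) (ortho_poly l)) (ortho_poly l))"
    by (rule ortho_expand) (intro avg_op_low_degree ortho_in_low_degree, simp)
  then show ?thesis by (simp add: d add.commute)
qed

lemma odd_op_ortho_expand:
  "odd_op (ortho_poly j) = (\<Sum>l<j. scaleC (cinner (odd_op (ortho_poly j)) (ortho_poly l)) (ortho_poly l))"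
  by (rule ortho_expand) (intro odd_op_low_degree ortho_in_low_degree, simp)

lemma cinner_odd_ortho_nonzero: "cinner (odd_op (ortho_poly (Suc j))) (ortho_poly j) \<noteq> 0"
proof
  assume "cinner (odd_op (ortho_poly (Suc j))) (ortho_poly j) = 0"
  then have "odd_op (ortho_poly (Suc j))
      = (\<Sum>l<j. scaleC (cinner (odd_op (ortho_poly (Suc j))) (ortho_poly l)) (ortho_poly l))"
    by (subst odd_op_ortho_expand) simp
  also have "\<dots> \<in> low_degree j" by (intro L2.span_sum L2.span_scale ortho_in_low_degree) simp
  finally have *: "odd_op (ortho_poly (Suc j)) \<in> low_degree j" .
  obtain c where "leading c (Suc j) (ortho_poly (Suc j))" by (rule leading_ortho_poly)
  from leading_notin[OF leading_odd_op[OF this]] * show False by blast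
qed

section \<open>Functionals on the test space\<close>

lemma tensor_in_X_plus_step:
  assumes "j \<le> N"
  shows "f \<otimes>\<^sub>L ortho_poly j \<in> X_plus_step N"
proof -
  have "ortho_poly j \<in> poly_space N"
    unfolding poly_space_eq by (rule ortho_in_low_degree) (use assms in simp)
  then show ?thesis unfolding X_plus_step_def by (intro L2.span_base) blast
qed

text \<open>Expanding the polynomial factor moves all scalars into the other factor, so N + 1
  arbitrary coefficient functions describe a step.\<close>

lemma X_plus_step_iff: "g \<in> X_plus_step N \<longleftrightarrow> (\<exists>G. g = (\<Sum>j\<le>N. G j \<otimes>\<^sub>L ortho_poly j))"
proof
  assume "g \<in> X_plus_step N"
  then show "\<exists>G. g = (\<Sum>j\<le>N. G j \<otimes>\<^sub>L ortho_poly j)"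
    unfolding X_plus_step_def
  proof (induction rule: L2.span_induct)
    case base
    show ?case
      unfolding L2.subspace_def mem_Collect_eq
    proof (intro conjI allI ballI impI)
      show "\<exists>G. 0 = (\<Sum>j\<le>N. G j \<otimes>\<^sub>L ortho_poly j)" by (intro exI[of _ "\<lambda>_. 0"]) simp
    next
      fix x y assume "x \<in> {g. \<exists>G. g = (\<Sum>j\<le>N. G j \<otimes>\<^sub>L ortho_poly j)}" "y \<in> {g. \<exists>G. g = (\<Sum>j\<le>N. G j \<otimes>\<^sub>L ortho_poly j)}"
      then obtain G H where "x = (\<Sum>j\<le>N. G j \<otimes>\<^sub>L ortho_poly j)" "y = (\<Sum>j\<le>N. H j \<otimes>\<^sub>L ortho_poly j)" by auto
      then show "\<exists>G. x + y = (\<Sum>j\<le>N. G j \<otimes>\<^sub>L ortho_poly j)"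
        by (intro exI[of _ "\<lambda>j. G j + H j"]) (simp add: tensor_add_left sum.distrib)
    next
      fix c x assume "x \<in> {g. \<exists>G. g = (\<Sum>j\<le>N. G j \<otimes>\<^sub>L ortho_poly j)}"
      then obtain G where "x = (\<Sum>j\<le>N. G j \<otimes>\<^sub>L ortho_poly j)" by auto
      then show "\<exists>G. scaleC c x = (\<Sum>j\<le>N. G j \<otimes>\<^sub>L ortho_poly j)"
        by (intro exI[of _ "\<lambda>j. scaleC c (G j)"]) (simp add: tensor_scaleC_left L2.scale_sum_right)
    qed
  next
    case (step x)
    then obtain f p where x: "x = f \<otimes>\<^sub>L p" "p \<in> low_degree (Suc N)" by (auto simp: poly_space_eq)
    have "x = f \<otimes>\<^sub>L (\<Sum>l<Suc N. scaleC (cinner p (ortho_poly l)) (ortho_poly l))"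
      unfolding x(1) by (rule arg_cong[OF ortho_expand[OF x(2)]])
    then show ?case
      by (intro exI[of _ "\<lambda>l. scaleC (cinner p (ortho_poly l)) f"])
        (simp add: tensor_sum_right tensor_scaleC_right tensor_scaleC_left lessThan_Suc_atMost del: sum.lessThan_Suc)
  qed
next
  assume "\<exists>G. g = (\<Sum>j\<le>N. G j \<otimes>\<^sub>L ortho_poly j)"
  then obtain G where g: "g = (\<Sum>j\<le>N. G j \<otimes>\<^sub>L ortho_poly j)" ..
  show "g \<in> X_plus_step N"
    unfolding g X_plus_step_def
    by (intro L2.span_sum tensor_in_X_plus_step[unfolded X_plus_step_def]) simp
qed

lemma X_minus_step_expand:
  assumes "f \<in> X_minus_step M"
  shows "\<exists>F. f = (\<Sum>i\<le>M. eigen_poly i \<otimes>\<^sub>L F i)"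
  using assms unfolding X_minus_step_def
proof (induction rule: L2.span_induct)
  case base
  show ?case
    unfolding L2.subspace_def mem_Collect_eq
  proof (intro conjI allI ballI impI)
    show "\<exists>F. 0 = (\<Sum>i\<le>M. eigen_poly i \<otimes>\<^sub>L F i)" by (intro exI[of _ "\<lambda>_. 0"]) simp
  next
    fix x y assume "x \<in> {f. \<exists>F. f = (\<Sum>i\<le>M. eigen_poly i \<otimes>\<^sub>L F i)}" "y \<in> {f. \<exists>F. f = (\<Sum>i\<le>M. eigen_poly i \<otimes>\<^sub>L F i)}"
    then obtain G H where "x = (\<Sum>i\<le>M. eigen_poly i \<otimes>\<^sub>L G i)" "y = (\<Sum>i\<le>M. eigen_poly i \<otimes>\<^sub>L H i)" by auto
    then show "\<exists>F. x + y = (\<Sum>i\<le>M. eigen_poly i \<otimes>\<^sub>L F i)"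
      by (intro exI[of _ "\<lambda>j. G j + H j"]) (simp add: tensor_add_right sum.distrib)
  next
    fix c x assume "x \<in> {f. \<exists>F. f = (\<Sum>i\<le>M. eigen_poly i \<otimes>\<^sub>L F i)}"
    then obtain G where "x = (\<Sum>i\<le>M. eigen_poly i \<otimes>\<^sub>L G i)" by auto
    then show "\<exists>F. scaleC c x = (\<Sum>i\<le>M. eigen_poly i \<otimes>\<^sub>L F i)"
      by (intro exI[of _ "\<lambda>j. scaleC c (G j)"]) (simp add: tensor_scaleC_right L2.scale_sum_right)
  qed
next
  case (step x)
  then obtain f p where x: "x = p \<otimes>\<^sub>L f" "p \<in> low_degree (Suc M)" by (auto simp: poly_space_eq)
  from leading_expand[OF leading_eigen_poly x(2)] obtain a where "p = (\<Sum>l<Suc M. scaleC (a l) (eigen_poly l))" ..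
  then show ?case
    by (intro exI[of _ "\<lambda>l. scaleC (a l) f"])
      (simp add: x(1) tensor_sum_left tensor_scaleC_right tensor_scaleC_left lessThan_Suc_atMost del: sum.lessThan_Suc)
qed

lemma X_plus_step_mono: "M \<le> N \<Longrightarrow> X_plus_step M \<subseteq> X_plus_step N"
  unfolding X_plus_step_def poly_space_eq using low_degree_mono[of "Suc M" "Suc N"]
  by (intro L2.span_mono) auto

lemma X_minus_step_mono: "M \<le> N \<Longrightarrow> X_minus_step M \<subseteq> X_minus_step N"
  unfolding X_minus_step_def poly_space_eq using low_degree_mono[of "Suc M" "Suc N"]
  by (intro L2.span_mono) auto

lemma X_plus_step_add: "f \<in> X_plus_step N \<Longrightarrow> g \<in> X_plus_step N \<Longrightarrow> f + g \<in> X_plus_step N"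
  unfolding X_plus_step_def by (rule L2.span_add)

lemma X_plus_step_scaleC: "f \<in> X_plus_step N \<Longrightarrow> scaleC c f \<in> X_plus_step N"
  unfolding X_plus_step_def by (rule L2.span_scale)

lemma X_plus_stepI: "f \<in> X_plus_step N \<Longrightarrow> f \<in> X_plus"
  by (auto simp: X_plus_def)

lemma X_plus_common_step:
  assumes "f \<in> X_plus" "g \<in> X_plus"
  obtains N where "f \<in> X_plus_step N" "g \<in> X_plus_step N"
proof -
  from assms obtain m n where "f \<in> X_plus_step m" "g \<in> X_plus_step n" by (auto simp: X_plus_def)
  then show ?thesis
    using that[of "max m n"] X_plus_step_mono[of m "max m n"] X_plus_step_mono[of n "max m n"] by auto
qed

lemma X_minus_common_step:
  assumes "f \<in> X_minus" "g \<in> X_minus"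
  obtains M where "f \<in> X_minus_step M" "g \<in> X_minus_step M"
proof -
  from assms obtain m n where "f \<in> X_minus_step m" "g \<in> X_minus_step n" by (auto simp: X_minus_def)
  then show ?thesis
    using that[of "max m n"] X_minus_step_mono[of m "max m n"] X_minus_step_mono[of n "max m n"] by auto
qed

lemma X_plus_add: "f \<in> X_plus \<Longrightarrow> g \<in> X_plus \<Longrightarrow> f + g \<in> X_plus"
  by (meson X_plus_common_step X_plus_stepI X_plus_step_add)

lemma X_plus_scaleC: "f \<in> X_plus \<Longrightarrow> scaleC c f \<in> X_plus"
  by (meson X_plus_common_step X_plus_stepI X_plus_step_scaleC)

lemma X_minus_add: "f \<in> X_minus \<Longrightarrow> g \<in> X_minus \<Longrightarrow> f + g \<in> X_minus"
  by (elim X_minus_common_step[of f g]) (auto simp: X_minus_def X_minus_step_def intro: L2.span_add)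

lemma X_minus_scaleC: "f \<in> X_minus \<Longrightarrow> scaleC c f \<in> X_minus"
  by (auto simp: X_minus_def X_minus_step_def intro: L2.span_scale)

lemma X_plus_zero: "0 \<in> X_plus"
  by (rule X_plus_stepI[of _ 0]) (simp add: X_plus_step_def L2.span_zero)

lemma tensor_in_X_plus: "f \<otimes>\<^sub>L ortho_poly j \<in> X_plus"
  by (rule X_plus_stepI[OF tensor_in_X_plus_step[of j j]]) simp

text \<open>The average keeps the degree and \<open>odd_op\<close> lowers it. Since the step is
  preserved, a bound on it can be applied to all iterates with one constant.\<close>

lemma V_eps_adj_step:
  assumes "g \<in> X_plus_step N"
  shows "V_eps_adj \<epsilon> g \<in> X_plus_step N"
proof -
  from assms obtain G where g: "g = (\<Sum>j\<le>N. G j \<otimes>\<^sub>L ortho_poly j)" by (auto simp: X_plus_step_iff)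
  have "V_eps_adj \<epsilon> (\<Sum>j\<in>A. G j \<otimes>\<^sub>L ortho_poly j) \<in> X_plus_step N" if "finite A" "A \<subseteq> {..N}" for A
    using that
  proof (induction A)
    case empty
    then show ?case using V_eps_adj_scaleC[of \<epsilon> 0 0] by (simp add: X_plus_step_def L2.span_zero)
  next
    case (insert j A)
    have o: "ortho_poly j \<in> low_degree (Suc N)" using insert.prems by (intro ortho_in_low_degree) auto
    have "odd_op (ortho_poly j) \<in> low_degree N" by (rule odd_op_low_degree[OF o])
    then have "odd_op (ortho_poly j) \<in> low_degree (Suc N)" using low_degree_mono[of N "Suc N"] by auto
    with avg_op_low_degree[OF o] have "V_eps_adj \<epsilon> (G j \<otimes>\<^sub>L ortho_poly j) \<in> X_plus_step N"
      unfolding V_eps_adj_tensor X_plus_step_def poly_space_eq odd_op_def[symmetric]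
      by (intro L2.span_add L2.span_scale L2.span_base) auto
    then show ?case using insert by (simp add: V_eps_adj_add X_plus_step_add)
  qed
  then show ?thesis unfolding g by simp
qed

lemma V_eps_adj_X_plus: "g \<in> X_plus \<Longrightarrow> V_eps_adj \<epsilon> g \<in> X_plus"
  by (auto simp: X_plus_def intro: V_eps_adj_step)

section \<open>Anti-linear functionals and their continuity\<close>

definition antilinear_on_X_plus :: "(int L2 \<Rightarrow> complex) \<Rightarrow> bool" where
  "antilinear_on_X_plus \<mu> \<longleftrightarrow> (\<forall>x\<in>X_plus. \<forall>y\<in>X_plus. \<mu> (x + y) = \<mu> x + \<mu> y) \<and>
     (\<forall>c. \<forall>x\<in>X_plus. \<mu> (scaleC c x) = cnj c * \<mu> x) \<and> (\<forall>x. x \<notin> X_plus \<longrightarrow> \<mu> x = 0)"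

lemma antilinear_sum:
  assumes "antilinear_on_X_plus \<mu>" "\<And>a. a \<in> A \<Longrightarrow> f a \<in> X_plus"
  shows "\<mu> (sum f A) = (\<Sum>a\<in>A. \<mu> (f a))" "sum f A \<in> X_plus"
proof -
  have "\<mu> (scaleC 0 0) = cnj 0 * \<mu> 0"
    using assms(1) X_plus_zero unfolding antilinear_on_X_plus_def by blast
  then have z: "\<mu> 0 = 0" by simp
  have "\<mu> (sum f A) = (\<Sum>a\<in>A. \<mu> (f a)) \<and> sum f A \<in> X_plus" using assms(2)
  proof (induction A rule: infinite_finite_induct)
    case (insert x F)
    then show ?case using assms(1) by (simp add: antilinear_on_X_plus_def X_plus_add)
  qed (simp_all add: z X_plus_zero)
  then show "\<mu> (sum f A) = (\<Sum>a\<in>A. \<mu> (f a))" "sum f A \<in> X_plus" by auto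
qed

lemma antilinear_ext:
  assumes \<mu>: "antilinear_on_X_plus \<mu>" and \<nu>: "antilinear_on_X_plus \<nu>"
    and eq: "\<And>u j. \<mu> (u \<otimes>\<^sub>L ortho_poly j) = \<nu> (u \<otimes>\<^sub>L ortho_poly j)"
  shows "\<mu> = \<nu>"
proof
  fix g
  show "\<mu> g = \<nu> g"
  proof (cases "g \<in> X_plus")
    case True
    then obtain N G where g: "g = (\<Sum>j\<le>N. G j \<otimes>\<^sub>L ortho_poly j)" by (auto simp: X_plus_def X_plus_step_iff)
    show ?thesis
      unfolding g antilinear_sum(1)[OF \<mu> tensor_in_X_plus] antilinear_sum(1)[OF \<nu> tensor_in_X_plus] eq ..
  qed (use assms in \<open>simp add: antilinear_on_X_plus_def\<close>)
qed

lemma X_plus_dual_antilinear: "\<mu> \<in> X_plus_dual \<Longrightarrow> antilinear_on_X_plus \<mu>"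
  by (auto simp: X_plus_dual_def antilinear_on_X_plus_def)

text \<open>A sublevel set of |\<mu>| is absolutely convex, and boundedness on a step places a ball
  of that step inside it; the bounds may vary freely from step to step.\<close>

lemma inductive_limit_nbhd_functional:
  assumes \<mu>: "antilinear_on_X_plus \<mu>" and d: "d > 0"
    and bd: "\<And>N. \<exists>C. \<forall>g\<in>X_plus_step N. cmod (\<mu> g) \<le> C * norm g"
  shows "inductive_limit_nbhd X_plus_step {y \<in> X_plus. cmod (\<mu> y) < d}"
  unfolding inductive_limit_nbhd_def X_plus_def[symmetric]
proof (intro conjI allI impI)
  have add: "\<mu> (x + y) = \<mu> x + \<mu> y" if "x \<in> X_plus" "y \<in> X_plus" for x y
    using \<mu> that by (simp add: antilinear_on_X_plus_def)
  have sc: "\<mu> (scaleC c x) = cnj c * \<mu> x" if "x \<in> X_plus" for c x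
    using \<mu> that by (simp add: antilinear_on_X_plus_def)
  show "{y \<in> X_plus. cmod (\<mu> y) < d} \<subseteq> X_plus" by blast
  show "convex {y \<in> X_plus. cmod (\<mu> y) < d}"
  proof (rule convexI)
    fix x y :: "int L2" and u v :: real
    assume *: "x \<in> {y \<in> X_plus. cmod (\<mu> y) < d}" "y \<in> {y \<in> X_plus. cmod (\<mu> y) < d}" "0 \<le> u" "0 \<le> v" "u + v = 1"
    then have "cmod (\<mu> (u *\<^sub>R x + v *\<^sub>R y)) = cmod (complex_of_real u * \<mu> x + complex_of_real v * \<mu> y)"
      by (simp add: scaleR_L2_def add sc X_plus_scaleC)
    also have "\<dots> \<le> u * cmod (\<mu> x) + v * cmod (\<mu> y)"
      by (rule order_trans[OF norm_triangle_ineq]) (use * in \<open>simp add: norm_mult\<close>)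
    also have "\<dots> < d" using * by (intro convex_bound_lt) auto
    finally show "u *\<^sub>R x + v *\<^sub>R y \<in> {y \<in> X_plus. cmod (\<mu> y) < d}"
      using * by (simp add: scaleR_L2_def X_plus_add X_plus_scaleC)
  qed
  show "scaleC c ` {y \<in> X_plus. cmod (\<mu> y) < d} \<subseteq> {y \<in> X_plus. cmod (\<mu> y) < d}" if "cmod c \<le> 1" for c
  proof clarify
    fix y assume y: "y \<in> X_plus" "cmod (\<mu> y) < d"
    have "cmod (\<mu> (scaleC c y)) \<le> 1 * cmod (\<mu> y)"
      unfolding sc[OF y(1)] norm_mult complex_mod_cnj using that by (intro mult_right_mono) auto
    then show "scaleC c y \<in> X_plus \<and> cmod (\<mu> (scaleC c y)) < d" using y X_plus_scaleC by auto
  qed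
  show "\<exists>e>0. ball 0 e \<inter> X_plus_step M \<subseteq> {y \<in> X_plus. cmod (\<mu> y) < d}" for M
  proof -
    obtain C where C: "\<And>g. g \<in> X_plus_step M \<Longrightarrow> cmod (\<mu> g) \<le> C * norm g" using bd by blast
    \<comment> \<open>Adding 1 to |C| keeps the divisor positive for every C.\<close>
    have "cmod (\<mu> g) < d" if "g \<in> X_plus_step M" "norm g < d / (\<bar>C\<bar> + 1)" for g
    proof -
      have "cmod (\<mu> g) \<le> C * norm g" by (rule C) fact
      also have "\<dots> \<le> (\<bar>C\<bar> + 1) * norm g" by (intro mult_right_mono) auto
      also have "\<dots> < d" using that(2) by (simp add: pos_less_divide_eq mult.commute)
      finally show ?thesis .
    qed
    then show ?thesis using d by (intro exI[of _ "d / (\<bar>C\<bar> + 1)"]) (auto simp: X_plus_stepI)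
  qed
qed

lemma X_plus_dualI:
  assumes \<mu>: "antilinear_on_X_plus \<mu>"
    and bd: "\<And>N. \<exists>C. \<forall>g\<in>X_plus_step N. cmod (\<mu> g) \<le> C * norm g"
  shows "\<mu> \<in> X_plus_dual"
proof -
  let ?T = "inductive_limit_topology X_plus_step"
  have W: "inductive_limit_nbhd X_plus_step {y \<in> X_plus. cmod (\<mu> y) < d}" if "d > 0" for d
    by (rule inductive_limit_nbhd_functional[OF \<mu> that bd])
  \<comment> \<open>The carrier of the topology is X_+ once X_+ itself is known to be open; the
    sublevel set of radius 1 serves as neighbourhood.\<close>
  have "openin ?T X_plus"
    unfolding openin_inductive_limit_topology X_plus_def[symmetric]
    using W[of 1] X_plus_add by fastforce
  then have ts: "topspace ?T = X_plus"
    using openin_subset[of ?T X_plus] openin_topspace[of ?T]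
    unfolding openin_inductive_limit_topology X_plus_def[symmetric] by blast
  have "continuous_map ?T euclidean \<mu>"
    unfolding continuous_map_def ts
  proof (intro conjI allI impI)
    fix U :: "complex set" assume "openin euclidean U"
    then have U: "open U" by simp
    show "openin ?T {x \<in> X_plus. \<mu> x \<in> U}"
      unfolding openin_inductive_limit_topology X_plus_def[symmetric]
    proof (intro conjI ballI)
      fix x assume "x \<in> {x \<in> X_plus. \<mu> x \<in> U}"
      then have x: "x \<in> X_plus" "\<mu> x \<in> U" by auto
      from U x(2) obtain d where d: "d > 0" "ball (\<mu> x) d \<subseteq> U" by (meson open_contains_ball)
      have "(+) x ` {y \<in> X_plus. cmod (\<mu> y) < d} \<subseteq> {x \<in> X_plus. \<mu> x \<in> U}"
      proof clarify
        fix y assume y: "y \<in> X_plus" "cmod (\<mu> y) < d"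
        have "\<mu> (x + y) = \<mu> x + \<mu> y" using \<mu> x(1) y(1) by (simp add: antilinear_on_X_plus_def)
        then have "\<mu> (x + y) \<in> ball (\<mu> x) d" using y(2) by (simp add: dist_norm)
        then show "x + y \<in> X_plus \<and> \<mu> (x + y) \<in> U" using d(2) X_plus_add[OF x(1) y(1)] by auto
      qed
      with W[OF d(1)] show "\<exists>W. inductive_limit_nbhd X_plus_step W \<and> (+) x ` W \<subseteq> {x \<in> X_plus. \<mu> x \<in> U}" by blast
    qed auto
  qed simp
  then show ?thesis using \<mu> by (auto simp: X_plus_dual_def antilinear_on_X_plus_def)
qed

lemma L2_embed_antilinear: "antilinear_on_X_plus (L2_embed f)"
  by (simp add: antilinear_on_X_plus_def L2_embed_def X_plus_add X_plus_scaleC cinner_add_right cinner_scaleC_right)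

section \<open>Coordinates of functionals\<close>

text \<open>
  The formal double series with coefficients \<open>a\<close> in the tensors of eigenpolynomials with orthonormal
  polynomials. On each step of \<^const>\<open>X_plus\<close> only finitely many terms are nonzero.
\<close>

definition coord_functional :: "nat \<Rightarrow> (nat \<Rightarrow> nat \<Rightarrow> complex) \<Rightarrow> int L2 \<Rightarrow> complex" where
  "coord_functional M a g = (if g \<in> X_plus
     then \<Sum>j. \<Sum>i\<le>M. a i j * cinner (eigen_poly i \<otimes>\<^sub>L ortho_poly j) g else 0)"

lemma cinner_step_eq_0:
  assumes "g \<in> X_plus_step N" "N < j"
  shows "cinner (f \<otimes>\<^sub>L ortho_poly j) g = 0"
proof -
  from assms(1) obtain G where g: "g = (\<Sum>l\<le>N. G l \<otimes>\<^sub>L ortho_poly l)" by (auto simp: X_plus_step_iff)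
  show ?thesis
    unfolding g cinner_sum_right cinner_tensor cinner_ortho_poly using assms(2) by (intro sum.neutral) auto
qed

lemma coord_functional_step:
  assumes "g \<in> X_plus_step N"
  shows "coord_functional M a g = (\<Sum>j\<le>N. \<Sum>i\<le>M. a i j * cinner (eigen_poly i \<otimes>\<^sub>L ortho_poly j) g)"
proof -
  have "(\<Sum>j. \<Sum>i\<le>M. a i j * cinner (eigen_poly i \<otimes>\<^sub>L ortho_poly j) g)
      = (\<Sum>j\<le>N. \<Sum>i\<le>M. a i j * cinner (eigen_poly i \<otimes>\<^sub>L ortho_poly j) g)"
    by (rule suminf_finite) (use cinner_step_eq_0[OF assms] in \<open>auto simp: not_le intro!: sum.neutral\<close>)
  then show ?thesis using X_plus_stepI[OF assms] by (simp add: coord_functional_def)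
qed

lemma coord_functional_tensor:
  "coord_functional M a (u \<otimes>\<^sub>L ortho_poly j) = (\<Sum>i\<le>M. a i j * cinner (eigen_poly i) u)"
proof -
  have "coord_functional M a (u \<otimes>\<^sub>L ortho_poly j)
      = (\<Sum>l\<le>j. \<Sum>i\<le>M. a i l * (cinner (eigen_poly i) u * of_bool (l = j)))"
    by (simp only: coord_functional_step[OF tensor_in_X_plus_step[of j j]] cinner_tensor cinner_ortho_poly order_refl)
  also have "\<dots> = (\<Sum>l\<le>j. (\<Sum>i\<le>M. a i l * cinner (eigen_poly i) u) * of_bool (l = j))"
    by (simp only: sum_distrib_right mult.assoc)
  finally show ?thesis by (simp only: sum_mult_of_bool_eq finite_atMost) simp
qed

lemma coord_functional_antilinear: "antilinear_on_X_plus (coord_functional M a)"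
  unfolding antilinear_on_X_plus_def
proof (intro conjI ballI allI impI)
  fix x y assume "x \<in> X_plus" "y \<in> X_plus"
  then obtain N where "x \<in> X_plus_step N" "y \<in> X_plus_step N" by (rule X_plus_common_step)
  then show "coord_functional M a (x + y) = coord_functional M a x + coord_functional M a y"
    using X_plus_step_add[of x N y]
    by (simp add: coord_functional_step[of _ N] cinner_add_right distrib_left sum.distrib)
next
  fix c x assume "x \<in> X_plus"
  then obtain N where "x \<in> X_plus_step N" by (auto simp: X_plus_def)
  then show "coord_functional M a (scaleC c x) = cnj c * coord_functional M a x"
    using X_plus_step_scaleC[of x N c]
    by (simp add: coord_functional_step[of _ N] cinner_scaleC_right sum_distrib_left mult_ac)
qed (simp add: coord_functional_def)

lemma coord_functional_bounded: "\<exists>C. \<forall>g\<in>X_plus_step N. cmod (coord_functional M a g) \<le> C * norm g"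
proof (intro exI[of _ "\<Sum>j\<le>N. \<Sum>i\<le>M. cmod (a i j) * norm (eigen_poly i \<otimes>\<^sub>L ortho_poly j)"] ballI)
  fix g assume "g \<in> X_plus_step N"
  then have "cmod (coord_functional M a g) \<le> (\<Sum>j\<le>N. \<Sum>i\<le>M. cmod (a i j * cinner (eigen_poly i \<otimes>\<^sub>L ortho_poly j) g))"
    unfolding coord_functional_step[OF \<open>g \<in> X_plus_step N\<close>] by (intro sum_norm_le order_refl)
  also have "\<dots> \<le> (\<Sum>j\<le>N. \<Sum>i\<le>M. cmod (a i j) * norm (eigen_poly i \<otimes>\<^sub>L ortho_poly j) * norm g)"
    unfolding norm_mult mult.assoc by (intro sum_mono mult_left_mono cmod_cinner_le norm_ge_zero)
  finally show "cmod (coord_functional M a g)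
      \<le> (\<Sum>j\<le>N. \<Sum>i\<le>M. cmod (a i j) * norm (eigen_poly i \<otimes>\<^sub>L ortho_poly j)) * norm g"
    by (simp only: sum_distrib_right)
qed

lemma coord_functional_in_dual: "coord_functional M a \<in> X_plus_dual"
  by (rule X_plus_dualI[OF coord_functional_antilinear coord_functional_bounded])

lemma coord_functional_linear:
  "coord_functional M (\<lambda>i j. c * a i j + d * a' i j) g = c * coord_functional M a g + d * coord_functional M a' g"
proof (cases "g \<in> X_plus")
  case True
  then obtain N where N: "g \<in> X_plus_step N" by (auto simp: X_plus_def)
  show ?thesis
    by (simp add: coord_functional_step[OF N] distrib_right distrib_left sum.distrib sum_distrib_left mult_ac)
qed (simp add: coord_functional_def)

lemma coord_functional_cong:
  assumes "\<And>i j. i \<le> M \<Longrightarrow> a i j = a' i j"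
  shows "coord_functional M a = coord_functional M a'"
  unfolding coord_functional_def[abs_def] using assms by (intro ext if_cong suminf_cong sum.cong) auto

text \<open>The coefficients of an L2 vector are inner products, but \<open>coord_functional\<close>
  imposes no growth condition on its array; this leaves room for the continued resolvent and its
  residues.\<close>

lemma L2_embed_coord:
  "L2_embed (\<Sum>i\<le>M. eigen_poly i \<otimes>\<^sub>L F i) = coord_functional M (\<lambda>i j. cinner (F i) (ortho_poly j))"
proof (rule antilinear_ext[OF L2_embed_antilinear coord_functional_antilinear])
  fix u j
  show "L2_embed (\<Sum>i\<le>M. eigen_poly i \<otimes>\<^sub>L F i) (u \<otimes>\<^sub>L ortho_poly j)
      = coord_functional M (\<lambda>i j. cinner (F i) (ortho_poly j)) (u \<otimes>\<^sub>L ortho_poly j)"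
    by (simp add: L2_embed_def tensor_in_X_plus coord_functional_tensor cinner_sum_left cinner_tensor mult.commute)
qed

text \<open>The first summand comes from the average and is diagonal in i, because b_i is an
  eigenvector. The second comes from the difference and reaches i only from larger i'.\<close>

definition coord_kernel :: "real \<Rightarrow> nat \<Rightarrow> nat \<Rightarrow> nat \<Rightarrow> nat \<Rightarrow> complex" where
  "coord_kernel \<epsilon> i j i' l = of_bool (i' = i) * (cnj (cinner (avg_op (ortho_poly j)) (ortho_poly l)) / 2 ^ i)
     + of_real \<epsilon> * cnj (cinner (odd_op (ortho_poly j)) (ortho_poly l)) * odd_coeff i' i"

definition coord_op :: "real \<Rightarrow> nat \<Rightarrow> (nat \<Rightarrow> nat \<Rightarrow> complex) \<Rightarrow> nat \<Rightarrow> nat \<Rightarrow> complex" where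
  "coord_op \<epsilon> M a i j = a i j / 2 ^ (i + j) + (\<Sum>l<j. \<Sum>i'\<le>M. coord_kernel \<epsilon> i j i' l * a i' l)"

lemma cinner_eigen_U: "cinner (eigen_poly i) (U_Lplus u) = cinner (eigen_poly i) u / 2 ^ i"
proof -
  have "cinner (eigen_poly i) (U_Lplus u) = cnj (cinner u (avg_op (eigen_poly i)))"
    by (metis cinner_U_Lplus cinner_commute)
  also have "\<dots> = cinner (avg_op (eigen_poly i)) u" by (rule cinner_commute[symmetric])
  finally show ?thesis by (simp add: avg_op_eigen_poly cinner_scaleC_left)
qed

lemma cinner_eigen_sign_U:
  assumes "i \<le> M"
  shows "cinner (eigen_poly i) (sign_op (U_Lplus u)) = (\<Sum>l\<le>M. odd_coeff i l * cinner (eigen_poly l) u)"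
proof -
  have "cinner (eigen_poly i) (sign_op (U_Lplus u)) = cnj (cinner (U_Lplus u) (sign_op (eigen_poly i)))"
    by (metis cinner_sign_op cinner_commute)
  also have "\<dots> = cinner (odd_op (eigen_poly i)) u"
    unfolding odd_op_def cinner_U_Lplus by (rule cinner_commute[symmetric])
  also have "\<dots> = (\<Sum>l<i. odd_coeff i l * cinner (eigen_poly l) u)"
    using odd_coeff[of i] by (simp add: cinner_sum_left cinner_scaleC_left)
  also have "\<dots> = (\<Sum>l\<le>M. odd_coeff i l * cinner (eigen_poly l) u)"
    by (rule sum.mono_neutral_left) (use assms in \<open>auto simp: odd_coeff_eq_0\<close>)
  finally show ?thesis .
qed

lemma dual_op_antilinear:
  assumes "antilinear_on_X_plus \<mu>"
  shows "antilinear_on_X_plus (dual_op (V_eps \<epsilon>) \<mu>)"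
  using assms
  by (simp add: antilinear_on_X_plus_def dual_op_def hilbert_adjoint_V_eps V_eps_adj_add V_eps_adj_scaleC
      V_eps_adj_X_plus X_plus_add X_plus_scaleC)

lemma coord_functional_tensor_sum:
  "coord_functional M a (u \<otimes>\<^sub>L (\<Sum>l\<in>A. scaleC (c l) (ortho_poly l)))
     = (\<Sum>l\<in>A. cnj (c l) * (\<Sum>i\<le>M. a i l * cinner (eigen_poly i) u))"
  and tensor_sum_in_X_plus: "u \<otimes>\<^sub>L (\<Sum>l\<in>A. scaleC (c l) (ortho_poly l)) \<in> X_plus"
proof -
  have eq: "u \<otimes>\<^sub>L (\<Sum>l\<in>A. scaleC (c l) (ortho_poly l)) = (\<Sum>l\<in>A. scaleC (c l) (u \<otimes>\<^sub>L ortho_poly l))"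
    by (simp add: tensor_sum_right tensor_scaleC_right)
  have X: "scaleC (c l) (u \<otimes>\<^sub>L ortho_poly l) \<in> X_plus" for l by (rule X_plus_scaleC[OF tensor_in_X_plus])
  show "u \<otimes>\<^sub>L (\<Sum>l\<in>A. scaleC (c l) (ortho_poly l)) \<in> X_plus"
    unfolding eq by (rule antilinear_sum(2)[OF coord_functional_antilinear X])
  have sc: "coord_functional M a (scaleC (c l) (u \<otimes>\<^sub>L ortho_poly l)) = cnj (c l) * coord_functional M a (u \<otimes>\<^sub>L ortho_poly l)" for l
    using coord_functional_antilinear[of M a] tensor_in_X_plus by (simp add: antilinear_on_X_plus_def)
  show "coord_functional M a (u \<otimes>\<^sub>L (\<Sum>l\<in>A. scaleC (c l) (ortho_poly l)))
     = (\<Sum>l\<in>A. cnj (c l) * (\<Sum>i\<le>M. a i l * cinner (eigen_poly i) u))"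
    unfolding eq antilinear_sum(1)[OF coord_functional_antilinear X] sc coord_functional_tensor ..
qed

text \<open>Tested on u \<otimes> e_j, the adjoint acts on u by the shift and the signed shift,
  which are moved onto b_i, and on e_j by \<open>avg_op\<close> and \<open>odd_op\<close>, which are
  expanded in e_l with l \<le> j.\<close>

lemma dual_op_coord_functional:
  "dual_op (V_eps \<epsilon>) (coord_functional M a) = coord_functional M (coord_op \<epsilon> M a)"
proof (rule antilinear_ext[OF dual_op_antilinear[OF coord_functional_antilinear] coord_functional_antilinear])
  fix u j
  let ?\<Phi> = "coord_functional M a"
  let ?v = "\<lambda>l. cinner (avg_op (ortho_poly j)) (ortho_poly l)"
  let ?w = "\<lambda>l. cinner (odd_op (ortho_poly j)) (ortho_poly l)"
  let ?c = "\<lambda>i. cinner (eigen_poly i) u"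
  have add: "?\<Phi> (x + y) = ?\<Phi> x + ?\<Phi> y" if "x \<in> X_plus" "y \<in> X_plus" for x y
    using coord_functional_antilinear[of M a] that by (simp add: antilinear_on_X_plus_def)
  have sc: "?\<Phi> (scaleC c x) = cnj c * ?\<Phi> x" if "x \<in> X_plus" for x c
    using coord_functional_antilinear[of M a] that by (simp add: antilinear_on_X_plus_def)
  have e1: "U_Lplus u \<otimes>\<^sub>L avg_op (ortho_poly j) = scaleC (1 / 2 ^ j) (U_Lplus u \<otimes>\<^sub>L ortho_poly j)
      + U_Lplus u \<otimes>\<^sub>L (\<Sum>l<j. scaleC (?v l) (ortho_poly l))"
    by (subst avg_op_ortho_expand) (simp only: tensor_add_right tensor_scaleC_right)
  have p1: "?\<Phi> (U_Lplus u \<otimes>\<^sub>L avg_op (ortho_poly j))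
      = (\<Sum>i\<le>M. a i j / 2 ^ (i + j) * ?c i) + (\<Sum>l<j. \<Sum>i\<le>M. cnj (?v l) / 2 ^ i * a i l * ?c i)"
    unfolding e1 add[OF X_plus_scaleC[OF tensor_in_X_plus] tensor_sum_in_X_plus] sc[OF tensor_in_X_plus]
      coord_functional_tensor coord_functional_tensor_sum cinner_eigen_U
    by (simp add: sum_distrib_left power_add field_simps)
  have p2: "?\<Phi> (sign_op (U_Lplus u) \<otimes>\<^sub>L odd_op (ortho_poly j))
      = (\<Sum>l<j. \<Sum>i\<le>M. \<Sum>i'\<le>M. cnj (?w l) * odd_coeff i' i * a i' l * ?c i)"
  proof -
    have "?\<Phi> (sign_op (U_Lplus u) \<otimes>\<^sub>L odd_op (ortho_poly j))
        = (\<Sum>l<j. cnj (?w l) * (\<Sum>i'\<le>M. a i' l * cinner (eigen_poly i') (sign_op (U_Lplus u))))"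
      by (subst odd_op_ortho_expand) (rule coord_functional_tensor_sum)
    also have "\<dots> = (\<Sum>l<j. \<Sum>i'\<le>M. \<Sum>i\<le>M. cnj (?w l) * odd_coeff i' i * a i' l * ?c i)"
      by (intro sum.cong refl) (simp add: cinner_eigen_sign_U sum_distrib_left mult_ac)
    also have "\<dots> = (\<Sum>l<j. \<Sum>i\<le>M. \<Sum>i'\<le>M. cnj (?w l) * odd_coeff i' i * a i' l * ?c i)"
      by (intro sum.cong refl sum.swap)
    finally show ?thesis .
  qed
  have X1: "U_Lplus u \<otimes>\<^sub>L avg_op (ortho_poly j) \<in> X_plus"
    unfolding e1 by (rule X_plus_add[OF X_plus_scaleC[OF tensor_in_X_plus] tensor_sum_in_X_plus])
  have X2: "sign_op (U_Lplus u) \<otimes>\<^sub>L odd_op (ortho_poly j) \<in> X_plus"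
    by (subst odd_op_ortho_expand) (rule tensor_sum_in_X_plus)
  have "dual_op (V_eps \<epsilon>) ?\<Phi> (u \<otimes>\<^sub>L ortho_poly j)
      = ?\<Phi> (U_Lplus u \<otimes>\<^sub>L avg_op (ortho_poly j)) + of_real \<epsilon> * ?\<Phi> (sign_op (U_Lplus u) \<otimes>\<^sub>L odd_op (ortho_poly j))"
    by (simp add: dual_op_def tensor_in_X_plus hilbert_adjoint_V_eps V_eps_adj_tensor odd_op_def[symmetric]
        add[OF X1 X_plus_scaleC[OF X2]] sc[OF X2])
  also have "\<dots> = (\<Sum>i\<le>M. a i j / 2 ^ (i + j) * ?c i)
     + (\<Sum>l<j. \<Sum>i\<le>M. cnj (?v l) / 2 ^ i * a i l * ?c i
        + of_real \<epsilon> * (\<Sum>i'\<le>M. cnj (?w l) * odd_coeff i' i * a i' l * ?c i))"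
    unfolding p1 p2 by (simp only: sum_distrib_left sum.distrib add.assoc)
  also have "\<dots> = (\<Sum>i\<le>M. a i j / 2 ^ (i + j) * ?c i)
     + (\<Sum>l<j. \<Sum>i\<le>M. (\<Sum>i'\<le>M. coord_kernel \<epsilon> i j i' l * a i' l) * ?c i)"
  proof (intro arg_cong2[where f = "(+)"] sum.cong refl)
    fix l i assume i: "i \<in> {..M}"
    have "(\<Sum>i'\<le>M. coord_kernel \<epsilon> i j i' l * a i' l)
        = (\<Sum>i'\<le>M. (cnj (?v l) / 2 ^ i * a i' l) * of_bool (i' = i) + of_real \<epsilon> * (cnj (?w l) * odd_coeff i' i * a i' l))"
      by (intro sum.cong refl) (simp add: coord_kernel_def algebra_simps)
    also have "\<dots> = cnj (?v l) / 2 ^ i * a i l + of_real \<epsilon> * (\<Sum>i'\<le>M. cnj (?w l) * odd_coeff i' i * a i' l)"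
      unfolding sum.distrib sum_mult_of_bool_eq[OF finite_atMost] sum_distrib_left using i by simp
    finally show "cnj (?v l) / 2 ^ i * a i l * ?c i
        + of_real \<epsilon> * (\<Sum>i'\<le>M. cnj (?w l) * odd_coeff i' i * a i' l * ?c i)
        = (\<Sum>i'\<le>M. coord_kernel \<epsilon> i j i' l * a i' l) * ?c i"
      by (simp add: distrib_right sum_distrib_right sum_distrib_left mult.assoc)
  qed
  also have "\<dots> = coord_functional M (coord_op \<epsilon> M a) (u \<otimes>\<^sub>L ortho_poly j)"
    unfolding coord_functional_tensor coord_op_def
    by (subst sum.swap) (simp add: distrib_right sum.distrib sum_distrib_right)
  finally show "dual_op (V_eps \<epsilon>) ?\<Phi> (u \<otimes>\<^sub>L ortho_poly j)
      = coord_functional M (coord_op \<epsilon> M a) (u \<otimes>\<^sub>L ortho_poly j)" .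
qed

section \<open>The resolvent in coordinates\<close>

text \<open>Forward substitution in j for z r - \<open>coord_op\<close> r = a. At a zero of the
  divisor the quotient is 0 by convention, and the resolvent equation is claimed only
  elsewhere.\<close>

function coord_resolvent ::
  "real \<Rightarrow> nat \<Rightarrow> (nat \<Rightarrow> nat \<Rightarrow> complex) \<Rightarrow> complex \<Rightarrow> nat \<Rightarrow> nat \<Rightarrow> complex" where
  "coord_resolvent \<epsilon> M a z i j =
     (a i j + (\<Sum>l<j. \<Sum>i'\<le>M. coord_kernel \<epsilon> i j i' l * coord_resolvent \<epsilon> M a z i' l)) / (z - 1 / 2 ^ (i + j))"
  by pat_completeness auto
termination by (relation "Wellfounded.measure (\<lambda>(\<epsilon>, M, a, z, i, j). j)") auto

declare coord_resolvent.simps [simp del]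

lemma coord_op_resolvent:
  assumes "z \<noteq> 1 / 2 ^ (i + j)"
  shows "coord_op \<epsilon> M (coord_resolvent \<epsilon> M a z) i j = z * coord_resolvent \<epsilon> M a z i j - a i j"
proof -
  let ?s = "\<Sum>l<j. \<Sum>i'\<le>M. coord_kernel \<epsilon> i j i' l * coord_resolvent \<epsilon> M a z i' l"
  have "(z - 1 / 2 ^ (i + j)) * coord_resolvent \<epsilon> M a z i j = a i j + ?s"
    using assms by (subst coord_resolvent.simps) simp
  then have "a i j = (z - 1 / 2 ^ (i + j)) * coord_resolvent \<epsilon> M a z i j - ?s" by (simp only: add_diff_cancel)
  then show ?thesis by (simp add: coord_op_def left_diff_distrib)
qed

lemma antilinear_eq_0_of_expanding:
  assumes D: "antilinear_on_X_plus D" and bd: "\<And>N. \<exists>C. \<forall>g\<in>X_plus_step N. cmod (D g) \<le> C * norm g"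
    and \<epsilon>: "0 \<le> \<epsilon>" "\<epsilon> \<le> 1" and z: "cmod z > 1"
    and eig: "\<And>g. g \<in> X_plus \<Longrightarrow> D (V_eps_adj \<epsilon> g) = z * D g"
  shows "D g = 0"
proof (cases "g \<in> X_plus")
  case True
  then obtain N where N: "g \<in> X_plus_step N" by (auto simp: X_plus_def)
  from bd obtain C where C: "\<And>g. g \<in> X_plus_step N \<Longrightarrow> cmod (D g) \<le> C * norm g" by blast
  \<comment> \<open>All iterates stay in the step N, so the single constant C bounds D on each of
    them.\<close>
  have it: "(V_eps_adj \<epsilon> ^^ n) g \<in> X_plus_step N \<and> norm ((V_eps_adj \<epsilon> ^^ n) g) \<le> norm g
      \<and> D ((V_eps_adj \<epsilon> ^^ n) g) = z ^ n * D g" for n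
  proof (induction n)
    case (Suc n)
    then show ?case
      using norm_V_eps_adj[OF \<epsilon>, of "(V_eps_adj \<epsilon> ^^ n) g"]
      by (auto simp: V_eps_adj_step eig X_plus_stepI intro: order_trans)
  qed (simp add: N)
  have b: "cmod z ^ n * cmod (D g) \<le> \<bar>C\<bar> * norm g" for n
  proof -
    have "cmod z ^ n * cmod (D g) = cmod (D ((V_eps_adj \<epsilon> ^^ n) g))" using it[of n] by (simp add: norm_mult norm_power)
    also have "\<dots> \<le> C * norm ((V_eps_adj \<epsilon> ^^ n) g)" using C it by blast
    also have "\<dots> \<le> \<bar>C\<bar> * norm g" using it[of n] by (intro mult_mono) auto
    finally show ?thesis .
  qed
  show ?thesis
  proof (rule ccontr)
    assume "D g \<noteq> 0"
    then have pos: "cmod (D g) > 0" by simp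
    from real_arch_pow[OF z] obtain n where "\<bar>C\<bar> * norm g / cmod (D g) < cmod z ^ n" by blast
    with b[of n] pos show False by (simp add: pos_divide_less_eq)
  qed
qed (use D in \<open>simp add: antilinear_on_X_plus_def\<close>)

lemma L2_embed_bounded: "cmod (L2_embed x g) \<le> norm x * norm g"
  by (simp add: L2_embed_def cmod_cinner_le)

text \<open>Both sides solve the same inhomogeneous equation; their difference solves the
  homogeneous one and is bounded on each step, hence vanishes by
  \<open>antilinear_eq_0_of_expanding\<close>.\<close>

lemma L2_embed_resolvent:
  assumes \<epsilon>: "0 \<le> \<epsilon>" "\<epsilon> \<le> 1" and z: "cmod z > 1"
    and f: "L2_embed f = coord_functional M a"
  shows "L2_embed (inv (shifted (V_eps \<epsilon>) z) f) = coord_functional M (coord_resolvent \<epsilon> M a z)"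
proof -
  define x where "x = inv (shifted (V_eps \<epsilon>) z) f"
  let ?r = "coord_resolvent \<epsilon> M a z"
  have "shifted (V_eps \<epsilon>) z x = f"
    unfolding x_def by (rule surj_f_inv_f[OF bij_is_surj[OF bij_shifted_V_eps[OF \<epsilon> z]]])
  then have Vx: "V_eps \<epsilon> x = scaleC z x - f" by (auto simp: shifted_def)
  define D where "D g = L2_embed x g - coord_functional M ?r g" for g
  have "D g = 0" for g
  proof (rule antilinear_eq_0_of_expanding[OF _ _ \<epsilon> z])
    show "antilinear_on_X_plus D"
      using L2_embed_antilinear[of x] coord_functional_antilinear[of M ?r]
      by (simp add: antilinear_on_X_plus_def D_def algebra_simps)
    fix N
    from coord_functional_bounded obtain C where C: "\<forall>g\<in>X_plus_step N. cmod (coord_functional M ?r g) \<le> C * norm g" by blast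
    have "cmod (D g) \<le> (norm x + C) * norm g" if "g \<in> X_plus_step N" for g
    proof -
      have "cmod (D g) \<le> cmod (L2_embed x g) + cmod (coord_functional M ?r g)"
        unfolding D_def by (rule norm_triangle_ineq4)
      also have "\<dots> \<le> norm x * norm g + C * norm g" using C that L2_embed_bounded[of x g] by (intro add_mono) auto
      finally show ?thesis by (simp add: distrib_right)
    qed
    then show "\<exists>C. \<forall>g\<in>X_plus_step N. cmod (D g) \<le> C * norm g" by blast
  next
    fix g assume g: "g \<in> X_plus"
    have h1: "L2_embed x (V_eps_adj \<epsilon> g) = z * L2_embed x g - L2_embed f g"
      using g by (simp add: L2_embed_def V_eps_adj_X_plus Vx cinner_diff_left cinner_scaleC_left flip: cinner_V_eps)
    have h2: "coord_functional M ?r (V_eps_adj \<epsilon> g) = dual_op (V_eps \<epsilon>) (coord_functional M ?r) g"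
      using g by (simp add: dual_op_def hilbert_adjoint_V_eps)
    have h3: "dual_op (V_eps \<epsilon>) (coord_functional M ?r) g = z * coord_functional M ?r g - L2_embed f g"
    proof -
      have "z \<noteq> 1 / 2 ^ n" for n
      proof
        assume "z = 1 / 2 ^ n"
        then have "cmod z = 1 / 2 ^ n" by (simp add: norm_divide norm_power)
        also have "\<dots> \<le> 1" by simp
        finally show False using z by simp
      qed
      then have "coord_op \<epsilon> M ?r i j = z * ?r i j + (- 1) * a i j" for i j
        by (simp add: coord_op_resolvent)
      then have "coord_op \<epsilon> M ?r = (\<lambda>i j. z * ?r i j + (- 1) * a i j)" by (intro ext)
      then show ?thesis
        unfolding dual_op_coord_functional f by (simp only: coord_functional_linear) simp
    qed
    show "D (V_eps_adj \<epsilon> g) = z * D g" unfolding D_def h1 h2 h3 right_diff_distrib by simp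
  qed
  then show ?thesis unfolding x_def[symmetric] by (auto simp: D_def fun_eq_iff)
qed

section \<open>The generalized resolvent\<close>

text \<open>The point 0 is the limit of the powers and closes the set; not being isolated, it yields
  no eigenvalue.\<close>

definition singular_set :: "complex set" where
  "singular_set = insert 0 (range (\<lambda>k. 1 / 2 ^ k))"

lemma half_power_in_singular_set [simp]: "1 / 2 ^ k \<in> singular_set"
  by (auto simp: singular_set_def)

lemma half_powers_tendsto: "(\<lambda>k. 1 / (2 :: complex) ^ k) \<longlonglongrightarrow> 0"
  using LIMSEQ_power_zero[of "1 / 2 :: complex"] by (simp add: power_divide norm_divide)

lemma closed_singular_set: "closed singular_set"
  unfolding singular_set_def
  by (intro compact_imp_closed compact_sequence_with_limit half_powers_tendsto)

lemma countable_singular_set: "countable singular_set"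
  by (simp add: singular_set_def)

lemma singular_set_subset: "singular_set \<subseteq> cball 0 1"
  by (auto simp: singular_set_def norm_divide norm_power)

lemma connected_compl_singular_set: "connected (- singular_set)"
  using connected_open_diff_countable[of "UNIV :: complex set" singular_set] countable_singular_set
  by (simp add: Compl_eq_Diff_UNIV connected_UNIV)

text \<open>The nearest other power is 2^-(k+1), at exactly this distance; for m < k the distance is
  at least 2^-k.\<close>

lemma half_power_gap:
  assumes "m \<noteq> k"
  shows "1 / 2 ^ Suc k \<le> \<bar>1 / 2 ^ m - 1 / 2 ^ k :: real\<bar>"
proof (cases "m < k")
  case True
  then have "(2::real) ^ Suc m \<le> 2 ^ k" by (intro power_increasing) auto
  then have "1 / 2 ^ k \<le> 1 / (2::real) ^ Suc m" by (intro divide_left_mono) auto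
  then show ?thesis by simp
next
  case False
  with assms have "Suc k \<le> m" by simp
  then have "(2::real) ^ Suc k \<le> 2 ^ m" by (intro power_increasing) auto
  then have "1 / 2 ^ m \<le> 1 / (2::real) ^ Suc k" by (intro divide_left_mono) auto
  then show ?thesis by simp
qed

lemma singular_set_gap:
  assumes "s \<in> singular_set" "s \<noteq> 1 / 2 ^ k"
  shows "1 / 2 ^ Suc k \<le> dist (1 / 2 ^ k) s"
proof (cases "s = 0")
  case True
  then show ?thesis by (simp add: norm_divide norm_power divide_simps)
next
  case False
  with assms obtain m where m: "s = 1 / 2 ^ m" "m \<noteq> k" by (auto simp: singular_set_def)
  have "dist (1 / 2 ^ k) s = cmod (complex_of_real (1 / 2 ^ m - 1 / 2 ^ k))"
    unfolding m(1) dist_norm by (simp add: norm_minus_commute)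
  then show ?thesis using half_power_gap[OF m(2)] by (simp only: norm_of_real)
qed

lemma closed_singular_set_remove: "closed (singular_set - {1 / 2 ^ k})"
proof -
  have "singular_set - {1 / 2 ^ k} = singular_set - ball (1 / 2 ^ k) (1 / 2 ^ Suc k)"
    using singular_set_gap[of _ k] by (force simp: not_less)
  then show ?thesis using closed_singular_set by (simp only: closed_Diff open_ball)
qed

lemma isolated_in_singular_set_iff: "z isolated_in singular_set \<longleftrightarrow> (\<exists>k. z = 1 / 2 ^ k)"
proof
  assume "z isolated_in singular_set"
  then obtain T where T: "z \<in> singular_set" "open T" "T \<inter> singular_set = {z}" by (auto simp: isolated_in_def)
  show "\<exists>k. z = 1 / 2 ^ k"
  proof (cases "z = 0")
    case True
    then have "0 \<in> T" using T by blast
    with half_powers_tendsto T(2) have "\<forall>\<^sub>F k in sequentially. 1 / 2 ^ k \<in> T"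
      by (rule topological_tendstoD)
    then obtain k where "1 / 2 ^ k \<in> T" by (auto simp: eventually_sequentially)
    then have "1 / 2 ^ k \<in> T \<inter> singular_set" by simp
    then show ?thesis unfolding T(3) by auto
  qed (use T in \<open>auto simp: singular_set_def\<close>)
next
  assume "\<exists>k. z = 1 / 2 ^ k"
  then obtain k where k: "z = 1 / 2 ^ k" ..
  have "open (- (singular_set - {1 / 2 ^ k}))" by (simp only: open_Compl closed_singular_set_remove)
  moreover have "- (singular_set - {1 / 2 ^ k}) \<inter> singular_set = {z}" by (auto simp: k)
  ultimately show "z isolated_in singular_set" unfolding isolated_in_def by (auto simp: k)
qed

lemma coord_resolvent_holomorphic: "(\<lambda>z. coord_resolvent \<epsilon> M a z i j) holomorphic_on - singular_set"
proof (induction j arbitrary: i rule: less_induct)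
  case (less j)
  have "(\<lambda>z. (a i j + (\<Sum>l<j. \<Sum>i'\<le>M. coord_kernel \<epsilon> i j i' l * coord_resolvent \<epsilon> M a z i' l)) / (z - 1 / 2 ^ (i + j)))
      holomorphic_on - singular_set"
  proof (intro holomorphic_intros less)
    show "z - 1 / 2 ^ (i + j) \<noteq> 0" if "z \<in> - singular_set" for z
      using that half_power_in_singular_set[of "i + j"] by auto
  qed auto
  then show ?case by (subst (asm) coord_resolvent.simps[symmetric])
qed

lemma coord_functional_holomorphic:
  "(\<lambda>z. coord_functional M (coord_resolvent \<epsilon> M a z) g) holomorphic_on - singular_set"
proof (cases "g \<in> X_plus")
  case True
  then obtain N where N: "g \<in> X_plus_step N" by (auto simp: X_plus_def)
  show ?thesis
    unfolding coord_functional_step[OF N] by (intro holomorphic_intros coord_resolvent_holomorphic)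
qed (simp add: coord_functional_def)

lemma X_minus_coord:
  assumes "f \<in> X_minus"
  shows "\<exists>M a. L2_embed f = coord_functional M a"
proof -
  from assms obtain M where "f \<in> X_minus_step M" by (auto simp: X_minus_def)
  from X_minus_step_expand[OF this] L2_embed_coord show ?thesis by metis
qed

text \<open>The coordinates of f are chosen arbitrarily. That the result does not depend on them is
  \<open>continued_resolvent_eq\<close>.\<close>

definition continued_resolvent :: "real \<Rightarrow> complex \<Rightarrow> int L2 \<Rightarrow> int L2 \<Rightarrow> complex" where
  "continued_resolvent \<epsilon> z f = (let (M, a) = SOME (M, a). L2_embed f = coord_functional M a
     in coord_functional M (coord_resolvent \<epsilon> M a z))"

lemma continued_resolvent_some:
  assumes "f \<in> X_minus"
  obtains M a where "L2_embed f = coord_functional M a"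
    "\<And>z. continued_resolvent \<epsilon> z f = coord_functional M (coord_resolvent \<epsilon> M a z)"
proof -
  obtain M a where Ma: "(SOME (M, a). L2_embed f = coord_functional M a) = (M, a)" by (meson surj_pair)
  from X_minus_coord[OF assms] have "\<exists>p. case p of (M, a) \<Rightarrow> L2_embed f = coord_functional M a" by auto
  from someI_ex[OF this] have "L2_embed f = coord_functional M a" unfolding Ma by simp
  moreover have "continued_resolvent \<epsilon> z f = coord_functional M (coord_resolvent \<epsilon> M a z)" for z
    unfolding continued_resolvent_def Ma by simp
  ultimately show ?thesis by (rule that)
qed

lemma holomorphic_eq_of_eq_near_infinity:
  assumes T: "closed T" "connected (- T)" "T \<subseteq> cball 0 s"
    and F: "F holomorphic_on - T" and G: "G holomorphic_on - T"
    and eq: "\<And>z. cmod z > r \<Longrightarrow> F z = G z" and z: "z \<notin> T"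
  shows "F z = G z"
proof -
  define U where "U = {z. cmod z > max r s}"
  have "open U" unfolding U_def by (intro open_Collect_less continuous_intros)
  have UT: "U \<subseteq> - T" using T(3) by (auto simp: U_def)
  \<comment> \<open>A real point beyond both radii, where F and G agree on a neighbourhood.\<close>
  define \<xi> where "\<xi> = complex_of_real (\<bar>r\<bar> + \<bar>s\<bar> + 1)"
  have \<xi>: "\<xi> \<in> U" unfolding \<xi>_def U_def mem_Collect_eq norm_of_real by linarith
  have "(\<lambda>z. F z - G z) z = 0"
  proof (rule analytic_continuation[where f = "\<lambda>z. F z - G z" and \<xi> = \<xi> and U = U])
    show "(\<lambda>z. F z - G z) holomorphic_on - T" using F G by (rule holomorphic_on_diff)
    show "\<xi> islimpt U" using \<open>open U\<close> \<xi> by (simp add: interior_limit_point interior_open)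
    show "F z - G z = 0" if "z \<in> U" for z using eq[of z] that by (simp add: U_def)
  qed (use T UT \<xi> z in auto)
  then show ?thesis by simp
qed

text \<open>Any two coordinate arrays of f give the Hilbert space resolvent for |z| > 1, and the
  identity theorem carries the equality to the whole connected complement.\<close>

lemma continued_resolvent_eq:
  assumes \<epsilon>: "0 \<le> \<epsilon>" "\<epsilon> \<le> 1" and f: "f \<in> X_minus" "L2_embed f = coord_functional M a" and z: "z \<notin> singular_set"
  shows "continued_resolvent \<epsilon> z f = coord_functional M (coord_resolvent \<epsilon> M a z)"
proof (rule ext)
  fix g
  obtain M' a' where *: "L2_embed f = coord_functional M' a'"
    "\<And>z. continued_resolvent \<epsilon> z f = coord_functional M' (coord_resolvent \<epsilon> M' a' z)"
    using continued_resolvent_some[OF f(1)] by metis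
  have eq: "coord_functional M' (coord_resolvent \<epsilon> M' a' w) g = coord_functional M (coord_resolvent \<epsilon> M a w) g"
    if "cmod w > 1" for w
    using L2_embed_resolvent[OF \<epsilon> that *(1)] L2_embed_resolvent[OF \<epsilon> that f(2)] by simp
  have "coord_functional M' (coord_resolvent \<epsilon> M' a' z) g = coord_functional M (coord_resolvent \<epsilon> M a z) g"
    by (rule holomorphic_eq_of_eq_near_infinity[OF closed_singular_set connected_compl_singular_set singular_set_subset
        coord_functional_holomorphic[of M' \<epsilon> a' g] coord_functional_holomorphic[of M \<epsilon> a g] eq z])
  then show "continued_resolvent \<epsilon> z f g = coord_functional M (coord_resolvent \<epsilon> M a z) g" by (simp add: *(2))
qed

lemma weakly_analytic_continued_resolvent: "weakly_analytic_on (continued_resolvent \<epsilon>) (- singular_set)"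
  unfolding weakly_analytic_on_def
proof (intro ballI conjI)
  fix f assume "f \<in> X_minus"
  then obtain M a where *: "\<And>z. continued_resolvent \<epsilon> z f = coord_functional M (coord_resolvent \<epsilon> M a z)"
    using continued_resolvent_some by metis
  show "continued_resolvent \<epsilon> z f \<in> X_plus_dual" for z by (simp add: * coord_functional_in_dual)
  show "(\<lambda>z. continued_resolvent \<epsilon> z f g) holomorphic_on - singular_set" for g
    unfolding * by (rule coord_functional_holomorphic)
qed

section \<open>Genuine poles at the powers of 1/2\<close>

lemma L2_embed_eigen_ortho:
  "L2_embed (eigen_poly k \<otimes>\<^sub>L ortho_poly n) = coord_functional k (\<lambda>i j. of_bool (i = k \<and> j = n))"
proof -
  have "(\<Sum>i\<le>k. eigen_poly i \<otimes>\<^sub>L (if i = k then ortho_poly n else 0)) = (\<Sum>i\<in>{k}. eigen_poly i \<otimes>\<^sub>L (if i = k then ortho_poly n else 0))"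
    by (rule sum.mono_neutral_right) auto
  then have eq: "eigen_poly k \<otimes>\<^sub>L ortho_poly n = (\<Sum>i\<le>k. eigen_poly i \<otimes>\<^sub>L (if i = k then ortho_poly n else 0))" by simp
  show ?thesis
    unfolding eq L2_embed_coord by (rule coord_functional_cong) (auto simp: cinner_ortho_poly)
qed

lemma eigen_ortho_in_X_minus: "eigen_poly k \<otimes>\<^sub>L ortho_poly n \<in> X_minus"
proof -
  have "eigen_poly k \<in> poly_space k" unfolding poly_space_eq by (rule eigen_in_low_degree) simp
  then have "eigen_poly k \<otimes>\<^sub>L ortho_poly n \<in> X_minus_step k"
    unfolding X_minus_step_def by (intro L2.span_base) blast
  then show ?thesis by (auto simp: X_minus_def)
qed

text \<open>With a source at (k, n) all entries with j < n are zero, so the recursion contributes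
  nothing up to j = n and only the source divided by its own denominator remains.\<close>

lemma coord_resolvent_single_low:
  assumes "j \<le> n"
  shows "coord_resolvent \<epsilon> M (\<lambda>i j. of_bool (i = k \<and> j = n)) z i j = of_bool (i = k \<and> j = n) / (z - 1 / 2 ^ (i + j))"
  using assms
proof (induction j arbitrary: i rule: less_induct)
  case (less j)
  have "coord_resolvent \<epsilon> M (\<lambda>i j. of_bool (i = k \<and> j = n)) z i' l = 0" if "l < j" for i' l
    using less.IH[OF that, of i'] that less.prems by simp
  then show ?case by (subst coord_resolvent.simps) simp
qed

text \<open>At j = 0 there is no coupling, so the source (k, 0) shows a simple pole at 2^-k with
  nonzero residue.\<close>

lemma continued_resolvent_pole:
  assumes \<epsilon>: "0 \<le> \<epsilon>" "\<epsilon> \<le> 1" and z: "z \<notin> singular_set"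
  shows "continued_resolvent \<epsilon> z (eigen_poly k \<otimes>\<^sub>L ortho_poly 0) (ortho_poly k \<otimes>\<^sub>L ortho_poly 0)
    = cinner (eigen_poly k) (ortho_poly k) / (z - 1 / 2 ^ k)"
proof -
  have "continued_resolvent \<epsilon> z (eigen_poly k \<otimes>\<^sub>L ortho_poly 0) (ortho_poly k \<otimes>\<^sub>L ortho_poly 0)
     = (\<Sum>i\<le>k. cinner (eigen_poly i) (ortho_poly k) / (z - 1 / 2 ^ i) * of_bool (i = k))"
    unfolding continued_resolvent_eq[OF \<epsilon> eigen_ortho_in_X_minus L2_embed_eigen_ortho z] coord_functional_tensor
    by (intro sum.cong refl) (simp add: coord_resolvent_single_low)
  then show ?thesis by (simp only: sum_mult_of_bool_eq finite_atMost) simp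
qed

lemma no_holomorphic_extension_at_pole:
  fixes p c :: complex
  assumes h: "h holomorphic_on B" "open B" "p \<in> B" and S: "open A" "p \<in> A"
    and eq: "\<And>z. z \<in> A \<inter> B - {p} \<Longrightarrow> h z = c / (z - p)" and c: "c \<noteq> 0"
  shows False
proof -
  have "isCont h p" using h by (metis continuous_on_eq_continuous_at holomorphic_on_imp_continuous_on)
  then have "(\<lambda>z. (z - p) * h z) \<midarrow>p\<rightarrow> (p - p) * h p"
    by (intro tendsto_intros) (simp add: isCont_def)
  moreover have "\<forall>\<^sub>F z in at p. z \<in> A \<inter> B - {p}"
    by (rule eventually_at_in_open) (use h S in auto)
  then have "\<forall>\<^sub>F z in at p. (z - p) * h z = c" by eventually_elim (use eq in auto)
  ultimately have "(\<lambda>z. c) \<midarrow>p\<rightarrow> 0" by (simp add: filterlim_cong)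
  then show False using c by (simp add: tendsto_const_iff)
qed

lemma continued_resolvent_not_extendable:
  assumes \<epsilon>: "0 \<le> \<epsilon>" "\<epsilon> \<le> 1" and z0: "z\<^sub>0 \<in> singular_set"
  shows "\<not> (\<exists>\<delta>>0. \<exists>R'. weakly_analytic_on R' (ball z\<^sub>0 \<delta>) \<and>
        (\<forall>f\<in>X_minus. \<forall>z\<in>ball z\<^sub>0 \<delta> - singular_set. R' z f = continued_resolvent \<epsilon> z f))"
proof
  assume "\<exists>\<delta>>0. \<exists>R'. weakly_analytic_on R' (ball z\<^sub>0 \<delta>) \<and>
        (\<forall>f\<in>X_minus. \<forall>z\<in>ball z\<^sub>0 \<delta> - singular_set. R' z f = continued_resolvent \<epsilon> z f)"
  then obtain \<delta> R' where \<delta>: "\<delta> > 0" and R': "weakly_analytic_on R' (ball z\<^sub>0 \<delta>)"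
    "\<And>f z. f \<in> X_minus \<Longrightarrow> z \<in> ball z\<^sub>0 \<delta> - singular_set \<Longrightarrow> R' z f = continued_resolvent \<epsilon> z f" by metis
  \<comment> \<open>At 0 the obstruction to an extension is a nearby pole 2^-k inside the
    ball.\<close>
  have "\<exists>k. 1 / 2 ^ k \<in> ball z\<^sub>0 \<delta>"
  proof (cases "z\<^sub>0 = 0")
    case True
    have "\<forall>\<^sub>F k in sequentially. 1 / 2 ^ k \<in> ball (0 :: complex) \<delta>"
      using \<delta> by (intro topological_tendstoD[OF half_powers_tendsto]) auto
    then show ?thesis unfolding True by (auto simp: eventually_sequentially)
  next
    case False
    then obtain k where "z\<^sub>0 = 1 / 2 ^ k" using z0 by (auto simp: singular_set_def)
    then show ?thesis using \<delta> by (intro exI[of _ k]) simp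
  qed
  then obtain k where k: "1 / 2 ^ k \<in> ball z\<^sub>0 \<delta>" ..
  define h where "h z = R' z (eigen_poly k \<otimes>\<^sub>L ortho_poly 0) (ortho_poly k \<otimes>\<^sub>L ortho_poly 0)" for z
  have h: "h holomorphic_on ball z\<^sub>0 \<delta>"
    using R'(1) eigen_ortho_in_X_minus tensor_in_X_plus unfolding weakly_analytic_on_def h_def by blast
  show False
  proof (rule no_holomorphic_extension_at_pole[OF h open_ball k, of "- (singular_set - {1 / 2 ^ k})"])
    show "open (- (singular_set - {1 / 2 ^ k}))" by (simp only: open_Compl closed_singular_set_remove)
    show "cinner (eigen_poly k) (ortho_poly k) \<noteq> 0" by (rule cinner_eigen_ortho)
    fix z assume "z \<in> - (singular_set - {1 / 2 ^ k}) \<inter> ball z\<^sub>0 \<delta> - {1 / 2 ^ k}"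
    then have z: "z \<in> ball z\<^sub>0 \<delta> - singular_set" by auto
    then show "h z = cinner (eigen_poly k) (ortho_poly k) / (z - 1 / 2 ^ k)"
      using R'(2)[OF eigen_ortho_in_X_minus z] continued_resolvent_pole[OF \<epsilon>, of z k] by (simp add: h_def)
  qed simp
qed

section \<open>Existence and uniqueness of the generalized resolvent\<close>

lemma generalized_resolvent_continued:
  assumes \<epsilon>: "0 \<le> \<epsilon>" "\<epsilon> \<le> 1"
  shows "generalized_resolvent (V_eps \<epsilon>) singular_set (continued_resolvent \<epsilon>)"
  unfolding generalized_resolvent_def
proof (intro conjI closed_singular_set singular_set_subset connected_compl_singular_set
    weakly_analytic_continued_resolvent ballI continued_resolvent_not_extendable[OF \<epsilon>])
  show "\<exists>r\<ge>1. \<forall>z. cmod z > r \<longrightarrow> bij (shifted (V_eps \<epsilon>) z) \<and>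
        (\<forall>f\<in>X_minus. continued_resolvent \<epsilon> z f = L2_embed (inv (shifted (V_eps \<epsilon>) z) f))"
  proof (intro exI[of _ "1 :: real"] conjI allI impI ballI order_refl)
    fix z :: complex assume z: "cmod z > 1"
    then show "bij (shifted (V_eps \<epsilon>) z)" by (rule bij_shifted_V_eps[OF \<epsilon>])
    fix f assume "f \<in> X_minus"
    then obtain M a where *: "L2_embed f = coord_functional M a"
        "\<And>z. continued_resolvent \<epsilon> z f = coord_functional M (coord_resolvent \<epsilon> M a z)"
      using continued_resolvent_some by metis
    show "continued_resolvent \<epsilon> z f = L2_embed (inv (shifted (V_eps \<epsilon>) z) f)"
      unfolding *(2) L2_embed_resolvent[OF \<epsilon> z *(1)] ..
  qed
qed

text \<open>The identity theorem needs a connected common domain. The complement of S is connected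
  and open by definition, and removing a countable closed set from it keeps it connected.\<close>

lemma generalized_resolvent_agree:
  assumes R: "generalized_resolvent T S R" and R': "generalized_resolvent T S' R'" and cS': "countable S'"
    and f: "f \<in> X_minus" and z: "z \<notin> S" "z \<notin> S'"
  shows "R z f = R' z f"
proof
  fix g
  have dual: "R z f \<in> X_plus_dual" "R' z f \<in> X_plus_dual"
    using R R' f z unfolding generalized_resolvent_def weakly_analytic_on_def by auto
  show "R z f g = R' z f g"
  proof (cases "g \<in> X_plus")
    case True
    obtain r where r: "\<And>z. cmod z > r \<Longrightarrow> R z f = L2_embed (inv (shifted T z) f)"
      using R f unfolding generalized_resolvent_def by blast
    obtain r' where r': "\<And>z. cmod z > r' \<Longrightarrow> R' z f = L2_embed (inv (shifted T z) f)"
      using R' f unfolding generalized_resolvent_def by blast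
    have hol: "(\<lambda>z. R z f g) holomorphic_on - S" "(\<lambda>z. R' z f g) holomorphic_on - S'"
      using R R' f True unfolding generalized_resolvent_def weakly_analytic_on_def by auto
    have S: "closed S" "connected (- S)" "S \<subseteq> cball 0 1" "closed S'" "S' \<subseteq> cball 0 1"
      using R R' unfolding generalized_resolvent_def by auto
    have "closed (S \<union> S')" "S \<union> S' \<subseteq> cball 0 1" using S by auto
    moreover have "connected (- (S \<union> S'))"
      using connected_open_diff_countable[of "- S" S'] S cS' by (simp add: open_Compl Diff_eq)
    moreover have "(\<lambda>z. R z f g) holomorphic_on - (S \<union> S')" "(\<lambda>z. R' z f g) holomorphic_on - (S \<union> S')"
      using hol by (auto elim: holomorphic_on_subset)
    moreover have "R w f g = R' w f g" if "cmod w > max r r'" for w using r[of w] r'[of w] that by simp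
    ultimately show ?thesis
      using z holomorphic_eq_of_eq_near_infinity[of "S \<union> S'" 1 "\<lambda>z. R z f g" "\<lambda>z. R' z f g" "max r r'" z] by blast
  qed (use X_plus_dual_antilinear[OF dual(1)] X_plus_dual_antilinear[OF dual(2)] in
      \<open>simp add: antilinear_on_X_plus_def\<close>)
qed

text \<open>At a point of S outside S', the function R' itself would be the extension that the
  definition of S forbids.\<close>

lemma generalized_resolvent_singularity_subset:
  assumes R: "generalized_resolvent T S R" and R': "generalized_resolvent T S' R'"
    and agree: "\<And>f z. f \<in> X_minus \<Longrightarrow> z \<notin> S \<Longrightarrow> z \<notin> S' \<Longrightarrow> R z f = R' z f"
  shows "S \<subseteq> S'"
proof
  fix z0 assume z0: "z0 \<in> S"
  show "z0 \<in> S'"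
  proof (rule ccontr)
    assume "z0 \<notin> S'"
    moreover have "open (- S')" using R' by (auto simp: generalized_resolvent_def)
    ultimately obtain \<delta> where \<delta>: "\<delta> > 0" "ball z0 \<delta> \<subseteq> - S'" by (meson ComplI open_contains_ball)
    have "weakly_analytic_on R' (ball z0 \<delta>)"
      using R' \<delta>(2) unfolding generalized_resolvent_def weakly_analytic_on_def
      by (meson holomorphic_on_subset subsetD)
    moreover have "\<forall>f\<in>X_minus. \<forall>z\<in>ball z0 \<delta> - S. R' z f = R z f" using agree \<delta>(2) by auto
    ultimately show False using R z0 \<delta>(1) unfolding generalized_resolvent_def by blast
  qed
qed

lemma generalized_resolvent_unique:
  assumes \<epsilon>: "0 \<le> \<epsilon>" "\<epsilon> \<le> 1" and R: "generalized_resolvent (V_eps \<epsilon>) S R"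
  shows "S = singular_set" "\<And>f z. f \<in> X_minus \<Longrightarrow> z \<notin> singular_set \<Longrightarrow> R z f = continued_resolvent \<epsilon> z f"
proof -
  note C = generalized_resolvent_continued[OF \<epsilon>]
  have agree: "R z f = continued_resolvent \<epsilon> z f" if "f \<in> X_minus" "z \<notin> S" "z \<notin> singular_set" for f z
    using generalized_resolvent_agree[OF R C countable_singular_set that] .
  show S: "S = singular_set"
    using generalized_resolvent_singularity_subset[OF R C agree]
      generalized_resolvent_singularity_subset[OF C R] agree by (metis subset_antisym)
  show "R z f = continued_resolvent \<epsilon> z f" if "f \<in> X_minus" "z \<notin> singular_set" for f z
    using agree[of f z] that S by simp
qed

section \<open>Riesz projections\<close>

lemma encircles_exists: "\<exists>C. encircles C (1 / 2 ^ k) singular_set"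
proof (intro exI[of _ "circlepath (1 / 2 ^ k) (1 / 2 ^ (k + 2))"])
  \<comment> \<open>The radius 2^-(k+2) is half the gap 2^-(k+1) between 2^-k and the rest of the
    singular set.\<close>
  let ?p = "1 / 2 ^ k :: complex" and ?r = "1 / 2 ^ (k + 2) :: real"
  have r: "?r > 0" "?r < 1 / 2 ^ Suc k" by (simp_all add: field_simps)
  have far: "?r < dist ?p s" if "s \<in> singular_set" "s \<noteq> ?p" for s
    using singular_set_gap[OF that] r(2) by linarith
  have disj: "path_image (circlepath ?p ?r) \<inter> singular_set = {}"
  proof -
    have "s \<notin> sphere ?p ?r" if "s \<in> singular_set" for s
      using far[OF that] r(1) by (cases "s = ?p") auto
    then show ?thesis using r(1) by auto
  qed
  have out: "winding_number (circlepath ?p ?r) s = 0" if "s \<in> singular_set - {?p}" for s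
  proof (rule winding_number_zero_outside[of _ "cball ?p ?r"])
    show "s \<notin> cball ?p ?r" using far[of s] that by simp
    show "path_image (circlepath ?p ?r) \<subseteq> cball ?p ?r" using r(1) by (auto simp: sphere_def)
  qed auto
  show "encircles (circlepath ?p ?r) ?p singular_set"
    unfolding encircles_def using r disj out by (simp add: simple_path_circlepath winding_number_circlepath)
qed

text \<open>The same choice term as in \<open>riesz_projection\<close>, once S is known to be
  \<open>singular_set\<close>; only the properties in \<open>encircles\<close> are known of
  it.\<close>

definition residue_curve :: "nat \<Rightarrow> real \<Rightarrow> complex" where
  "residue_curve k = (SOME C. encircles C (1 / 2 ^ k) singular_set)"

lemma residue_curve: "encircles (residue_curve k) (1 / 2 ^ k) singular_set"
  unfolding residue_curve_def by (rule someI_ex[OF encircles_exists])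

lemma residue_curve_image: "path_image (residue_curve k) \<subseteq> - singular_set"
  using residue_curve[of k] by (auto simp: encircles_def)

lemma residue_curve_integrable:
  "h holomorphic_on - singular_set \<Longrightarrow> h contour_integrable_on residue_curve k"
  using residue_curve[of k] residue_curve_image closed_singular_set
  by (intro contour_integrable_holomorphic_simple[where S = "- singular_set"]) (auto simp: encircles_def open_Compl)

text \<open>The curve winds around no singularity other than 2^-k, so the global form of Cauchy's
  theorem applies to a function regular there.\<close>

lemma residue_curve_Cauchy:
  assumes "h holomorphic_on - (singular_set - {1 / 2 ^ k})"
  shows "(h has_contour_integral 0) (residue_curve k)"
proof (rule Cauchy_theorem_global[OF _ assms])
  show "open (- (singular_set - {1 / 2 ^ k}))" by (simp only: open_Compl closed_singular_set_remove)
  show "path_image (residue_curve k) \<subseteq> - (singular_set - {1 / 2 ^ k})" using residue_curve_image[of k] by blast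
  show "winding_number (residue_curve k) w = 0" if "w \<notin> - (singular_set - {1 / 2 ^ k})" for w
    using residue_curve[of k] that by (auto simp: encircles_def)
qed (use residue_curve[of k] in \<open>auto simp: encircles_def\<close>)

text \<open>The coefficient of (z - 2^-k)^-(n+1) in the Laurent expansion of a coordinate; n = 0 is
  the residue.\<close>

definition laurent_coord ::
  "real \<Rightarrow> nat \<Rightarrow> nat \<Rightarrow> (nat \<Rightarrow> nat \<Rightarrow> complex) \<Rightarrow> nat \<Rightarrow> nat \<Rightarrow> nat \<Rightarrow> complex" where
  "laurent_coord \<epsilon> k M a n i j =
     contour_integral (residue_curve k) (\<lambda>z. (z - 1 / 2 ^ k) ^ n * coord_resolvent \<epsilon> M a z i j) / (2 * pi * \<i>)"

lemma has_contour_integral_laurent: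
  "((\<lambda>z. (z - 1 / 2 ^ k) ^ n * coord_resolvent \<epsilon> M a z i j)
     has_contour_integral (2 * pi * \<i> * laurent_coord \<epsilon> k M a n i j)) (residue_curve k)"
proof -
  have "(\<lambda>z. (z - 1 / 2 ^ k) ^ n * coord_resolvent \<epsilon> M a z i j) holomorphic_on - singular_set"
    by (intro holomorphic_intros coord_resolvent_holomorphic)
  from has_contour_integral_integral[OF residue_curve_integrable[OF this, of k]]
  show ?thesis by (simp add: laurent_coord_def)
qed

lemma laurent_coord_eqI:
  assumes "(h has_contour_integral (2 * pi * \<i> * c)) (residue_curve k)"
    and "\<And>z. z \<notin> singular_set \<Longrightarrow> h z = (z - 1 / 2 ^ k) ^ n * coord_resolvent \<epsilon> M a z i j"
  shows "laurent_coord \<epsilon> k M a n i j = c"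
proof -
  have "((\<lambda>z. (z - 1 / 2 ^ k) ^ n * coord_resolvent \<epsilon> M a z i j) has_contour_integral (2 * pi * \<i> * c)) (residue_curve k)"
    by (rule has_contour_integral_eq[OF assms(1)]) (use assms(2) residue_curve_image[of k] in blast)
  from has_contour_integral_unique[OF this has_contour_integral_laurent] show ?thesis by simp
qed

text \<open>Each level of the recursion in j divides by one factor z - 2^-(i+j), so the pole order
  grows by at most one per level and is at most j + 1.\<close>

lemma coord_resolvent_order:
  "\<exists>q. q holomorphic_on - (singular_set - {1 / 2 ^ k}) \<and>
     (\<forall>z. z \<notin> singular_set \<longrightarrow> (z - 1 / 2 ^ k) ^ Suc j * coord_resolvent \<epsilon> M a z i j = q z)"
proof (induction j arbitrary: i rule: less_induct)
  case (less j)
  let ?D = "- (singular_set - {1 / 2 ^ k})" and ?p = "1 / 2 ^ k :: complex"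
  have "\<exists>q. \<forall>l i. l < j \<longrightarrow> q l i holomorphic_on ?D \<and>
     (\<forall>z. z \<notin> singular_set \<longrightarrow> (z - ?p) ^ Suc l * coord_resolvent \<epsilon> M a z i l = q l i z)"
    using less by metis
  then obtain q where q: "\<And>l i. l < j \<Longrightarrow> q l i holomorphic_on ?D"
    "\<And>l i z. l < j \<Longrightarrow> z \<notin> singular_set \<Longrightarrow> (z - ?p) ^ Suc l * coord_resolvent \<epsilon> M a z i l = q l i z"
    by metis
  \<comment> \<open>The quotient (z - 2^-k) / (z - 2^-(i+j)) with its removable singularity filled
    in.\<close>
  define s where "s z = (if i + j = k then 1 else (z - ?p) / (z - 1 / 2 ^ (i + j)))" for z
  define Q where "Q z = s z * ((z - ?p) ^ j * a i j
      + (\<Sum>l<j. \<Sum>i'\<le>M. coord_kernel \<epsilon> i j i' l * ((z - ?p) ^ (j - Suc l) * q l i' z)))" for z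
  have "s holomorphic_on ?D"
  proof (cases "i + j = k")
    case False
    then have "1 / 2 ^ (i + j) \<noteq> ?p" by (subst half_power_eq_iff)
    then have "z - 1 / 2 ^ (i + j) \<noteq> 0" if "z \<in> ?D" for z
      using that half_power_in_singular_set[of "i + j"] by auto
    then have "(\<lambda>z. (z - ?p) / (z - 1 / 2 ^ (i + j))) holomorphic_on ?D"
      by (intro holomorphic_intros) auto
    then show ?thesis using False by (simp add: s_def[abs_def])
  qed (simp add: s_def[abs_def])
  then have "Q holomorphic_on ?D"
    unfolding Q_def by (intro holomorphic_intros q) auto
  moreover have "(z - ?p) ^ Suc j * coord_resolvent \<epsilon> M a z i j = Q z" if z: "z \<notin> singular_set" for z
  proof -
    have nz: "z - 1 / 2 ^ (i + j) \<noteq> 0" using z half_power_in_singular_set[of "i + j"] by auto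
    have s: "(z - ?p) / (z - 1 / 2 ^ (i + j)) = s z" using nz by (auto simp: s_def)
    have "(z - ?p) ^ Suc j * coord_resolvent \<epsilon> M a z i j
        = (z - ?p) / (z - 1 / 2 ^ (i + j)) * ((z - ?p) ^ j * (a i j
            + (\<Sum>l<j. \<Sum>i'\<le>M. coord_kernel \<epsilon> i j i' l * coord_resolvent \<epsilon> M a z i' l)))"
      by (subst coord_resolvent.simps) simp
    also have "(z - ?p) ^ j * (a i j + (\<Sum>l<j. \<Sum>i'\<le>M. coord_kernel \<epsilon> i j i' l * coord_resolvent \<epsilon> M a z i' l))
        = (z - ?p) ^ j * a i j
          + (\<Sum>l<j. \<Sum>i'\<le>M. coord_kernel \<epsilon> i j i' l * ((z - ?p) ^ j * coord_resolvent \<epsilon> M a z i' l))"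
      by (simp only: distrib_left sum_distrib_left mult.left_commute)
    also have "(\<Sum>l<j. \<Sum>i'\<le>M. coord_kernel \<epsilon> i j i' l * ((z - ?p) ^ j * coord_resolvent \<epsilon> M a z i' l))
        = (\<Sum>l<j. \<Sum>i'\<le>M. coord_kernel \<epsilon> i j i' l * ((z - ?p) ^ (j - Suc l) * q l i' z))"
    proof (intro sum.cong refl)
      fix l i' assume "l \<in> {..<j}"
      then have l: "l < j" by simp
      have "(z - ?p) ^ j = (z - ?p) ^ (j - Suc l) * (z - ?p) ^ Suc l"
        using l by (subst power_add[symmetric]) simp
      then show "coord_kernel \<epsilon> i j i' l * ((z - ?p) ^ j * coord_resolvent \<epsilon> M a z i' l)
          = coord_kernel \<epsilon> i j i' l * ((z - ?p) ^ (j - Suc l) * q l i' z)"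
        by (simp only: q(2)[OF l z, symmetric] mult.assoc)
    qed
    finally show ?thesis unfolding s Q_def .
  qed
  ultimately show ?case by blast
qed

lemma laurent_coord_eq_0:
  assumes "j < n"
  shows "laurent_coord \<epsilon> k M a n i j = 0"
proof -
  obtain q where q: "q holomorphic_on - (singular_set - {1 / 2 ^ k})"
     "\<And>z. z \<notin> singular_set \<Longrightarrow> (z - 1 / 2 ^ k) ^ Suc j * coord_resolvent \<epsilon> M a z i j = q z"
    using coord_resolvent_order by metis
  have "(\<lambda>z. (z - 1 / 2 ^ k) ^ (n - Suc j) * q z) holomorphic_on - (singular_set - {1 / 2 ^ k})"
    by (intro holomorphic_intros q)
  from residue_curve_Cauchy[OF this]
  show ?thesis
  proof (intro laurent_coord_eqI[where h = "\<lambda>z. (z - 1 / 2 ^ k) ^ (n - Suc j) * q z"])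
    fix z :: complex assume z: "z \<notin> singular_set"
    have "(z - 1 / 2 ^ k) ^ n = (z - 1 / 2 ^ k) ^ (n - Suc j) * (z - 1 / 2 ^ k) ^ Suc j"
      using assms by (subst power_add[symmetric]) simp
    then show "(z - 1 / 2 ^ k) ^ (n - Suc j) * q z = (z - 1 / 2 ^ k) ^ n * coord_resolvent \<epsilon> M a z i j"
      by (simp only: q(2)[OF z, symmetric] mult.assoc)
  qed simp
qed

text \<open>Multiply the resolvent equation by (z - 2^-k)^n, write z = 2^-k + (z - 2^-k) and
  integrate; the source term is a polynomial in z and contributes 0.\<close>

lemma coord_op_laurent:
  "coord_op \<epsilon> M (laurent_coord \<epsilon> k M a n) i j
     = laurent_coord \<epsilon> k M a n i j / 2 ^ k + laurent_coord \<epsilon> k M a (Suc n) i j"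
proof -
  let ?C = "residue_curve k" and ?p = "1 / 2 ^ k :: complex" and ?t = "2 * pi * \<i>"
  let ?L = "\<lambda>n i j. laurent_coord \<epsilon> k M a n i j" and ?\<rho> = "\<lambda>z i j. coord_resolvent \<epsilon> M a z i j"
  let ?h = "\<lambda>z i j. (z - ?p) ^ n * ?\<rho> z i j"
  note H = has_contour_integral_laurent[of k n \<epsilon> M a]
  have "((\<lambda>z. 1 / 2 ^ (i + j) * ?h z i j + (\<Sum>l<j. \<Sum>i'\<le>M. coord_kernel \<epsilon> i j i' l * ?h z i' l)) has_contour_integral
      (1 / 2 ^ (i + j) * (?t * ?L n i j) + (\<Sum>l<j. \<Sum>i'\<le>M. coord_kernel \<epsilon> i j i' l * (?t * ?L n i' l)))) ?C"
    by (intro has_contour_integral_add has_contour_integral_sum has_contour_integral_lmul H) auto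
  also have "1 / 2 ^ (i + j) * (?t * ?L n i j) + (\<Sum>l<j. \<Sum>i'\<le>M. coord_kernel \<epsilon> i j i' l * (?t * ?L n i' l))
      = ?t * coord_op \<epsilon> M (?L n) i j"
    by (simp add: coord_op_def distrib_left sum_distrib_left mult_ac)
  finally have 1: "((\<lambda>z. 1 / 2 ^ (i + j) * ?h z i j + (\<Sum>l<j. \<Sum>i'\<le>M. coord_kernel \<epsilon> i j i' l * ?h z i' l))
      has_contour_integral (?t * coord_op \<epsilon> M (?L n) i j)) ?C" .
  have "((\<lambda>z. (z - ?p) ^ n) has_contour_integral 0) ?C"
    by (rule residue_curve_Cauchy) (intro holomorphic_intros)
  then have "((\<lambda>z. ((z - ?p) ^ Suc n * ?\<rho> z i j + ?p * ?h z i j) + - a i j * (z - ?p) ^ n) has_contour_integral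
      ((?t * ?L (Suc n) i j + ?p * (?t * ?L n i j)) + - a i j * 0)) ?C"
    by (intro has_contour_integral_add has_contour_integral_lmul H has_contour_integral_laurent)
  then have 2: "((\<lambda>z. ((z - ?p) ^ Suc n * ?\<rho> z i j + ?p * ?h z i j) + - a i j * (z - ?p) ^ n) has_contour_integral
      (?t * (?L n i j / 2 ^ k + ?L (Suc n) i j))) ?C"
    by (simp add: algebra_simps)
  have "?t * coord_op \<epsilon> M (?L n) i j = ?t * (?L n i j / 2 ^ k + ?L (Suc n) i j)"
  proof (rule has_contour_integral_unique[OF has_contour_integral_eq[OF 1] 2])
    fix z assume "z \<in> path_image ?C"
    then have "z \<notin> singular_set" using residue_curve_image[of k] by blast
    then have "z \<noteq> 1 / 2 ^ (i + j)" by auto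
    from coord_op_resolvent[OF this, of \<epsilon> M a]
    have "(z - ?p) ^ n * coord_op \<epsilon> M (?\<rho> z) i j = (z - ?p) ^ n * (z * ?\<rho> z i j - a i j)" by simp
    then show "1 / 2 ^ (i + j) * ?h z i j + (\<Sum>l<j. \<Sum>i'\<le>M. coord_kernel \<epsilon> i j i' l * ?h z i' l)
        = ((z - ?p) ^ Suc n * ?\<rho> z i j + ?p * ?h z i j) + - a i j * (z - ?p) ^ n"
      by (simp add: coord_op_def algebra_simps sum_distrib_left)
  qed
  then show ?thesis by simp
qed

text \<open>On a fixed test vector the functional is a finite sum, so the contour integral can be
  taken coordinate by coordinate.\<close>

lemma riesz_projection_coord:
  assumes \<epsilon>: "0 \<le> \<epsilon>" "\<epsilon> \<le> 1" and R: "generalized_resolvent (V_eps \<epsilon>) S R"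
    and f: "f \<in> X_minus" "L2_embed f = coord_functional M a"
  shows "riesz_projection S R (1 / 2 ^ k) f = coord_functional M (laurent_coord \<epsilon> k M a 0)"
proof
  fix g
  note S = generalized_resolvent_unique(1)[OF \<epsilon> R]
  show "riesz_projection S R (1 / 2 ^ k) f g = coord_functional M (laurent_coord \<epsilon> k M a 0) g"
  proof (cases "g \<in> X_plus")
    case True
    then obtain N where N: "g \<in> X_plus_step N" by (auto simp: X_plus_def)
    let ?c = "\<lambda>i j. cinner (eigen_poly i \<otimes>\<^sub>L ortho_poly j) g"
    have "((\<lambda>z. \<Sum>j\<le>N. \<Sum>i\<le>M. (z - 1 / 2 ^ k) ^ 0 * coord_resolvent \<epsilon> M a z i j * ?c i j) has_contour_integral
        (\<Sum>j\<le>N. \<Sum>i\<le>M. 2 * pi * \<i> * laurent_coord \<epsilon> k M a 0 i j * ?c i j)) (residue_curve k)"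
      by (intro has_contour_integral_sum has_contour_integral_rmul has_contour_integral_laurent) auto
    then have "((\<lambda>z. R z f g) has_contour_integral
        (\<Sum>j\<le>N. \<Sum>i\<le>M. 2 * pi * \<i> * laurent_coord \<epsilon> k M a 0 i j * ?c i j)) (residue_curve k)"
    proof (rule has_contour_integral_eq)
      fix z assume "z \<in> path_image (residue_curve k)"
      then have z: "z \<notin> singular_set" using residue_curve_image[of k] by blast
      show "(\<Sum>j\<le>N. \<Sum>i\<le>M. (z - 1 / 2 ^ k) ^ 0 * coord_resolvent \<epsilon> M a z i j * ?c i j) = R z f g"
        unfolding generalized_resolvent_unique(2)[OF \<epsilon> R f(1) z] continued_resolvent_eq[OF \<epsilon> f z]
          coord_functional_step[OF N] by simp
    qed
    then have "contour_integral (residue_curve k) (\<lambda>z. R z f g) = 2 * pi * \<i> * coord_functional M (laurent_coord \<epsilon> k M a 0) g"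
      unfolding coord_functional_step[OF N] by (simp add: contour_integral_unique sum_distrib_left mult.assoc)
    then show ?thesis using True by (simp add: riesz_projection_def S residue_curve_def)
  qed (simp add: riesz_projection_def coord_functional_def)
qed

section \<open>Generalized eigenspaces\<close>

text \<open>The coordinate form of the dual operator minus 2^-k.\<close>

definition coord_nilpotent_part :: "real \<Rightarrow> nat \<Rightarrow> nat \<Rightarrow> (nat \<Rightarrow> nat \<Rightarrow> complex) \<Rightarrow> nat \<Rightarrow> nat \<Rightarrow> complex" where
  "coord_nilpotent_part \<epsilon> k M a i j = coord_op \<epsilon> M a i j - a i j / 2 ^ k"

text \<open>The exponent is allowed to depend on j, exactly as the bound j + 1 on the pole order
  provides.\<close>

definition coord_nilpotent :: "real \<Rightarrow> nat \<Rightarrow> nat \<Rightarrow> (nat \<Rightarrow> nat \<Rightarrow> complex) \<Rightarrow> bool" where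
  "coord_nilpotent \<epsilon> k M a \<longleftrightarrow> (\<forall>i j n. j < n \<longrightarrow> (coord_nilpotent_part \<epsilon> k M ^^ n) a i j = 0)"

lemma coord_nilpotent_laurent: "coord_nilpotent \<epsilon> k M (laurent_coord \<epsilon> k M a 0)"
proof -
  have "(coord_nilpotent_part \<epsilon> k M ^^ n) (laurent_coord \<epsilon> k M a 0) = laurent_coord \<epsilon> k M a n" for n
  proof (induction n)
    case (Suc n)
    then show ?case by (intro ext) (simp add: coord_nilpotent_part_def coord_op_laurent)
  qed simp
  then show ?thesis by (simp add: coord_nilpotent_def laurent_coord_eq_0)
qed

lemma coord_nilpotent_step:
  assumes "coord_nilpotent \<epsilon> k M a"
  shows "coord_nilpotent \<epsilon> k M (coord_nilpotent_part \<epsilon> k M a)"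
  using assms unfolding coord_nilpotent_def by (metis less_SucI funpow_Suc_right comp_apply)

text \<open>In the first row j that can be nonzero there is no input from below, so the nilpotent
  part multiplies the entry by 2^-(i+j) - 2^-k, and a power of this factor can kill it only if the
  factor is 0.\<close>

lemma coord_nilpotent_row:
  assumes nil: "coord_nilpotent \<epsilon> k M a" and zero: "\<And>i l. i \<le> M \<Longrightarrow> l < j \<Longrightarrow> a i l = 0"
    and i: "i \<le> M" "i + j \<noteq> k"
  shows "a i j = 0"
proof -
  have it: "(\<forall>i\<le>M. \<forall>l<j. (coord_nilpotent_part \<epsilon> k M ^^ n) a i l = 0) \<and>
     (\<forall>i\<le>M. (coord_nilpotent_part \<epsilon> k M ^^ n) a i j = (1 / 2 ^ (i + j) - 1 / 2 ^ k) ^ n * a i j)" for n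
  proof (induction n)
    case (Suc n)
    let ?b = "(coord_nilpotent_part \<epsilon> k M ^^ n) a"
    have b: "?b i l = 0" if "i \<le> M" "l < j" for i l using Suc that by blast
    have "coord_nilpotent_part \<epsilon> k M ?b i l = (1 / 2 ^ (i + l) - 1 / 2 ^ k) * ?b i l" if "l \<le> j" for i l
    proof -
      have "(\<Sum>l'<l. \<Sum>i'\<le>M. coord_kernel \<epsilon> i l i' l' * ?b i' l') = 0"
        using that by (intro sum.neutral ballI) (simp add: b)
      then show ?thesis by (simp add: coord_nilpotent_part_def coord_op_def left_diff_distrib)
    qed
    then show ?case using Suc b by simp
  qed (use zero in simp)
  have "(1 / 2 ^ (i + j) - 1 / 2 ^ k) ^ Suc j * a i j = 0"
    using it[of "Suc j"] nil i(1) unfolding coord_nilpotent_def by (metis lessI)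
  moreover have "1 / 2 ^ (i + j) - 1 / 2 ^ k \<noteq> (0 :: complex)"
    using i(2) by (simp only: right_minus_eq half_power_eq_iff not_False_eq_True)
  ultimately show ?thesis by simp
qed

text \<open>In row j only the entry on the diagonal i + j = k is left, so the sum over i' collapses;
  a position with i > M is absent and gives 0.\<close>

lemma coord_functional_diagonal:
  assumes nil: "coord_nilpotent \<epsilon> k M a" and zero: "\<And>i l. i \<le> M \<Longrightarrow> l < j \<Longrightarrow> a i l = 0"
    and ij: "i + j = k"
  shows "coord_functional M a (ortho_poly i \<otimes>\<^sub>L ortho_poly j)
    = (if i \<le> M then a i j * cinner (eigen_poly i) (ortho_poly i) else 0)"
proof -
  have "a i' j = 0" if "i' \<le> M" "i' \<noteq> i" for i'
    by (rule coord_nilpotent_row[OF nil zero that(1)]) (use that ij in auto)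
  then have "(\<Sum>i'\<le>M. a i' j * cinner (eigen_poly i') (ortho_poly i))
      = (\<Sum>i'\<in>{..M} \<inter> {i}. a i' j * cinner (eigen_poly i') (ortho_poly i))"
    by (intro sum.mono_neutral_right) auto
  then show ?thesis by (simp add: coord_functional_tensor)
qed

text \<open>Induction over the rows: entries off the diagonal vanish by
  \<open>coord_nilpotent_row\<close>, and the one on the diagonal is read off by its test
  vector.\<close>

lemma coord_nilpotent_eq_0:
  assumes nil: "coord_nilpotent \<epsilon> k M a"
    and diag: "\<And>i. i \<le> k \<Longrightarrow> coord_functional M a (ortho_poly i \<otimes>\<^sub>L ortho_poly (k - i)) = 0"
    and "i \<le> M"
  shows "a i j = 0"
  using \<open>i \<le> M\<close>
proof (induction j arbitrary: i rule: less_induct)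
  case (less j)
  show ?case
  proof (cases "i + j = k")
    case True
    then have "k - i = j" "i \<le> k" by auto
    with diag[of i] coord_functional_diagonal[OF nil less.IH True] less.prems
    have "a i j * cinner (eigen_poly i) (ortho_poly i) = 0" by simp
    then show ?thesis using cinner_eigen_ortho(2)[of i] by simp
  qed (use coord_nilpotent_row[OF nil less.IH less.prems] in blast)
qed

lemma coord_functional_zero:
  assumes "\<And>i j. i \<le> M \<Longrightarrow> a i j = 0"
  shows "coord_functional M a = 0"
proof -
  have "coord_functional M a = coord_functional M (\<lambda>i j. 0 * a i j + 0 * a i j)"
    by (rule coord_functional_cong) (simp add: assms)
  also have "\<dots> = 0" by (intro ext) (simp only: coord_functional_linear, simp)
  finally show ?thesis .
qed

text \<open>The passage from a vanishing functional to vanishing coordinates works because the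
  nilpotent part of a is again nilpotent, so \<open>coord_nilpotent_eq_0\<close> applies to
  it.\<close>

lemma dual_op_eigen_iff:
  assumes nil: "coord_nilpotent \<epsilon> k M a"
  shows "dual_op (V_eps \<epsilon>) (coord_functional M a) = (\<lambda>g. 1 / 2 ^ k * coord_functional M a g)
    \<longleftrightarrow> (\<forall>i\<le>M. \<forall>j. coord_nilpotent_part \<epsilon> k M a i j = 0)"
proof -
  have eq: "coord_functional M (coord_nilpotent_part \<epsilon> k M a) g
      = dual_op (V_eps \<epsilon>) (coord_functional M a) g - 1 / 2 ^ k * coord_functional M a g" for g
  proof -
    have "coord_nilpotent_part \<epsilon> k M a = (\<lambda>i j. 1 * coord_op \<epsilon> M a i j + (- 1 / 2 ^ k) * a i j)"
      by (simp add: coord_nilpotent_part_def[abs_def])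
    then show ?thesis unfolding dual_op_coord_functional by (simp only: coord_functional_linear) simp
  qed
  show ?thesis
  proof
    assume "dual_op (V_eps \<epsilon>) (coord_functional M a) = (\<lambda>g. 1 / 2 ^ k * coord_functional M a g)"
    then have "coord_functional M (coord_nilpotent_part \<epsilon> k M a) g = 0" for g by (simp add: eq)
    then show "\<forall>i\<le>M. \<forall>j. coord_nilpotent_part \<epsilon> k M a i j = 0"
      using coord_nilpotent_eq_0[OF coord_nilpotent_step[OF nil]] by blast
  next
    assume "\<forall>i\<le>M. \<forall>j. coord_nilpotent_part \<epsilon> k M a i j = 0"
    then have "coord_functional M (coord_nilpotent_part \<epsilon> k M a) = 0" by (intro coord_functional_zero) simp
    then have "dual_op (V_eps \<epsilon>) (coord_functional M a) g - 1 / 2 ^ k * coord_functional M a g = 0" for g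
      using eq[of g] by simp
    then show "dual_op (V_eps \<epsilon>) (coord_functional M a) = (\<lambda>g. 1 / 2 ^ k * coord_functional M a g)"
      by (simp only: right_minus_eq fun_eq_iff) simp
  qed
qed

text \<open>
  The coupling between neighbouring diagonal positions does not vanish, so an eigenvector is supported
  in the rows from \<open>k\<close> on.
\<close>

lemma eigenvector_diagonal:
  assumes \<epsilon>: "\<epsilon> \<noteq> 0" and nil: "coord_nilpotent \<epsilon> k M a"
    and eig: "\<And>i j. i \<le> M \<Longrightarrow> coord_nilpotent_part \<epsilon> k M a i j = 0"
    and i: "0 < i" "i \<le> k"
  shows "coord_functional M a (ortho_poly i \<otimes>\<^sub>L ortho_poly (k - i)) = 0"
proof -
  have rows: "a i j = 0" if "i \<le> M" "j < k" for i j
    using that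
  proof (induction j arbitrary: i rule: less_induct)
    case (less j)
    have low: "a i' l = 0" if "i' \<le> M" "l < j" for i' l using less.IH[OF that(2,1)] that(2) less.prems(2) by simp
    show ?case
    proof (cases "i + j = k")
      case True
      \<comment> \<open>Since j < k, the index i is positive, and the equation to test is the one at
        the next diagonal position (i - 1, j + 1).\<close>
      then obtain m where m: "i = Suc m" using less.prems(2) by (cases i) auto
      have zero: "a i' j = 0" if "i' \<le> M" "i' \<noteq> i" for i'
        by (rule coord_nilpotent_row[OF nil low that(1)]) (use that True in auto)
      \<comment> \<open>At that position the diagonal term cancels against 2^-k, and all inputs
        except the one from (i, j) are already zero.\<close>
      have "(\<Sum>l<Suc j. \<Sum>i'\<le>M. coord_kernel \<epsilon> m (Suc j) i' l * a i' l)
          = (\<Sum>i'\<le>M. coord_kernel \<epsilon> m (Suc j) i' j * a i' j)"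
        by (simp add: low)
      also have "\<dots> = (\<Sum>i'\<in>{i}. coord_kernel \<epsilon> m (Suc j) i' j * a i' j)"
        using less.prems(1) zero by (intro sum.mono_neutral_right) auto
      finally have "coord_nilpotent_part \<epsilon> k M a m (Suc j) = coord_kernel \<epsilon> m (Suc j) i j * a i j"
        using True m by (simp add: coord_nilpotent_part_def coord_op_def)
      moreover have "coord_kernel \<epsilon> m (Suc j) i j \<noteq> 0"
        using \<epsilon> odd_coeff_nonzero[of m] cinner_odd_ortho_nonzero[of j] by (simp add: coord_kernel_def m)
      ultimately show ?thesis using eig[of m "Suc j"] less.prems(1) m by simp
    qed (use coord_nilpotent_row[OF nil low less.prems(1)] in blast)
  qed
  then show ?thesis using i by (simp add: coord_functional_tensor)
qed

text \<open>Gaussian elimination: triangularity of the values m_i(x_i') with nonzero diagonal gives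
  independence, and together with injectivity of the evaluation it gives spanning.\<close>

lemma functionals_dim_eqI:
  assumes I: "functionals.subspace I"
    and inj: "\<And>\<mu>. \<mu> \<in> I \<Longrightarrow> (\<And>i. i < n \<Longrightarrow> \<mu> (x i) = 0) \<Longrightarrow> \<mu> = 0"
    and m: "\<And>i. i < n \<Longrightarrow> m i \<in> I" "\<And>i. i < n \<Longrightarrow> m i (x i) \<noteq> 0"
    and tri: "\<And>i i'. i < i' \<Longrightarrow> i' < n \<Longrightarrow> m i (x i') = 0"
  shows "functionals.dim I = n"
proof (rule functionals.dim_unique)
  have inj_m: "inj_on m {..<n}"
  proof (rule linorder_inj_onI)
    fix i i' assume "i < i'" "i \<in> {..<n}" "i' \<in> {..<n}"
    then show "m i \<noteq> m i'" using tri[of i i'] m(2)[of i'] by auto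
  qed auto
  then show "card (m ` {..<n}) = n" by (simp add: card_image)
  show "m ` {..<n} \<subseteq> I" using m(1) by auto
  \<comment> \<open>Combinations of the \<open>m i\<close> with i < p vanish at \<open>x p\<close>,
    where \<open>m p\<close> does not; hence \<open>m p\<close> is independent of them.\<close>
  have van: "\<mu> (x p) = 0" if "\<mu> \<in> functionals.span (m ` {..<p})" "p < n" for \<mu> p
    using that(1)
  proof (induction rule: functionals.span_induct)
    case base
    show ?case by (simp add: functionals.subspace_def)
  qed (use tri that(2) in auto)
  show "functionals.independent (m ` {..<n})"
  proof -
    have "functionals.independent (m ` {..<p})" if "p \<le> n" for p
      using that
    proof (induction p)
      case (Suc p)
      have "m p \<notin> functionals.span (m ` {..<p})" using van[of "m p" p] m(2)[of p] Suc.prems by auto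
      then show ?case using Suc by (simp add: lessThan_Suc functionals.independent_insertI)
    qed (simp add: functionals.independent_empty)
    then show ?thesis by blast
  qed
  show "I \<subseteq> functionals.span (m ` {..<n})"
  proof
    fix \<mu> assume "\<mu> \<in> I"
    \<comment> \<open>Here p bounds the test points at which the functional may be nonzero; p = n is
      no restriction and p = 0 forces it to vanish.\<close>
    have "\<mu> \<in> functionals.span (m ` {..<p})"
      if "p \<le> n" "\<mu> \<in> I" "\<And>i. p \<le> i \<Longrightarrow> i < n \<Longrightarrow> \<mu> (x i) = 0" for p \<mu>
      using that
    proof (induction p arbitrary: \<mu>)
      case 0
      then have "\<mu> = 0" by (intro inj) auto
      then show ?case by (simp only: functionals.span_zero)
    next
      case (Suc p)
      \<comment> \<open>Removes the value at \<open>x p\<close>; the values at later test points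
        stay zero by triangularity.\<close>
      define c where "c = \<mu> (x p) / m p (x p)"
      define \<nu> where "\<nu> = \<mu> - (\<lambda>y. c * m p y)"
      have "\<nu> \<in> functionals.span (m ` {..<p})"
      proof (rule Suc.IH)
        show "\<nu> \<in> I"
          unfolding \<nu>_def using Suc.prems m(1)[of p] I
          by (intro functionals.subspace_diff functionals.subspace_scale) auto
        show "\<nu> (x i) = 0" if "p \<le> i" "i < n" for i
          using that Suc.prems(3)[of i] tri[of p i] m(2)[of p] by (cases "i = p") (auto simp: \<nu>_def c_def)
      qed (use Suc.prems in simp)
      then have "\<nu> \<in> functionals.span (m ` {..<Suc p})"
        by (rule subsetD[OF functionals.span_mono, rotated]) auto
      moreover have "(\<lambda>y. c * m p y) \<in> functionals.span (m ` {..<Suc p})"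
        by (intro functionals.span_scale functionals.span_base) simp
      ultimately have "\<nu> + (\<lambda>y. c * m p y) \<in> functionals.span (m ` {..<Suc p})" by (rule functionals.span_add)
      then show ?case by (simp add: \<nu>_def)
    qed
    from this[of n \<mu>] \<open>\<mu> \<in> I\<close> show "\<mu> \<in> functionals.span (m ` {..<n})" by simp
  qed
qed

section \<open>Linearity of the residues and root vectors\<close>

lemma coord_resolvent_linear:
  "coord_resolvent \<epsilon> M (\<lambda>i j. c * a i j + d * b i j) z i j
     = c * coord_resolvent \<epsilon> M a z i j + d * coord_resolvent \<epsilon> M b z i j"
proof (induction j arbitrary: i rule: less_induct)
  case (less j)
  have "(\<Sum>l<j. \<Sum>i'\<le>M. coord_kernel \<epsilon> i j i' l * coord_resolvent \<epsilon> M (\<lambda>i j. c * a i j + d * b i j) z i' l)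
      = (\<Sum>l<j. \<Sum>i'\<le>M. c * (coord_kernel \<epsilon> i j i' l * coord_resolvent \<epsilon> M a z i' l)
          + d * (coord_kernel \<epsilon> i j i' l * coord_resolvent \<epsilon> M b z i' l))"
    by (intro sum.cong refl) (simp add: less algebra_simps)
  also have "\<dots> = c * (\<Sum>l<j. \<Sum>i'\<le>M. coord_kernel \<epsilon> i j i' l * coord_resolvent \<epsilon> M a z i' l)
     + d * (\<Sum>l<j. \<Sum>i'\<le>M. coord_kernel \<epsilon> i j i' l * coord_resolvent \<epsilon> M b z i' l)"
    by (simp only: sum.distrib sum_distrib_left)
  finally show ?case
    unfolding coord_resolvent.simps[of _ _ _ _ i j] by (simp add: algebra_simps add_divide_distrib)
qed

lemma laurent_coord_linear:
  "laurent_coord \<epsilon> k M (\<lambda>i j. c * a i j + d * b i j) n i j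
     = c * laurent_coord \<epsilon> k M a n i j + d * laurent_coord \<epsilon> k M b n i j"
proof (rule laurent_coord_eqI)
  have "((\<lambda>z. c * ((z - 1 / 2 ^ k) ^ n * coord_resolvent \<epsilon> M a z i j)
      + d * ((z - 1 / 2 ^ k) ^ n * coord_resolvent \<epsilon> M b z i j)) has_contour_integral
      (c * (2 * pi * \<i> * laurent_coord \<epsilon> k M a n i j) + d * (2 * pi * \<i> * laurent_coord \<epsilon> k M b n i j))) (residue_curve k)"
    by (intro has_contour_integral_add has_contour_integral_lmul has_contour_integral_laurent)
  then show "((\<lambda>z. c * ((z - 1 / 2 ^ k) ^ n * coord_resolvent \<epsilon> M a z i j)
      + d * ((z - 1 / 2 ^ k) ^ n * coord_resolvent \<epsilon> M b z i j)) has_contour_integral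
      (2 * pi * \<i> * (c * laurent_coord \<epsilon> k M a n i j + d * laurent_coord \<epsilon> k M b n i j))) (residue_curve k)"
    by (simp add: algebra_simps)
qed (simp add: coord_resolvent_linear algebra_simps)

text \<open>Up to row n the resolvent is the source divided by z - 2^-(i+j), and at the source i + j
  = k; the residue returns the source itself.\<close>

lemma laurent_coord_single_low:
  assumes "j \<le> n" "p + n = k"
  shows "laurent_coord \<epsilon> k M (\<lambda>i j. of_bool (i = p \<and> j = n)) 0 i j = of_bool (i = p \<and> j = n)"
proof (rule laurent_coord_eqI)
  have C: "valid_path (residue_curve k)" "1 / 2 ^ k \<notin> path_image (residue_curve k)" "winding_number (residue_curve k) (1 / 2 ^ k) = 1"
    using residue_curve[of k] half_power_in_singular_set[of k] unfolding encircles_def by auto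
  from has_contour_integral_winding_number[OF C(1,2)] C(3)
  have "((\<lambda>w. 1 / (w - 1 / 2 ^ k)) has_contour_integral 2 * pi * \<i>) (residue_curve k)" by simp
  from has_contour_integral_lmul[OF this, of "of_bool (i = p \<and> j = n)"]
  show "((\<lambda>w. of_bool (i = p \<and> j = n) * (1 / (w - 1 / 2 ^ k))) has_contour_integral
      (2 * pi * \<i> * of_bool (i = p \<and> j = n))) (residue_curve k)"
    by (simp add: mult.commute)
  fix z :: complex
  show "of_bool (i = p \<and> j = n) * (1 / (z - 1 / 2 ^ k))
      = (z - 1 / 2 ^ k) ^ 0 * coord_resolvent \<epsilon> M (\<lambda>i j. of_bool (i = p \<and> j = n)) z i j"
    unfolding coord_resolvent_single_low[OF assms(1)] using assms(2) by auto
qed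

context
  fixes \<epsilon> :: real and S R and k :: nat
  assumes \<epsilon>: "0 \<le> \<epsilon>" "\<epsilon> \<le> 1" and R: "generalized_resolvent (V_eps \<epsilon>) S R"
begin

lemma generalized_eigenspace_coord:
  assumes "\<mu> \<in> generalized_eigenspace S R (1 / 2 ^ k)"
  obtains M a where "\<mu> = coord_functional M a" "coord_nilpotent \<epsilon> k M a"
proof -
  from assms obtain f where f: "f \<in> X_minus" "\<mu> = riesz_projection S R (1 / 2 ^ k) f"
    unfolding generalized_eigenspace_def by blast
  from X_minus_coord[OF f(1)] obtain M a where Ma: "L2_embed f = coord_functional M a" by blast
  show ?thesis
    using that riesz_projection_coord[OF \<epsilon> R f(1) Ma, of k] f(2) coord_nilpotent_laurent by metis
qed

text \<open>Both preimages are expanded with a common degree bound M, so that the coordinate arrays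
  can be combined.\<close>

lemma generalized_eigenspace_linear:
  assumes "\<mu> \<in> generalized_eigenspace S R (1 / 2 ^ k)" "\<nu> \<in> generalized_eigenspace S R (1 / 2 ^ k)"
  shows "(\<lambda>g. c * \<mu> g + d * \<nu> g) \<in> generalized_eigenspace S R (1 / 2 ^ k)"
proof -
  obtain f f' where f: "f \<in> X_minus" "\<mu> = riesz_projection S R (1 / 2 ^ k) f"
    and f': "f' \<in> X_minus" "\<nu> = riesz_projection S R (1 / 2 ^ k) f'"
    using assms unfolding generalized_eigenspace_def by blast
  obtain M where M: "f \<in> X_minus_step M" "f' \<in> X_minus_step M" using X_minus_common_step[OF f(1) f'(1)] .
  obtain a a' where a: "L2_embed f = coord_functional M a" "L2_embed f' = coord_functional M a'"
    using X_minus_step_expand[OF M(1)] X_minus_step_expand[OF M(2)] L2_embed_coord by metis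
  define F where "F = scaleC c f + scaleC d f'"
  have F: "F \<in> X_minus" unfolding F_def by (intro X_minus_add X_minus_scaleC f f')
  have "L2_embed F g = c * L2_embed f g + d * L2_embed f' g" for g
    by (simp add: F_def L2_embed_def cinner_add_left cinner_scaleC_left)
  then have "L2_embed F = coord_functional M (\<lambda>i j. c * a i j + d * a' i j)"
    unfolding a by (simp add: coord_functional_linear fun_eq_iff)
  note FF = riesz_projection_coord[OF \<epsilon> R F this, of k]
  have L: "laurent_coord \<epsilon> k M (\<lambda>i j. c * a i j + d * a' i j) 0
      = (\<lambda>i j. c * laurent_coord \<epsilon> k M a 0 i j + d * laurent_coord \<epsilon> k M a' 0 i j)"
    by (intro ext laurent_coord_linear)
  have "riesz_projection S R (1 / 2 ^ k) F = (\<lambda>g. c * \<mu> g + d * \<nu> g)"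
    unfolding f(2) f'(2) riesz_projection_coord[OF \<epsilon> R f(1) a(1)] riesz_projection_coord[OF \<epsilon> R f'(1) a(2)]
      FF L by (intro ext coord_functional_linear)
  then show ?thesis unfolding generalized_eigenspace_def using F by (metis imageI)
qed

text \<open>Starting vectors lie on the diagonal i + j = k, where the resolvent has its first pole
  at 2^-k.\<close>

definition root_vector :: "nat \<Rightarrow> int L2 \<Rightarrow> complex" where
  "root_vector i = riesz_projection S R (1 / 2 ^ k) (eigen_poly i \<otimes>\<^sub>L ortho_poly (k - i))"

lemma root_vector_in: "root_vector i \<in> generalized_eigenspace S R (1 / 2 ^ k)"
  unfolding generalized_eigenspace_def root_vector_def by (rule imageI[OF eigen_ortho_in_X_minus])

lemma root_vector_coord:
  "root_vector i = coord_functional i (laurent_coord \<epsilon> k i (\<lambda>i' j. of_bool (i' = i \<and> j = k - i)) 0)"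
  unfolding root_vector_def by (rule riesz_projection_coord[OF \<epsilon> R eigen_ortho_in_X_minus L2_embed_eigen_ortho])

text \<open>The test vector i' looks at row k - i', which does not exceed the row k - i of the
  source; there the residue is still the source itself.\<close>

lemma root_vector_diagonal:
  assumes "i \<le> i'" "i' \<le> k"
  shows "root_vector i (ortho_poly i' \<otimes>\<^sub>L ortho_poly (k - i')) = of_bool (i = i') * cinner (eigen_poly i) (ortho_poly i)"
proof -
  have "root_vector i (ortho_poly i' \<otimes>\<^sub>L ortho_poly (k - i'))
      = (\<Sum>l\<le>i. of_bool (l = i \<and> k - i' = k - i) * cinner (eigen_poly l) (ortho_poly i'))"
    unfolding root_vector_coord coord_functional_tensor
    using assms by (intro sum.cong refl) (simp add: laurent_coord_single_low)
  also have "\<dots> = (\<Sum>l\<le>i. (of_bool (i = i') * cinner (eigen_poly l) (ortho_poly i')) * of_bool (l = i))"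
    using assms by (intro sum.cong refl) auto
  also have "\<dots> = of_bool (i = i') * cinner (eigen_poly i) (ortho_poly i')"
    by (simp only: sum_mult_of_bool_eq finite_atMost) simp
  finally show ?thesis by auto
qed

text \<open>For the source (0, k) only i = 0 occurs and rows below k vanish. The nilpotent part is
  therefore zero at (0, k), the only diagonal position present, and hence everywhere.\<close>

lemma root_vector_eigen: "dual_op (V_eps \<epsilon>) (root_vector 0) = (\<lambda>g. 1 / 2 ^ k * root_vector 0 g)"
proof -
  define a where "a = laurent_coord \<epsilon> k 0 (\<lambda>i' j. of_bool (i' = 0 \<and> j = k - 0)) 0"
  have nil: "coord_nilpotent \<epsilon> k 0 a" unfolding a_def by (rule coord_nilpotent_laurent)
  have low: "a 0 l = 0" if "l < k" for l
    unfolding a_def using that by (subst laurent_coord_single_low) auto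
  have "coord_nilpotent_part \<epsilon> k 0 a 0 j = 0" for j
  proof (rule coord_nilpotent_eq_0[OF coord_nilpotent_step[OF nil]])
    fix i assume "i \<le> k"
    show "coord_functional 0 (coord_nilpotent_part \<epsilon> k 0 a) (ortho_poly i \<otimes>\<^sub>L ortho_poly (k - i)) = 0"
    proof (cases "i = 0")
      case True
      have "coord_nilpotent_part \<epsilon> k 0 a 0 k = 0"
        by (simp add: coord_nilpotent_part_def coord_op_def low)
      then show ?thesis by (simp add: coord_functional_tensor True)
    qed (simp add: coord_functional_tensor cinner_eigen_ortho)
  qed simp
  then show ?thesis
    unfolding root_vector_coord a_def[symmetric] dual_op_eigen_iff[OF nil] by simp
qed

lemma root_vector_nonzero: "root_vector 0 \<noteq> 0"
  using root_vector_diagonal[of 0 0] cinner_eigen_ortho(2)[of 0] by auto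

lemma subspace_generalized_eigenspace: "functionals.subspace (generalized_eigenspace S R (1 / 2 ^ k))"
  unfolding functionals.subspace_def
proof (intro conjI ballI allI)
  show "0 \<in> generalized_eigenspace S R (1 / 2 ^ k)"
    using generalized_eigenspace_linear[OF root_vector_in[of 0] root_vector_in[of 0], of 0 0] by (simp add: zero_fun_def)
  fix \<mu> assume \<mu>: "\<mu> \<in> generalized_eigenspace S R (1 / 2 ^ k)"
  show "(\<lambda>x. c * \<mu> x) \<in> generalized_eigenspace S R (1 / 2 ^ k)" for c
    using generalized_eigenspace_linear[OF \<mu> \<mu>, of c 0] by simp
  fix \<nu> assume \<nu>: "\<nu> \<in> generalized_eigenspace S R (1 / 2 ^ k)"
  show "\<mu> + \<nu> \<in> generalized_eigenspace S R (1 / 2 ^ k)"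
    using generalized_eigenspace_linear[OF \<mu> \<nu>, of 1 1] by (simp add: plus_fun_def)
qed

lemma generalized_eigenspace_eq_0:
  assumes \<mu>: "\<mu> \<in> generalized_eigenspace S R (1 / 2 ^ k)"
    and diag: "\<And>i. i \<le> k \<Longrightarrow> \<mu> (ortho_poly i \<otimes>\<^sub>L ortho_poly (k - i)) = 0"
  shows "\<mu> = 0"
proof -
  obtain M a where a: "\<mu> = coord_functional M a" "coord_nilpotent \<epsilon> k M a"
    using generalized_eigenspace_coord[OF \<mu>] .
  show ?thesis
    unfolding a(1) by (rule coord_functional_zero, rule coord_nilpotent_eq_0[OF a(2)]) (use diag a(1) in auto)
qed

lemma dim_generalized_eigenspace: "functionals.dim (generalized_eigenspace S R (1 / 2 ^ k)) = k + 1"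
proof (rule functionals_dim_eqI[where x = "\<lambda>i. ortho_poly i \<otimes>\<^sub>L ortho_poly (k - i)" and m = root_vector])
  show "\<mu> = 0" if "\<mu> \<in> generalized_eigenspace S R (1 / 2 ^ k)"
      "\<And>i. i < k + 1 \<Longrightarrow> \<mu> (ortho_poly i \<otimes>\<^sub>L ortho_poly (k - i)) = 0" for \<mu>
    by (rule generalized_eigenspace_eq_0[OF that(1)]) (simp add: that(2))
  show "root_vector i (ortho_poly i \<otimes>\<^sub>L ortho_poly (k - i)) \<noteq> 0" if "i < k + 1" for i
    using that cinner_eigen_ortho(2)[of i] by (subst root_vector_diagonal) auto
  show "root_vector i (ortho_poly i' \<otimes>\<^sub>L ortho_poly (k - i')) = 0" if "i < i'" "i' < k + 1" for i i'
    using that by (subst root_vector_diagonal) auto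
qed (simp_all only: subspace_generalized_eigenspace root_vector_in)

text \<open>The single test vector e_0 \<otimes> e_k is enough, since
  \<open>eigenvector_diagonal\<close> makes eigenvectors vanish on the others, and
  \<open>root_vector 0\<close> does not vanish on it.\<close>

lemma dim_eigenspace:
  assumes "\<epsilon> \<noteq> 0"
  shows "functionals.dim {\<mu> \<in> generalized_eigenspace S R (1 / 2 ^ k).
     dual_op (V_eps \<epsilon>) \<mu> = (\<lambda>g. 1 / 2 ^ k * \<mu> g)} = 1"
proof (rule functionals_dim_eqI[where x = "\<lambda>i. ortho_poly 0 \<otimes>\<^sub>L ortho_poly k" and m = root_vector])
  let ?I = "{\<mu> \<in> generalized_eigenspace S R (1 / 2 ^ k). dual_op (V_eps \<epsilon>) \<mu> = (\<lambda>g. 1 / 2 ^ k * \<mu> g)}"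
  have d: "dual_op (V_eps \<epsilon>) 0 = 0" "dual_op (V_eps \<epsilon>) (\<mu> + \<nu>) = dual_op (V_eps \<epsilon>) \<mu> + dual_op (V_eps \<epsilon>) \<nu>"
    "dual_op (V_eps \<epsilon>) (\<lambda>x. c * \<mu> x) = (\<lambda>x. c * dual_op (V_eps \<epsilon>) \<mu> x)" for \<mu> \<nu> c
    by (auto simp: dual_op_def fun_eq_iff)
  show "functionals.subspace ?I"
    using subspace_generalized_eigenspace unfolding functionals.subspace_def
    by (auto simp: d fun_eq_iff add_divide_distrib)
  show "\<mu> = 0" if \<mu>: "\<mu> \<in> ?I" and 0: "\<And>i :: nat. i < 1 \<Longrightarrow> \<mu> (ortho_poly 0 \<otimes>\<^sub>L ortho_poly k) = 0" for \<mu>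
  proof (rule generalized_eigenspace_eq_0)
    show m: "\<mu> \<in> generalized_eigenspace S R (1 / 2 ^ k)" using \<mu> by simp
    obtain M a where a: "\<mu> = coord_functional M a" "coord_nilpotent \<epsilon> k M a"
      using generalized_eigenspace_coord[OF m] .
    have "\<forall>i\<le>M. \<forall>j. coord_nilpotent_part \<epsilon> k M a i j = 0"
      using \<mu> dual_op_eigen_iff[OF a(2)] unfolding a(1) by blast
    then show "\<mu> (ortho_poly i \<otimes>\<^sub>L ortho_poly (k - i)) = 0" if "i \<le> k" for i
      using eigenvector_diagonal[OF assms a(2) _ _ that] 0[of 0] unfolding a(1) by (cases "i = 0") auto
  qed
  show "root_vector i \<in> ?I" if "i < 1" for i using that root_vector_in root_vector_eigen by simp
  show "root_vector i (ortho_poly 0 \<otimes>\<^sub>L ortho_poly k) \<noteq> 0" if "i < 1" for i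
    using that root_vector_diagonal[of 0 0] cinner_eigen_ortho(2)[of 0] by simp
qed simp

end

text \<open>Isolation singles out the powers of 1/2 among the singularities, and
  \<open>root_vector 0\<close> is an eigenvector for each of them.\<close>

lemma generalized_eigenvalues_V_eps:
  assumes \<epsilon>: "0 \<le> \<epsilon>" "\<epsilon> \<le> 1" and R: "generalized_resolvent (V_eps \<epsilon>) S R"
  shows "generalized_eigenvalues (V_eps \<epsilon>) S = {1 / 2 ^ k | k :: nat. True}"
proof -
  have "\<exists>\<mu>\<in>X_plus_dual. \<mu> \<noteq> 0 \<and> dual_op (V_eps \<epsilon>) \<mu> = (\<lambda>g. 1 / 2 ^ k * \<mu> g)" for k
    using root_vector_nonzero[OF \<epsilon> R] root_vector_eigen[OF \<epsilon> R] root_vector_coord[OF \<epsilon> R] coord_functional_in_dual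
    by metis
  then show ?thesis
    unfolding generalized_eigenvalues_def generalized_resolvent_unique(1)[OF \<epsilon> R] isolated_in_singular_set_iff
    by auto
qed

theorem theorem4p14:
  fixes \<epsilon> :: real
  assumes "0 \<le> \<epsilon>" and "\<epsilon> \<le> 1"
  shows
    "((\<exists>S R. generalized_resolvent (V_eps \<epsilon>) S R) \<and>
      (\<forall>S R. generalized_resolvent (V_eps \<epsilon>) S R \<longrightarrow>
         generalized_eigenvalues (V_eps \<epsilon>) S = {1 / 2 ^ k | k :: nat. True})) \<and>
     (\<forall>S R. generalized_resolvent (V_eps \<epsilon>) S R \<longrightarrow> (\<forall>k :: nat.
         functionals.subspace (generalized_eigenspace S R (1 / 2 ^ k)) \<and>
         functionals.dim (generalized_eigenspace S R (1 / 2 ^ k)) = k + 1 \<and>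
         (\<epsilon> \<noteq> 0 \<longrightarrow>
            algebraic_multiplicity S R (1 / 2 ^ k) = k + 1 \<and>
            geometric_multiplicity (V_eps \<epsilon>) S R (1 / 2 ^ k) = 1))) \<and>
     ((\<exists>S R. generalized_resolvent V_L S R) \<and>
      (\<forall>S R. generalized_resolvent V_L S R \<longrightarrow>
         generalized_eigenvalues V_L S = {1 / 2 ^ k | k :: nat. True}) \<and>
      (\<forall>S R. generalized_resolvent V_L S R \<longrightarrow> (\<forall>k :: nat.
         functionals.subspace (generalized_eigenspace S R (1 / 2 ^ k)) \<and>
         functionals.dim (generalized_eigenspace S R (1 / 2 ^ k)) = k + 1 \<and>
         algebraic_multiplicity S R (1 / 2 ^ k) = k + 1 \<and>
         geometric_multiplicity V_L S R (1 / 2 ^ k) = 1)))"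
proof -
  have mult: "functionals.subspace (generalized_eigenspace S R (1 / 2 ^ k)) \<and>
      functionals.dim (generalized_eigenspace S R (1 / 2 ^ k)) = k + 1 \<and>
      algebraic_multiplicity S R (1 / 2 ^ k) = k + 1 \<and>
      (e \<noteq> 0 \<longrightarrow> geometric_multiplicity (V_eps e) S R (1 / 2 ^ k) = 1)"
    if "0 \<le> e" "e \<le> 1" "generalized_resolvent (V_eps e) S R" for e S R k
    unfolding algebraic_multiplicity_def geometric_multiplicity_def
    by (intro conjI impI subspace_generalized_eigenspace[OF that] dim_generalized_eigenspace[OF that]
        dim_eigenspace[OF that])
  \<comment> \<open>The case e = 1 of \<open>mult\<close> and of the spectral statement covers the
    two-sided shift.\<close>
  have one: "0 \<le> (1 :: real)" "(1 :: real) \<le> 1" by simp_all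
  show ?thesis
    unfolding V_L_eq_V_eps_1
  proof (intro conjI)
    show "\<exists>S R. generalized_resolvent (V_eps \<epsilon>) S R" "\<exists>S R. generalized_resolvent (V_eps 1) S R"
      using generalized_resolvent_continued[OF assms] generalized_resolvent_continued[OF one] by blast+
  next
    show "\<forall>S R. generalized_resolvent (V_eps \<epsilon>) S R \<longrightarrow>
        generalized_eigenvalues (V_eps \<epsilon>) S = {1 / 2 ^ k | k :: nat. True}"
      by (intro allI impI generalized_eigenvalues_V_eps[OF assms])
    show "\<forall>S R. generalized_resolvent (V_eps 1) S R \<longrightarrow>
        generalized_eigenvalues (V_eps 1) S = {1 / 2 ^ k | k :: nat. True}"
      by (intro allI impI generalized_eigenvalues_V_eps[OF one])
  next
    show "\<forall>S R. generalized_resolvent (V_eps \<epsilon>) S R \<longrightarrow> (\<forall>k :: nat.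
         functionals.subspace (generalized_eigenspace S R (1 / 2 ^ k)) \<and>
         functionals.dim (generalized_eigenspace S R (1 / 2 ^ k)) = k + 1 \<and>
         (\<epsilon> \<noteq> 0 \<longrightarrow>
            algebraic_multiplicity S R (1 / 2 ^ k) = k + 1 \<and>
            geometric_multiplicity (V_eps \<epsilon>) S R (1 / 2 ^ k) = 1))"
      using mult[OF assms] by simp
    show "\<forall>S R. generalized_resolvent (V_eps 1) S R \<longrightarrow> (\<forall>k :: nat.
         functionals.subspace (generalized_eigenspace S R (1 / 2 ^ k)) \<and>
         functionals.dim (generalized_eigenspace S R (1 / 2 ^ k)) = k + 1 \<and>
         algebraic_multiplicity S R (1 / 2 ^ k) = k + 1 \<and>
         geometric_multiplicity (V_eps 1) S R (1 / 2 ^ k) = 1)"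
      using mult[OF one] by simp
  qed
qed

end
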